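(* Let $f_{\alpha}, f_{\beta}: \mathbb{N} \rightarrow \mathbb{R}_{\ge 0}$ be two monotonically non-decreasing computable functions such that $1 \le f_{\alpha}(1)$ and $2 \le f_{\alpha}(1) + f_{\beta}(1)$. Unless $\mathsf{NP} \subseteq \mathsf{coNP}/\mathrm{poly}$, the problem \textsc{Directed Linear Spanner} (with these functions), parameterized by the number of vertices $|V(D)|$ of the input digraph, does not admit a polynomial compression of size $\mathcal{O}(|V(D)|^{2-\epsilon})$ for any $\epsilon > 0$; this holds even when the input digraph $D$ is restricted to be a directed acyclic graph.
   Context: Digraphs are finite, without loops or parallel arcs. For a digraph $D$ with vertex set $V(D)$ and arc set $A(D)$, and vertices $u,v$, $\mathsf{dist}(u,v,D)$ is the length (number of arcs) of a shortest directed path from $u$ to $v$ in $D$, and $\mathsf{dist}(u,v,D)=+\infty$ if there is no such path. A spanning subgraph $H$ of $D$ is a subgraph with $V(H)=V(D)$. \textsc{Directed Linear Spanner}: the input is a digraph $D$, two monotonically non-decreasing computable functions $f_{\alpha}, f_{\beta}: \mathbb{N} \rightarrow \mathbb{R}_{\ge 0}$ (each assumed encodable with a constant number of bits), and a positive integer $k$. The question is whether there exists a spanning subgraph $H$ of $D$ with at most $|A(D)| - k$ arcs such that $\mathsf{dist}(u,v,H) \le f_{\alpha}(\mathsf{dist}(u,v,D)) \cdot \mathsf{dist}(u,v,D) + f_{\beta}(\mathsf{dist}(u,v,D))$ for every pair of vertices $u,v$. A polynomial compression of a parameterized language $\mathcal{Q} \subseteq \Sigma^* \times \mathbb{N}$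 into a language $\mathcal{R} \subseteq \Sigma^*$ is an algorithm that, given $(x,n) \in \Sigma^*\times\mathbb{N}$, runs in time polynomial in $|x|+n$ and outputs a string $y$ with $|y| \le p(n)$ for some polynomial $p$ such that $y \in \mathcal{R}$ if and only if $(x,n) \in \mathcal{Q}$. A polynomial compression of size $\mathcal{O}(g(n))$ is one whose output has bit-length $\mathcal{O}(g(n))$; here $\mathcal{R}$ may be an arbitrary language. *)

theory Defs
  imports
    Complex_Main
    "HOL-Library.Extended_Real"
    "HOL-Library.Landau_Symbols"
    "HOL-Computational_Algebra.Polynomial"
    "Graph_Theory.Graph_Theory"
begin

section \<open>Turing machines\<close>

text \<open>
  Deterministic multi-tape Turing machines with two-way infinite tapes. A machine has the running
  states \<open>{..<num_states M}\<close> with start state \<open>0\<close>; the state \<open>num_states M\<close> is the halting state.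
  The tape symbols are \<open>{..<num_symbols M}\<close>: \<open>0\<close> is the blank, and \<open>1\<close> and \<open>2\<close> stand for the bits
  \<open>False\<close> and \<open>True\<close>. The input is on the first tape, the output is read off the last one.
\<close>

datatype move = Move_Left | Move_Stay | Move_Right

record tm =
  num_tapes :: nat
  num_symbols :: nat
  num_states :: nat
  delta :: "nat \<Rightarrow> nat list \<Rightarrow> nat \<times> (nat \<times> move) list"

definition tm_wf :: "tm \<Rightarrow> bool" where
  "tm_wf M \<longleftrightarrow> num_tapes M \<ge> 1 \<and> num_symbols M \<ge> 3 \<and>
     (\<forall>q < num_states M. \<forall>rs. length rs = num_tapes M \<and> set rs \<subseteq> {..<num_symbols M} \<longrightarrow>
        (case delta M q rs of (q', as) \<Rightarrow>
           q' \<le> num_states M \<and> length as = num_tapes M \<and> fst ` set as \<subseteq> {..<num_symbols M}))"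

type_synonym tape = "(int \<Rightarrow> nat) \<times> int"
type_synonym config = "nat \<times> tape list"

fun shift :: "move \<Rightarrow> int" where
  "shift Move_Left = -1"
| "shift Move_Stay = 0"
| "shift Move_Right = 1"

fun act :: "tape \<Rightarrow> nat \<times> move \<Rightarrow> tape" where
  "act (t, h) (a, m) = (t(h := a), h + shift m)"

fun tm_step :: "tm \<Rightarrow> config \<Rightarrow> config" where
  "tm_step M (q, ts) =
     (if q < num_states M
      then (case delta M q (map (\<lambda>(t, h). t h) ts) of (q', as) \<Rightarrow> (q', map2 act ts as))
      else (q, ts))"

definition string_tape :: "bool list \<Rightarrow> int \<Rightarrow> nat" where
  "string_tape x i =
     (if 0 \<le> i \<and> i < int (length x) then (if x ! nat i then 2 else 1) else 0)"

definition tm_init :: "tm \<Rightarrow> bool list \<Rightarrow> config" where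
  "tm_init M x =
     (0, map (\<lambda>i. (if i = 0 then string_tape x else (\<lambda>_. 0), 0)) [0..<num_tapes M])"

definition tm_outputs :: "tm \<Rightarrow> bool list \<Rightarrow> nat \<Rightarrow> bool list \<Rightarrow> bool" where
  "tm_outputs M x t y \<longleftrightarrow>
     (case (tm_step M ^^ t) (tm_init M x) of (q, ts) \<Rightarrow>
        q = num_states M \<and> fst (last ts) = string_tape y)"

definition computable :: "(bool list \<Rightarrow> bool list) \<Rightarrow> bool" where
  "computable F \<longleftrightarrow> (\<exists>M. tm_wf M \<and> (\<forall>x. \<exists>t. tm_outputs M x t (F x)))"

definition poly_time :: "(bool list \<Rightarrow> bool list) \<Rightarrow> bool" where
  "poly_time F \<longleftrightarrow>
     (\<exists>M (p :: nat poly). tm_wf M \<and> (\<forall>x. \<exists>t \<le> poly p (length x). tm_outputs M x t (F x)))"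


section \<open>Encodings of pairs and numbers\<close>

definition pair_enc :: "bool list \<Rightarrow> bool list \<Rightarrow> bool list" where
  "pair_enc x y = replicate (length x) True @ [False] @ x @ y"

definition unary :: "nat \<Rightarrow> bool list" where
  "unary n = replicate n True"

text \<open>Binary representation, least significant bit first, without leading zeros.\<close>

fun binary :: "nat \<Rightarrow> bool list" where
  "binary n = (if n = 0 then [] else odd n # binary (n div 2))"

declare binary.simps [simp del]


section \<open>Complexity classes\<close>

type_synonym language = "bool list set"

definition class_P :: "language set" where
  "class_P = {L. poly_time (\<lambda>x. [x \<in> L])}"

definition NP :: "language set" where
  "NP = {L. \<exists>V \<in> class_P. \<exists>p :: nat poly.
           \<forall>x. x \<in> L \<longleftrightarrow> (\<exists>w. length w \<le> poly p (length x) \<and> pair_enc x w \<in> V)}"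

definition coNP :: "language set" where
  "coNP = {L. - L \<in> NP}"

text \<open>\<open>C/poly\<close>: the class \<open>C\<close> with polynomial-length advice depending only on the input length.\<close>

definition with_poly_advice :: "language set \<Rightarrow> language set" where
  "with_poly_advice C = {L. \<exists>L' \<in> C. \<exists>(a :: nat \<Rightarrow> bool list) (p :: nat poly).
     (\<forall>n. length (a n) \<le> poly p n) \<and>
     (\<forall>x. x \<in> L \<longleftrightarrow> pair_enc x (a (length x)) \<in> L')}"


section \<open>Polynomial compression\<close>

type_synonym parameterized_language = "(bool list \<times> nat) set"

text \<open>
  \<open>admits_poly_compression I Q g\<close>: the problem \<open>Q\<close>, with inputs restricted to the instances in \<open>I\<close>,
  has a polynomial compression of size \<open>O(g)\<close> into some language. The unrestricted problem is the
  case \<open>I = UNIV\<close>. The parameter is handed to the machine in unary, so that the length of its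
  input, and hence its running time, is polynomial in \<open>|x| + n\<close>.
  The bound by \<open>p\<close> holds for all \<open>n\<close>, whereas the \<open>O\<close>-bound only concerns large \<open>n\<close>.
\<close>

definition admits_poly_compression ::
  "(bool list \<times> nat) set \<Rightarrow> parameterized_language \<Rightarrow> (nat \<Rightarrow> real) \<Rightarrow> bool" where
  "admits_poly_compression I Q g \<longleftrightarrow>
     (\<exists>(R :: language) F (p :: nat poly) (s :: nat \<Rightarrow> nat).
        poly_time F \<and> (\<lambda>n. real (s n)) \<in> O(g) \<and>
        (\<forall>(x, n) \<in> I.
           length (F (pair_enc x (unary n))) \<le> poly p n \<and>
           length (F (pair_enc x (unary n))) \<le> s n \<and>
           (F (pair_enc x (unary n)) \<in> R \<longleftrightarrow> (x, n) \<in> Q)))"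


section \<open>Computable real-valued functions\<close>

text \<open>
  Computability in the sense of computable analysis: on input \<open>n\<close> and \<open>m\<close> a machine produces a
  dyadic approximation \<open>a / 2^m\<close> of \<open>f n\<close> with error at most \<open>2^-m\<close>. The numerator is a natural
  number, so this applies to nonnegative functions only.
\<close>

definition computable_nonneg_real :: "(nat \<Rightarrow> real) \<Rightarrow> bool" where
  "computable_nonneg_real f \<longleftrightarrow>
     (\<exists>F. computable F \<and>
        (\<forall>n m. \<exists>a. F (pair_enc (unary n) (unary m)) = binary a \<and>
                   \<bar>f n - real a / 2 ^ m\<bar> \<le> 1 / 2 ^ m))"


section \<open>Directed Linear Spanner\<close>

definition ddist :: "'a pair_pre_digraph \<Rightarrow> 'a \<Rightarrow> 'a \<Rightarrow> enat" where
  "ddist D u v = (INF p \<in> {p. pre_digraph.apath (with_proj D) u p v}. enat (length p))"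

text \<open>
  The right-hand side of the spanner inequality is \<open>\<infinity>\<close> for \<open>ddist D u v = \<infinity>\<close>, so only pairs at
  finite distance are constrained.
\<close>

definition linear_spanner ::
  "(nat \<Rightarrow> real) \<Rightarrow> (nat \<Rightarrow> real) \<Rightarrow> 'a pair_pre_digraph \<Rightarrow> 'a pair_pre_digraph \<Rightarrow> bool" where
  "linear_spanner f\<^sub>\<alpha> f\<^sub>\<beta> D H \<longleftrightarrow>
     spanning (with_proj H) (with_proj D) \<and>
     (\<forall>u \<in> pverts D. \<forall>v \<in> pverts D. \<forall>d :: nat. ddist D u v = enat d \<longrightarrow>
        ereal_of_enat (ddist H u v) \<le> ereal (f\<^sub>\<alpha> d * real d + f\<^sub>\<beta> d))"

text \<open>
  Input digraphs have the vertex set \<open>{..<n}\<close> and are given by \<open>n\<close> in unary and their adjacency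
  matrix, row by row; the number \<open>k\<close> follows in binary.
\<close>

definition instance_enc :: "nat pair_pre_digraph \<Rightarrow> nat \<Rightarrow> bool list" where
  "instance_enc D k =
     (let n = card (pverts D) in
        unary n @ [False] @
        concat (map (\<lambda>u. map (\<lambda>v. (u, v) \<in> parcs D) [0..<n]) [0..<n]) @
        binary k)"

definition input_digraph :: "nat pair_pre_digraph \<Rightarrow> bool" where
  "input_digraph D \<longleftrightarrow> pair_digraph D \<and> pverts D = {..<card (pverts D)}"

definition directed_linear_spanner ::
  "(nat \<Rightarrow> real) \<Rightarrow> (nat \<Rightarrow> real) \<Rightarrow> parameterized_language" where
  "directed_linear_spanner f\<^sub>\<alpha> f\<^sub>\<beta> =
     {(instance_enc D k, card (pverts D)) | D k.
        input_digraph D \<and> k > 0 \<and>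
        (\<exists>H. linear_spanner f\<^sub>\<alpha> f\<^sub>\<beta> D H \<and> card (parcs H) + k \<le> card (parcs D))}"

definition dag_instances :: "(bool list \<times> nat) set" where
  "dag_instances =
     {(instance_enc D k, card (pverts D)) | D k.
        input_digraph D \<and> k > 0 \<and> acyclic (parcs D)}"

end

theory Submission
  imports Defs
begin

text \<open>
  Let \<open>L \<in> NP\<close>. For every input length \<open>m\<close> there is a CNF of size polynomial in \<open>m\<close> with input variables
  \<open>X\<^sub>0, \<dots>, X\<^sub>m\<^sub>-\<^sub>1\<close> that is satisfiable with \<open>X = x\<close> iff \<open>x \<in> L\<close>. From \<open>s\<^sup>2\<close> strings \<open>x\<^sub>i\<^sub>j\<close> of
  length \<open>m\<close> we build a DAG with \<open>s \<cdot> poly(m)\<close> vertices: a source \<open>u\<^sub>i\<close> for every \<open>i\<close>, a vertex for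
  every literal and every clause, arcs from the sources to the literals, from the literals to the
  clauses containing them, and from \<open>u\<^sub>i\<close> to the clauses of row \<open>i\<close>. With
  \<open>b = \<lfloor>f\<^sub>\<alpha> 1 + f\<^sub>\<beta> 1\<rfloor>\<close>, each arc from a source to a literal has a detour of length \<open>b\<close>,
  so it may be deleted, but then this literal no longer provides a detour for the arcs from that source to
  the clauses. Hence the minimum number of arcs of a spanner is a constant plus the sum over \<open>i\<close> of the
  minimum hitting sets of the clauses of row \<open>i\<close>. Row \<open>i\<close> contains the CNF, variables
  \<open>q\<^sub>j\<close> selecting a column, and the clauses \<open>q\<^sub>j \<longrightarrow> X\<^sub>l = x\<^sub>i\<^sub>j[l]\<close>; an escape literal makes its minimum
  one of two consecutive numbers, the smaller one iff some \<open>x\<^sub>i\<^sub>j\<close> lies in \<open>L\<close>. So a threshold on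
  the number of arcs expresses the disjunction over all \<open>i, j\<close>.

  If \<open>s\<close> is a large power of \<open>m\<close>, a compression to size \<open>O(n\<^sup>2\<^sup>-\<^sup>\<epsilon>)\<close> maps such a DAG to at most
  \<open>s\<^sup>2\<close> bits. By the pigeonhole principle (Fortnow and Santhanam, Dell and van Melkebeek), among the
  tuples of nonmembers there are an output \<open>y\<close> and a position \<open>(i, j)\<close> such that a quarter of all
  nonmembers of length \<open>m\<close> occurs at this position in tuples mapped to \<open>y\<close>. Iterating on the remaining
  nonmembers, \<open>O(m)\<close> such triples \<open>(i, j, y)\<close> cover all of them. They form the advice: a certificate
  for \<open>x \<notin> L\<close> is a tuple with \<open>x\<close> at position \<open>(i, j)\<close> that is mapped to \<open>y\<close>.

  The graph never has to be computed: its adjacency matrix, with the entries depending on the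
  \<open>x\<^sub>i\<^sub>j\<close> left open, is part of the advice, and the certificate fills in these entries.
\<close>

text \<open>The grid is what puts the threshold at exponent \<open>2\<close>: a string
  \<open>x i j\<close> is stored in the arcs between row \<open>i\<close> and column
  \<open>j\<close>, so \<open>s\<^sup>2\<close> strings cost only \<open>s\<close> times a
  polynomial in \<open>m\<close> many vertices. At most \<open>s\<^sup>2\<close> output bits then
  mean about one bit per string, too little to record which nonmembers were used. The hypotheses on
  the functions enter through \<open>b\<close>. From
  \<open>2 \<le> f\<^sub>\<alpha> 1 + f\<^sub>\<beta> 1\<close> comes \<open>b \<ge> 2\<close>, so
  the way over a kept literal is short enough to replace an arc to a clause. From
  \<open>1 \<le> f\<^sub>\<alpha> 1\<close> and monotonicity the bound at distance \<open>d\<close>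
  is at least \<open>b + d - 1\<close>, so the excess \<open>b - 1\<close> of one detour is
  tolerated at every distance. Rounding down makes \<open>b + 1\<close> too long for a single arc.
  The only concrete machine is the verifier. It checks a certificate in one pass from left to right,
  and this dictates the numbering of the vertices: the bits of \<open>x\<close> must occur in order,
  and each bit right before its complement.\<close>

section \<open>Programs on tapes\<close>

text \<open>
  A program with states \<open>0, \<dots>, k\<close> is a pair of its halting state \<open>k\<close> and its transition function. It acts on
  infinitely many tapes, so that programs can be composed without adjusting the number of tapes.
\<close>

type_synonym tapes = "nat \<Rightarrow> tape"
type_synonym action = "nat \<Rightarrow> nat \<times> move"
type_synonym prog = "nat \<times> (nat \<Rightarrow> (nat \<Rightarrow> nat) \<Rightarrow> nat \<times> action)"

definition rd :: "tapes \<Rightarrow> nat \<Rightarrow> nat" where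
  "rd f i = fst (f i) (snd (f i))"

definition apply_acts :: "tapes \<Rightarrow> action \<Rightarrow> tapes" where
  "apply_acts f A = (\<lambda>i. act (f i) (A i))"

inductive steps :: "prog \<Rightarrow> nat \<Rightarrow> tapes \<Rightarrow> nat \<Rightarrow> tapes \<Rightarrow> bool" for p where
  halt: "steps p (fst p) f 0 f"
| step: "q < fst p \<Longrightarrow> snd p q (rd f) = (q', A) \<Longrightarrow> steps p q' (apply_acts f A) n f' \<Longrightarrow>
    steps p q f (Suc n) f'"

text \<open>The halting state \<open>fst p1\<close> of the first program coincides with the shifted
  start state \<open>0\<close> of the second. No linking step is needed, and running times simply
  add up.\<close>

definition pseq :: "prog \<Rightarrow> prog \<Rightarrow> prog" (infixr \<open>;;\<close> 60) where
  "p1 ;; p2 = (fst p1 + fst p2, \<lambda>q r. if q < fst p1 then snd p1 q r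
     else (case snd p2 (q - fst p1) r of (q', A) \<Rightarrow> (fst p1 + q', A)))"

lemma steps_pseq2: "steps p2 q f n f' \<Longrightarrow> steps (pseq p1 p2) (fst p1 + q) f n f'"
proof (induction rule: steps.induct)
  case (halt f)
  then show ?case using steps.halt[of "pseq p1 p2" f] by (simp add: pseq_def)
next
  case (step q f q' A n f')
  then show ?case by (intro steps.step[where q' = "fst p1 + q'" and A = A]) (auto simp: pseq_def)
qed

lemma steps_pseq:
  "steps p1 q f n f' \<Longrightarrow> steps p2 0 f' n' f'' \<Longrightarrow> steps (pseq p1 p2) q f (n + n') f''"
proof (induction rule: steps.induct)
  case (halt f)
  then show ?case using steps_pseq2[of p2 0 f n' f'' p1] by simp
next
  case (step q f q' A n f')
  then have "steps (pseq p1 p2) q f (Suc (n + n')) f''"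
    by (intro steps.step[where q' = q' and A = A]) (auto simp: pseq_def)
  then show ?case by simp
qed

text \<open>The condition on the tapes \<open>i \<ge> K\<close> makes it harmless to cut them off
  when the program becomes a machine with \<open>K\<close> tapes.\<close>

definition prog_ok :: "nat \<Rightarrow> nat \<Rightarrow> prog \<Rightarrow> bool" where
  "prog_ok K S p \<longleftrightarrow> (\<forall>q < fst p. \<forall>r q' A. (\<forall>i. r i < S) \<longrightarrow> snd p q r = (q', A) \<longrightarrow>
     q' \<le> fst p \<and> (\<forall>i. fst (A i) < S) \<and> (\<forall>i \<ge> K. A i = (r i, Move_Stay)))"

lemma prog_okD:
  assumes "prog_ok K S p" "q < fst p" "\<forall>i. r i < S" "snd p q r = (q', A)"
  shows "q' \<le> fst p" "fst (A i) < S" "i \<ge> K \<Longrightarrow> A i = (r i, Move_Stay)"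
  using assms unfolding prog_ok_def by blast+

lemma prog_okI:
  assumes "\<And>q r q' A. q < fst p \<Longrightarrow> (\<forall>i. r i < S) \<Longrightarrow> snd p q r = (q', A) \<Longrightarrow>
     q' \<le> fst p \<and> (\<forall>i. fst (A i) < S) \<and> (\<forall>i \<ge> K. A i = (r i, Move_Stay))"
  shows "prog_ok K S p"
  using assms unfolding prog_ok_def by blast

lemma prog_ok_pseq:
  assumes "prog_ok K S p1" "prog_ok K S p2"
  shows "prog_ok K S (pseq p1 p2)"
proof (rule prog_okI)
  fix q r q' A
  assume q: "q < fst (pseq p1 p2)" and r: "\<forall>i. r i < S" and e: "snd (pseq p1 p2) q r = (q', A)"
  show "q' \<le> fst (pseq p1 p2) \<and> (\<forall>i. fst (A i) < S) \<and> (\<forall>i \<ge> K. A i = (r i, Move_Stay))"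
  proof (cases "q < fst p1")
    case True
    then have "snd p1 q r = (q', A)" using e by (simp add: pseq_def)
    then show ?thesis using prog_okD[OF assms(1) True r] by (auto simp: pseq_def intro: trans_le_add1)
  next
    case False
    obtain q2 A2 where e2: "snd p2 (q - fst p1) r = (q2, A2)" by force
    have "q - fst p1 < fst p2" using False q by (auto simp: pseq_def)
    then show ?thesis using prog_okD[OF assms(2) _ r e2] e e2 False by (simp add: pseq_def)
  qed
qed

section \<open>From programs to Turing machines\<close>

definition compile :: "nat \<Rightarrow> nat \<Rightarrow> prog \<Rightarrow> tm" where
  "compile K S p = \<lparr>num_tapes = K, num_symbols = S, num_states = fst p,
     delta = \<lambda>q rs. case snd p q (\<lambda>i. if i < K then rs ! i else 0) of (q', A) \<Rightarrow> (q', map A [0..<K])\<rparr>"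

lemma tm_wf_compile:
  assumes "prog_ok K S p" "K \<ge> 1" "S \<ge> 3"
  shows "tm_wf (compile K S p)"
  unfolding tm_wf_def
proof (intro conjI allI impI)
  fix q rs
  assume q: "q < num_states (compile K S p)"
    and rs: "length rs = num_tapes (compile K S p) \<and> set rs \<subseteq> {..<num_symbols (compile K S p)}"
  obtain q' A where e: "snd p q (\<lambda>i. if i < K then rs ! i else 0) = (q', A)" by force
  have "\<forall>i. (if i < K then rs ! i else 0) < S"
    using rs assms(3) by (auto simp: compile_def subset_iff)
  then have "q' \<le> fst p \<and> (\<forall>i. fst (A i) < S)"
    using prog_okD[OF assms(1) _ _ e] q by (simp add: compile_def)
  then show "case delta (compile K S p) q rs of (q', as) \<Rightarrow> q' \<le> num_states (compile K S p) \<and>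
      length as = num_tapes (compile K S p) \<and> fst ` set as \<subseteq> {..<num_symbols (compile K S p)}"
    using e by (auto simp: compile_def)
qed (use assms in \<open>auto simp: compile_def\<close>)

lemma map2_act: "map2 act (map f [0..<K]) (map A [0..<K]) = map (apply_acts f A) [0..<K]"
  by (simp add: list_eq_iff_nth_eq apply_acts_def)

text \<open>The tapes from \<open>K\<close> on are blank at the start and never change, so reading
  \<open>0\<close> there, as \<open>compile\<close> does, agrees with the run of the
  program.\<close>

lemma compile_steps:
  assumes "steps p q f n f'" "prog_ok K S p" "S \<ge> 1"
    "\<forall>i \<ge> K. f i = (\<lambda>_. 0, 0)" "\<forall>i j. fst (f i) j < S"
  shows "(tm_step (compile K S p) ^^ n) (q, map f [0..<K]) = (fst p, map f' [0..<K])"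
  using assms
proof (induction rule: steps.induct)
  case (halt f)
  then show ?case by simp
next
  case (step q f q' A n f')
  have r: "(\<lambda>i. if i < K then map (\<lambda>(t, h). t h) (map f [0..<K]) ! i else 0) = rd f"
    using step.prems(3) by (auto simp: fun_eq_iff rd_def case_prod_beta)
  have ok: "(\<forall>i. fst (A i) < S) \<and> (\<forall>i \<ge> K. A i = (rd f i, Move_Stay))"
    using prog_okD[OF step.prems(1) step.hyps(1) _ step.hyps(2)] step.prems(4) by (simp add: rd_def)
  have 1: "tm_step (compile K S p) (q, map f [0..<K]) = (q', map (apply_acts f A) [0..<K])"
    using step.hyps(1,2) by (simp add: compile_def map2_act r del: map_map)
  have 2: "\<forall>i \<ge> K. apply_acts f A i = (\<lambda>_. 0, 0)"
    using ok step.prems(3) by (auto simp: apply_acts_def rd_def)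
  have 3: "\<forall>i j. fst (apply_acts f A i) j < S"
  proof (intro allI)
    fix i j
    show "fst (apply_acts f A i) j < S"
      using spec[OF conjunct1[OF ok], of i] step.prems(4)[rule_format, of i j]
      by (cases "f i"; cases "A i") (simp add: apply_acts_def)
  qed
  show ?case
    using step.IH[OF step.prems(1,2) 2 3] 1 by (simp add: funpow_swap1)
qed

text \<open>Apart from the simulation of \<open>M\<close>, all building blocks are loops with a
  single state. The exit step acts as well, so that a loop can place its heads for the next
  program.\<close>

definition while_prog :: "((nat \<Rightarrow> nat) \<Rightarrow> bool) \<Rightarrow> ((nat \<Rightarrow> nat) \<Rightarrow> action) \<Rightarrow> ((nat \<Rightarrow> nat) \<Rightarrow> action) \<Rightarrow> prog"
  where "while_prog c b e = (1, \<lambda>q r. if c r then (0, b r) else (1, e r))"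

lemma while_exit:
  assumes "\<not> c (rd f)" "f' = apply_acts f (e (rd f))"
  shows "steps (while_prog c b e) 0 f (Suc 0) f'"
  using assms steps.halt[of "while_prog c b e"]
  by (auto intro!: steps.step simp: while_prog_def)

lemma while_iter:
  assumes "c (rd f)" "steps (while_prog c b e) 0 (apply_acts f (b (rd f))) n f'"
  shows "steps (while_prog c b e) 0 f (Suc n) f'"
  using assms by (auto intro!: steps.step simp: while_prog_def)

lemma prog_ok_while:
  assumes "\<And>r i. (\<forall>i. r i < S) \<Longrightarrow> fst (b r i) < S \<and> fst (e r i) < S"
    "\<And>r i. i \<ge> K \<Longrightarrow> b r i = (r i, Move_Stay) \<and> e r i = (r i, Move_Stay)"
  shows "prog_ok K S (while_prog c b e)"
  using assms by (auto simp: prog_ok_def while_prog_def split: if_splits)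

definition once :: "((nat \<Rightarrow> nat) \<Rightarrow> action) \<Rightarrow> prog" where
  "once a = while_prog (\<lambda>_. False) a a"

lemma steps_once: "f' = apply_acts f (a (rd f)) \<Longrightarrow> steps (once a) 0 f (Suc 0) f'"
  unfolding once_def by (rule while_exit) auto

definition mv :: "move \<Rightarrow> nat set \<Rightarrow> (nat \<Rightarrow> nat) \<Rightarrow> action" where
  "mv m A r = (\<lambda>i. (r i, if i \<in> A then m else Move_Stay))"

definition shift_heads :: "int \<Rightarrow> nat set \<Rightarrow> tapes \<Rightarrow> tapes" where
  "shift_heads d A f = (\<lambda>i. if i \<in> A then (fst (f i), snd (f i) + d) else f i)"

lemma act_rd: "act (f i) (rd f i, m) = (fst (f i), snd (f i) + shift m)"
  by (cases "f i") (simp add: rd_def)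

lemma apply_mv: "apply_acts f (mv m A (rd f)) = shift_heads (shift m) A f"
  by (auto simp: apply_acts_def mv_def shift_heads_def act_rd fun_eq_iff)

lemma apply_upd: "apply_acts f (A(i := a)) = (apply_acts f A)(i := act (f i) a)"
  by (auto simp: apply_acts_def fun_eq_iff)

lemma shift_heads_shift_heads: "shift_heads d A (shift_heads e A f) = shift_heads (e + d) A f"
  by (auto simp: shift_heads_def fun_eq_iff)

lemma shift_heads_0: "shift_heads 0 A f = f"
  by (auto simp: shift_heads_def fun_eq_iff)

definition ltape :: "nat list \<Rightarrow> int \<Rightarrow> nat" where
  "ltape xs i = (if 0 \<le> i \<and> i < int (length xs) then xs ! nat i else 0)"

definition bit_sym :: "bool \<Rightarrow> nat" where "bit_sym b = (if b then 2 else 1)"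

lemma string_tape_ltape: "string_tape x = ltape (map bit_sym x)"
  by (auto simp: string_tape_def ltape_def fun_eq_iff bit_sym_def)

lemma ltape_write: "(ltape (xs @ [k]))(int (length xs) := c) = ltape (xs @ [c])"
  by (auto simp: ltape_def fun_eq_iff nth_append)

lemma ltape_snoc_0: "ltape (xs @ [0]) = ltape xs"
  by (auto simp: ltape_def fun_eq_iff nth_append)

lemma ltape_snoc: "(ltape xs)(int (length xs) := c) = ltape (xs @ [c])"
  using ltape_write[of xs 0 c] by (simp add: ltape_snoc_0)

lemma ltape_nth: "j < length xs \<Longrightarrow> ltape xs (int j) = xs ! j"
  by (simp add: ltape_def)

lemma ltape_beyond: "length xs \<le> j \<Longrightarrow> ltape xs (int j) = 0"
  by (simp add: ltape_def)

lemma ltape_neg: "i < 0 \<Longrightarrow> ltape xs i = 0"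
  by (simp add: ltape_def)

lemma nth_neq_0: "j < length xs \<Longrightarrow> (0::nat) \<notin> set xs \<Longrightarrow> xs ! j \<noteq> 0"
  by (metis nth_mem)

text \<open>The exit step leaves all heads on the last symbol, from where \<open>rewind\<close> can
  run back without meeting the blank at the end.\<close>

definition copy_prog :: "nat \<Rightarrow> nat set \<Rightarrow> prog" where
  "copy_prog i A = while_prog (\<lambda>r. r i \<noteq> 0)
     (\<lambda>r k. if k \<in> A then (r i, Move_Right) else if k = i then (r i, Move_Right) else (r k, Move_Stay))
     (mv Move_Left (insert i A))"

lemma copy_prog_steps:
  assumes "\<forall>k \<in> A. f k = (ltape (take j xs), int j)" "f i = (ltape xs, int j)" "i \<notin> A"
    "j \<le> length xs" "0 \<notin> set xs"
  shows "steps (copy_prog i A) 0 f (length xs - j + 1)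
    (\<lambda>k. if k \<in> insert i A then (ltape xs, int (length xs) - 1) else f k)"
  using assms
proof (induction "length xs - j" arbitrary: j f)
  case 0
  then have [simp]: "j = length xs" by simp
  have "steps (copy_prog i A) 0 f (Suc 0)
     (\<lambda>k. if k \<in> insert i A then (ltape xs, int (length xs) - 1) else f k)"
    unfolding copy_prog_def
    by (rule while_exit) (use 0 in \<open>auto simp: rd_def ltape_beyond apply_mv shift_heads_def fun_eq_iff\<close>)
  then show ?case by simp
next
  case (Suc n)
  then have j: "j < length xs" by simp
  have r: "rd f i = xs ! j" "xs ! j \<noteq> 0" using Suc.prems(2,5) j by (auto simp: rd_def ltape_nth nth_neq_0)
  define f' where "f' = (\<lambda>k. if k \<in> A then (ltape (take (Suc j) xs), int (Suc j))
    else if k = i then (ltape xs, int (Suc j)) else f k)"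
  have w: "(ltape (take j xs))(int j := xs ! j) = ltape (take (Suc j) xs)"
    using ltape_snoc[of "take j xs" "xs ! j"] j by (simp add: take_Suc_conv_app_nth min_def)
  have "steps (copy_prog i A) 0 f' (length xs - Suc j + 1)
    (\<lambda>k. if k \<in> insert i A then (ltape xs, int (length xs) - 1) else f' k)"
    by (rule Suc.hyps(1)) (use Suc j in \<open>auto simp: f'_def\<close>)
  also have "(\<lambda>k. if k \<in> insert i A then (ltape xs, int (length xs) - 1) else f' k) =
    (\<lambda>k. if k \<in> insert i A then (ltape xs, int (length xs) - 1) else f k)"
    by (auto simp: f'_def fun_eq_iff)
  also have "f' = apply_acts f ((\<lambda>r k. if k \<in> A then (r i, Move_Right) else if k = i then (r i, Move_Right) else (r k, Move_Stay)) (rd f))"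
    using Suc.prems r w j
    by (auto simp: f'_def apply_acts_def fun_eq_iff) (auto simp: ltape_def act_rd)
  finally have this': "steps (copy_prog i A) 0 (apply_acts f ((\<lambda>r k. if k \<in> A then (r i, Move_Right) else if k = i then (r i, Move_Right) else (r k, Move_Stay)) (rd f))) (length xs - Suc j + 1)
    (\<lambda>k. if k \<in> insert i A then (ltape xs, int (length xs) - 1) else f k)" .
  have "steps (copy_prog i A) 0 f (Suc (length xs - Suc j + 1))
    (\<lambda>k. if k \<in> insert i A then (ltape xs, int (length xs) - 1) else f k)"
    unfolding copy_prog_def by (rule while_iter) (use r this'[unfolded copy_prog_def] in auto)
  then show ?case using j by (simp add: Suc_diff_Suc)
qed

definition rewind :: "nat \<Rightarrow> nat set \<Rightarrow> prog" where
  "rewind i A = while_prog (\<lambda>r. r i \<noteq> 0) (mv Move_Left A) (mv Move_Right A)"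

text \<open>\<open>j\<close> is the head position plus one, so that \<open>j = 0\<close> is the head
  on the blank in cell \<open>-1\<close>, where the loop stops; the exit step then moves to cell
  \<open>0\<close>.\<close>

lemma rewind_steps:
  assumes "f i = (ltape xs, int j - 1)" "i \<in> A" "j \<le> length xs" "0 \<notin> set xs"
  shows "steps (rewind i A) 0 f (Suc j) (shift_heads (1 - int j) A f)"
  using assms
proof (induction j arbitrary: f)
  case 0
  then show ?case
    unfolding rewind_def by (intro while_exit) (auto simp: rd_def ltape_neg apply_mv)
next
  case (Suc j)
  have r: "rd f i = xs ! j" "xs ! j \<noteq> 0" using Suc.prems by (auto simp: rd_def ltape_nth nth_neq_0)
  have "steps (rewind i A) 0 (shift_heads (-1) A f) (Suc j) (shift_heads (1 - int j) A (shift_heads (-1) A f))"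
    by (rule Suc.IH) (use Suc in \<open>auto simp: shift_heads_def\<close>)
  note this' = this[unfolded rewind_def]
  show ?case
    unfolding rewind_def by (rule while_iter) (use r this' in \<open>auto simp: apply_mv shift_heads_shift_heads\<close>)
qed

text \<open>A run of \<open>True\<close>s on tape \<open>i\<close> acts as a number in unary that is
  added to the positions of the heads in \<open>A\<close>; this is how the length prefixes of
  \<open>pair_enc\<close> are used. The heads in \<open>B\<close> then move one more cell, past a
  separator.\<close>

definition scan :: "nat \<Rightarrow> nat set \<Rightarrow> nat set \<Rightarrow> prog" where
  "scan i A B = while_prog (\<lambda>r. r i = 2) (mv Move_Right A) (mv Move_Right B)"

definition ones_from :: "bool list \<Rightarrow> nat \<Rightarrow> nat" where
  "ones_from v h = length (takeWhile id (drop h v))"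

lemma string_tape_eq_2: "string_tape v (int h) = 2 \<longleftrightarrow> h < length v \<and> v ! h"
  by (auto simp: string_tape_def)

lemma ones_from_Suc: "string_tape v (int h) = 2 \<Longrightarrow> ones_from v h = Suc (ones_from v (Suc h))"
  by (auto simp: string_tape_eq_2 ones_from_def Cons_nth_drop_Suc[symmetric])

lemma ones_from_0: "string_tape v (int h) \<noteq> 2 \<Longrightarrow> ones_from v h = 0"
  by (cases "h < length v") (auto simp: string_tape_eq_2 ones_from_def Cons_nth_drop_Suc[symmetric])

lemma ones_from_le: "ones_from v h \<le> length v - h"
  unfolding ones_from_def by (metis length_drop length_takeWhile_le)

lemma scan_steps:
  assumes "f i = (string_tape v, int h)" "i \<in> A"
  shows "steps (scan i A B) 0 f (Suc (ones_from v h))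
    (shift_heads 1 B (shift_heads (int (ones_from v h)) A f))"
  using assms
proof (induction "ones_from v h" arbitrary: f h)
  case 0
  then have "rd f i \<noteq> 2" using ones_from_Suc[of v h] by (auto simp: rd_def)
  then show ?case unfolding 0(1)[symmetric]
    unfolding scan_def by (intro while_exit) (auto simp: rd_def apply_mv shift_heads_0)
next
  case (Suc n)
  then have r: "rd f i = 2" using ones_from_0[of v h] by (auto simp: rd_def)
  then have s: "ones_from v h = Suc (ones_from v (Suc h))"
    using ones_from_Suc Suc.prems by (auto simp: rd_def)
  have "steps (scan i A B) 0 (shift_heads 1 A f) (Suc (ones_from v (Suc h)))
     (shift_heads 1 B (shift_heads (int (ones_from v (Suc h))) A (shift_heads 1 A f)))"
    by (rule Suc.hyps(1)) (use Suc s in \<open>auto simp: shift_heads_def\<close>)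
  note this' = this[unfolded scan_def]
  show ?case
    unfolding s scan_def by (rule while_iter) (use r this' in \<open>auto simp: apply_mv shift_heads_shift_heads\<close>)
qed

lemma prog_ok_mv_while:
  assumes "A \<subseteq> {..<K}" "B \<subseteq> {..<K}"
  shows "prog_ok K S (while_prog c (mv m A) (mv m' B))"
  using assms by (intro prog_ok_while) (auto simp: mv_def)

lemma prog_ok_copy: "insert i A \<subseteq> {..<K} \<Longrightarrow> prog_ok K S (copy_prog i A)"
  unfolding copy_prog_def by (rule prog_ok_while) (auto simp: mv_def)

lemma prog_ok_rewind: "A \<subseteq> {..<K} \<Longrightarrow> prog_ok K S (rewind i A)"
  unfolding rewind_def by (rule prog_ok_mv_while)

lemma prog_ok_scan: "A \<subseteq> {..<K} \<Longrightarrow> B \<subseteq> {..<K} \<Longrightarrow> prog_ok K S (scan i A B)"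
  unfolding scan_def by (rule prog_ok_mv_while)

section \<open>A verifier for templates\<close>

text \<open>
  The advice is a word over the symbols \<open>1, \<dots>, 8\<close>, where \<open>c\<close> is written as \<open>True\<^sup>c False\<close>. A symbol
  \<open>1, \<dots>, 5\<close> prescribes one bit: \<open>1\<close> and \<open>2\<close> the bits \<open>False\<close> and \<open>True\<close>, \<open>3\<close> an arbitrary bit, \<open>4\<close> the
  next bit of the input, \<open>5\<close> the complement of the preceding bit. A block is a template over these symbols
  preceded by \<open>6\<close> and followed by \<open>7\<close> and the expected output in the symbols \<open>1\<close> and \<open>2\<close>;
  \<open>8\<close> marks the end of the advice.
\<close>

fun dec :: "nat \<Rightarrow> bool list \<Rightarrow> nat list" where
  "dec k [] = (if k = 0 then [] else [k])"
| "dec k (True # bs) = dec (min (Suc k) 8) bs"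
| "dec k (False # bs) = (if k = 0 then 8 else k) # dec 0 bs"

text \<open>The current cell of tape \<open>4\<close> is the counter: a \<open>True\<close>
  increments it in place, a \<open>False\<close> moves on to a fresh cell. The cap at
  \<open>8\<close> keeps the alphabet finite, and turning an empty count into \<open>8\<close> keeps
  the decoded word free of blanks, as rewinding requires.\<close>

definition decode_prog :: prog where
  "decode_prog = while_prog (\<lambda>r. r 1 \<noteq> 0)
     (\<lambda>r. (mv Move_Right {1} r)(4 := if r 1 = 2 then (min (Suc (r 4)) 8, Move_Stay)
        else (if r 4 = 0 then 8 else r 4, Move_Right)))
     (mv Move_Left {4})"

lemma ltape_last: "ltape (ys @ [k]) (int (length ys)) = k"
  by (simp add: ltape_def nth_append)

text \<open>The final head position depends on whether the word ends within a symbol, so only the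
  bound needed by \<open>rewind_steps\<close> is stated. The partial count \<open>k\<close> under
  the head generalizes the induction.\<close>

lemma decode_steps:
  assumes "f 1 = (string_tape v, int h)" "f 4 = (ltape (ys @ [k]), int (length ys))"
  shows "\<exists>j t. j \<le> length (ys @ dec k (drop h v)) \<and>
    steps decode_prog 0 f (Suc (length v - h))
      (f(1 := t, 4 := (ltape (ys @ dec k (drop h v)), int j - 1)))"
  using assms
proof (induction "length v - h" arbitrary: f h ys k)
  case 0
  have "steps decode_prog 0 f (Suc 0) (shift_heads (-1) {4} f)"
    unfolding decode_prog_def using 0
    by (intro while_exit) (auto simp: rd_def string_tape_def apply_mv)
  moreover have "shift_heads (-1) {4} f =
    f(1 := f 1, 4 := (ltape (ys @ dec k (drop h v)), int (length ys) - 1))"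
    using 0 by (auto simp: shift_heads_def fun_eq_iff ltape_snoc_0)
  ultimately have "steps decode_prog 0 f (Suc (length v - h))
     (f(1 := f 1, 4 := (ltape (ys @ dec k (drop h v)), int (length ys) - 1)))"
    by (simp only: 0(1)[symmetric])
  moreover have "length ys \<le> length (ys @ dec k (drop h v))" by simp
  ultimately show ?case by blast
next
  case (Suc n)
  then have h: "h < length v" by simp
  have d: "drop h v = v ! h # drop (Suc h) v" using h by (simp add: Cons_nth_drop_Suc)
  have r: "rd f 1 = bit_sym (v ! h)" "rd f 4 = k" "rd f (Suc 0) = bit_sym (v ! h)"
    using Suc.prems h by (auto simp: rd_def string_tape_def bit_sym_def ltape_last)
  define k' ys' where "k' = (if v ! h then min (Suc k) 8 else 0)"
    and "ys' = (if v ! h then ys else ys @ [if k = 0 then 8 else k])"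
  define f' where "f' = f(1 := (string_tape v, int (Suc h)), 4 := (ltape (ys' @ [k']), int (length ys')))"
  have D: "ys' @ dec k' (drop (Suc h) v) = ys @ dec k (drop h v)"
    by (cases "v ! h") (auto simp: d k'_def ys'_def)
  have "\<exists>j t. j \<le> length (ys' @ dec k' (drop (Suc h) v)) \<and>
    steps decode_prog 0 f' (Suc (length v - Suc h))
      (f'(1 := t, 4 := (ltape (ys' @ dec k' (drop (Suc h) v)), int j - 1)))"
    by (rule Suc.hyps(1)) (use Suc h in \<open>auto simp: f'_def\<close>)
  then obtain j t where j: "j \<le> length (ys @ dec k (drop h v))"
    and s: "steps decode_prog 0 f' (Suc (length v - Suc h))
      (f'(1 := t, 4 := (ltape (ys @ dec k (drop h v)), int j - 1)))"
    unfolding D by blast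
  have e1: "f'(1 := t, 4 := x) = f(1 := t, 4 := x)" for x by (auto simp: f'_def fun_eq_iff)
  have e0: "ltape (ys @ [a, 0]) = ltape (ys @ [a])" for a
    using ltape_snoc_0[of "ys @ [a]"] by simp
  have e4: "act (f 4) (if rd f 1 = 2 then (min (Suc (rd f 4)) 8, Move_Stay)
        else (if rd f 4 = 0 then 8 else rd f 4, Move_Right)) = (ltape (ys' @ [k']), int (length ys'))"
    using Suc.prems r by (auto simp: k'_def ys'_def bit_sym_def ltape_write e0)
  have e2: "apply_acts f ((mv Move_Right {1} (rd f))(4 := if rd f 1 = 2 then (min (Suc (rd f 4)) 8, Move_Stay)
        else (if rd f 4 = 0 then 8 else rd f 4, Move_Right))) = f'"
    unfolding apply_upd apply_mv e4 using Suc.prems(1)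
    by (intro ext) (simp add: shift_heads_def f'_def)
  have "steps decode_prog 0 f (Suc (Suc (length v - Suc h)))
      (f(1 := t, 4 := (ltape (ys @ dec k (drop h v)), int j - 1)))"
    unfolding decode_prog_def
    by (rule while_iter) (use r s[unfolded e1 decode_prog_def] e2 in \<open>auto simp: bit_sym_def\<close>)
  then have "steps decode_prog 0 f (Suc (length v - h))
      (f(1 := t, 4 := (ltape (ys @ dec k (drop h v)), int j - 1)))"
    unfolding Suc_diff_Suc[OF h] .
  with j show ?case by (intro exI[of _ j] exI[of _ t] conjI)
qed

text \<open>The decoded word does not end with the advice: the witness follows in the input and is
  decoded as well. Passing an \<open>8\<close> clears the verdict, so that no block forged inside
  the witness can be selected. The exit step checks that the selected position starts a
  block.\<close>

definition skip_prog :: "nat \<Rightarrow> prog" where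
  "skip_prog l = while_prog (\<lambda>r. r 3 = 2)
     (\<lambda>r. (mv Move_Right {3, 4} r)(l := (if r 4 = 8 then 1 else r l, Move_Stay)))
     (\<lambda>r. (mv Move_Right {3, 4} r)(l := (if r 4 = 6 then r l else 1, Move_Stay)))"

lemma ltape_single: "(ltape [a])(0 := c) = ltape [c]" "ltape [a] 0 = a"
  by (auto simp: ltape_def fun_eq_iff)

lemma skip_steps:
  assumes "f 3 = (string_tape v, int h)" "f 4 = (ltape D, int p)" "f l = (ltape [bit_sym ok], 0)" "l > 4"
  shows "steps (skip_prog l) 0 f (Suc (ones_from v h))
    (f(3 := (string_tape v, int (h + ones_from v h + 1)), 4 := (ltape D, int (p + ones_from v h + 1)),
       l := (ltape [bit_sym (ok \<and> (\<forall>i < ones_from v h. ltape D (int (p + i)) \<noteq> 8) \<and>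
                ltape D (int (p + ones_from v h)) = 6)], 0)))"
  using assms
proof (induction "ones_from v h" arbitrary: f h p ok)
  case 0
  then have "rd f 3 \<noteq> 2" using ones_from_Suc[of v h] by (auto simp: rd_def)
  then show ?case unfolding 0(1)[symmetric]
    unfolding skip_prog_def using 0(2-)
    by (intro while_exit) (auto simp: rd_def apply_upd apply_mv shift_heads_def fun_eq_iff ltape_single bit_sym_def
       fun_cong[OF ltape_single(1)[unfolded fun_upd_def]])
next
  case (Suc n)
  then have r: "rd f 3 = 2" using ones_from_0[of v h] by (auto simp: rd_def)
  then have s: "ones_from v h = Suc (ones_from v (Suc h))"
    using ones_from_Suc Suc.prems by (auto simp: rd_def)
  define f' where "f' = f(3 := (string_tape v, int (Suc h)), 4 := (ltape D, int (Suc p)),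
    l := (ltape [bit_sym (ok \<and> ltape D (int p) \<noteq> 8)], 0))"
  have e: "apply_acts f ((mv Move_Right {3, 4} (rd f))(l := (if rd f 4 = 8 then 1 else rd f l, Move_Stay))) = f'"
    using Suc.prems
    by (auto simp: rd_def apply_upd apply_mv shift_heads_def fun_eq_iff ltape_single bit_sym_def f'_def
       fun_cong[OF ltape_single(1)[unfolded fun_upd_def]])
  have all: "(\<forall>i < Suc m. P i) \<longleftrightarrow> P 0 \<and> (\<forall>i < m. P (Suc i))" for m and P :: "nat \<Rightarrow> bool"
    using less_Suc_eq_0_disj by auto
  have "steps (skip_prog l) 0 f' (Suc (ones_from v (Suc h)))
    (f'(3 := (string_tape v, int (Suc h + ones_from v (Suc h) + 1)),
       4 := (ltape D, int (Suc p + ones_from v (Suc h) + 1)),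
       l := (ltape [bit_sym ((ok \<and> ltape D (int p) \<noteq> 8) \<and> (\<forall>i < ones_from v (Suc h). ltape D (int (Suc p + i)) \<noteq> 8) \<and>
                ltape D (int (Suc p + ones_from v (Suc h))) = 6)], 0)))"
    by (rule Suc.hyps(1)) (use Suc s in \<open>auto simp: f'_def\<close>)
  also have "(f'(3 := (string_tape v, int (Suc h + ones_from v (Suc h) + 1)),
       4 := (ltape D, int (Suc p + ones_from v (Suc h) + 1)),
       l := (ltape [bit_sym ((ok \<and> ltape D (int p) \<noteq> 8) \<and> (\<forall>i < ones_from v (Suc h). ltape D (int (Suc p + i)) \<noteq> 8) \<and>
                ltape D (int (Suc p + ones_from v (Suc h))) = 6)], 0))) =
     (f(3 := (string_tape v, int (h + ones_from v h + 1)), 4 := (ltape D, int (p + ones_from v h + 1)),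
       l := (ltape [bit_sym (ok \<and> (\<forall>i < ones_from v h. ltape D (int (p + i)) \<noteq> 8) \<and>
                ltape D (int (p + ones_from v h)) = 6)], 0)))"
    using Suc.prems(4) unfolding s all by (auto simp: f'_def fun_eq_iff conj_assoc)
  finally show ?case
    unfolding skip_prog_def s
    by - (rule while_iter, use r in simp, simp only: e)
qed

definition symbol_ok :: "nat \<Rightarrow> bool \<Rightarrow> bool \<Rightarrow> bool \<Rightarrow> bool" where
  "symbol_ok c x b prev = (if c = 1 then \<not> b else if c = 2 then b else if c = 3 then True
     else if c = 4 then b = x else b \<noteq> prev)"

fun matches :: "nat list \<Rightarrow> (int \<Rightarrow> bool) \<Rightarrow> int \<Rightarrow> (int \<Rightarrow> bool) \<Rightarrow> int \<Rightarrow> bool \<Rightarrow> bool" where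
  "matches [] X hx W hw prev = True"
| "matches (c # cs) X hx W hw prev = (symbol_ok c (X hx) (W hw) prev \<and>
     matches cs X (if c = 4 then hx + 1 else hx) W (hw + 1) (W hw))"

text \<open>Checking and copying happen in the same pass: tape \<open>6\<close> receives the bits
  that become the input of \<open>M\<close>, the current cell of tape \<open>2\<close> remembers the
  previous bit, and the verdict in cell \<open>0\<close> of tape \<open>l\<close> can only fall from
  \<open>2\<close> to \<open>1\<close>.\<close>

definition match_prog :: "nat \<Rightarrow> prog" where
  "match_prog l = while_prog (\<lambda>r. 1 \<le> r 4 \<and> r 4 \<le> 5)
     (\<lambda>r i. if i = 0 then (r 0, if r 4 = 4 then Move_Right else Move_Stay)
        else if i = 2 then (bit_sym (r 3 = 2), Move_Stay)
        else if i = 3 \<or> i = 4 then (r i, Move_Right)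
        else if i = 6 then (bit_sym (r 3 = 2), Move_Right)
        else if i = l then (if symbol_ok (r 4) (r 0 = 2) (r 3 = 2) (r 2 = 2) then r l else 1, Move_Stay)
        else (r i, Move_Stay))
     (\<lambda>r. (mv Move_Right {4} r)(6 := (r 6, Move_Left)))"

lemma takeWhile_drop_Nil: "takeWhile P (drop p D) = [] \<longleftrightarrow> \<not> (p < length D \<and> P (D ! p))"
  by (cases "p < length D") (auto simp: Cons_nth_drop_Suc[symmetric])

lemma takeWhile_drop_Cons:
  "p < length D \<Longrightarrow> P (D ! p) \<Longrightarrow> takeWhile P (drop p D) = D ! p # takeWhile P (drop (Suc p) D)"
  by (auto simp: Cons_nth_drop_Suc[symmetric])

lemma match_steps:
  assumes "f 0 = (X, hx)" "f 2 = (P, hp)" "f 3 = (W, hw)" "f 4 = (ltape D, int p)"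
    "f 6 = (ltape ys, int (length ys))" "f l = (ltape [bit_sym ok], 0)" "l > 6"
    "cs = takeWhile (\<lambda>c. 1 \<le> c \<and> c \<le> 5) (drop p D)"
  shows "\<exists>f'. steps (match_prog l) 0 f (Suc (length cs)) f' \<and>
    f' 4 = (ltape D, int (p + length cs + 1)) \<and>
    f' 6 = (ltape (ys @ map (\<lambda>i. bit_sym (W (hw + int i) = 2)) [0..<length cs]),
            int (length ys + length cs) - 1) \<and>
    f' l = (ltape [bit_sym (ok \<and> matches cs (\<lambda>i. X i = 2) hx (\<lambda>i. W i = 2) hw (P hp = 2))], 0) \<and>
    (\<forall>i. i \<notin> {0, 2, 3, 4, 6, l} \<longrightarrow> f' i = f i)"
  using assms
proof (induction cs arbitrary: f hx P hp hw p ys ok)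
  case Nil
  then have np: "\<not> (p < length D \<and> (1 \<le> D ! p \<and> D ! p \<le> 5))"
    using Nil.prems(8)[symmetric] unfolding takeWhile_drop_Nil by simp
  then have "\<not> (1 \<le> rd f 4 \<and> rd f 4 \<le> 5)"
    using Nil.prems(4) by (auto simp: rd_def ltape_def)
  moreover define g where "g = apply_acts f ((mv Move_Right {4} (rd f))(6 := (rd f 6, Move_Left)))"
  ultimately have 1: "steps (match_prog l) 0 f (Suc 0) g"
    unfolding match_prog_def by (intro while_exit) auto
  have 2: "g 4 = (ltape D, int p + 1)" "g 6 = (ltape ys, int (length ys) - 1)"
    "\<forall>i. i \<notin> {4, 6} \<longrightarrow> g i = f i"
    using Nil.prems(4,5)
    by (auto simp: g_def apply_upd apply_mv shift_heads_def rd_def fun_upd_idem)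
  show ?case using Nil.prems(6,7) 1 2 by (intro exI[of _ g]) auto
next
  case (Cons c cs)
  have p: "p < length D" "1 \<le> D ! p" "D ! p \<le> 5"
    using Cons.prems(8) takeWhile_drop_Nil[of "\<lambda>c. 1 \<le> c \<and> c \<le> 5" p D] by auto
  have c: "c = D ! p" "cs = takeWhile (\<lambda>c. 1 \<le> c \<and> c \<le> 5) (drop (Suc p) D)"
    using Cons.prems(8) takeWhile_drop_Cons[of p D "\<lambda>c. 1 \<le> c \<and> c \<le> 5"] p by auto
  have r: "rd f 4 = c" "rd f 3 = W hw" "rd f 0 = X hx" "rd f 2 = P hp" "rd f l = bit_sym ok"
    using Cons.prems p c(1) by (auto simp: rd_def ltape_nth ltape_single)
  let ?b = "W hw = 2"
  define A where "A = (\<lambda>i. if i = 0 then (rd f 0, if rd f 4 = 4 then Move_Right else Move_Stay)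
        else if i = 2 then (bit_sym (rd f 3 = 2), Move_Stay)
        else if i = 3 \<or> i = 4 then (rd f i, Move_Right)
        else if i = 6 then (bit_sym (rd f 3 = 2), Move_Right)
        else if i = l then (if symbol_ok (rd f 4) (rd f 0 = 2) (rd f 3 = 2) (rd f 2 = 2) then rd f l else 1, Move_Stay)
        else (rd f i, Move_Stay))"
  define g where "g = apply_acts f A"
  have g0: "g 0 = (X, if c = 4 then hx + 1 else hx)"
    and g2: "g 2 = (P(hp := bit_sym ?b), hp)" and g3: "g 3 = (W, hw + 1)"
    and g6: "g 6 = (ltape (ys @ [bit_sym ?b]), int (length (ys @ [bit_sym ?b])))"
    and gl: "g l = (ltape [bit_sym (ok \<and> symbol_ok c (X hx = 2) ?b (P hp = 2))], 0)"
    and go: "\<forall>i. i \<notin> {0, 2, 3, 4, 6, l} \<longrightarrow> g i = f i"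
    using Cons.prems r
    by (auto simp: g_def A_def apply_acts_def ltape_snoc ltape_single bit_sym_def act_rd)
  have g4: "g 4 = (ltape D, int (Suc p))"
    using Cons.prems(4) by (simp add: g_def A_def apply_acts_def rd_def fun_upd_idem)
  have P2: "((P(hp := bit_sym ?b)) hp = 2) = ?b" by (auto simp: bit_sym_def)
  obtain f' where f': "steps (match_prog l) 0 g (Suc (length cs)) f'"
    "f' 4 = (ltape D, int (Suc p + length cs + 1))"
    "f' 6 = (ltape ((ys @ [bit_sym ?b]) @ map (\<lambda>i. bit_sym (W (hw + 1 + int i) = 2)) [0..<length cs]),
            int (length (ys @ [bit_sym ?b]) + length cs) - 1)"
    "f' l = (ltape [bit_sym ((ok \<and> symbol_ok c (X hx = 2) ?b (P hp = 2)) \<and>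
        matches cs (\<lambda>i. X i = 2) (if c = 4 then hx + 1 else hx) (\<lambda>i. W i = 2) (hw + 1) ?b)], 0)"
    "\<forall>i. i \<notin> {0, 2, 3, 4, 6, l} \<longrightarrow> f' i = g i"
    using Cons.IH[OF g0 g2 g3 g4 g6 gl Cons.prems(7) c(2), unfolded P2] by blast
  have "steps (match_prog l) 0 f (Suc (Suc (length cs))) f'"
    unfolding match_prog_def
    by (rule while_iter) (use p c(1) r f'(1)[unfolded match_prog_def] in \<open>auto simp: g_def A_def\<close>)
  moreover have "(ys @ [bit_sym ?b]) @ map (\<lambda>i. bit_sym (W (hw + 1 + int i) = 2)) [0..<length cs] =
     ys @ map (\<lambda>i. bit_sym (W (hw + int i) = 2)) [0..<length (c # cs)]"
    by (simp add: upt_conv_Cons map_Suc_upt[symmetric] add.assoc del: upt_Suc)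
  ultimately show ?case using f' go by (intro exI[of _ f']) (auto simp: conj_assoc)
qed

definition move_code :: "move \<Rightarrow> nat" where
  "move_code m = (case m of Move_Left \<Rightarrow> 1 | Move_Stay \<Rightarrow> 2 | Move_Right \<Rightarrow> 3)"

definition code_shift :: "nat \<Rightarrow> int" where
  "code_shift n = (if n = 1 then -1 else if n = 3 then 1 else 0)"

lemma code_shift_move_code: "code_shift (move_code m) = shift m" "move_code m \<noteq> 0" "move_code m < 4"
  by (cases m; simp add: code_shift_def move_code_def)+

text \<open>
  The head positions of \<open>M\<close> are unknown when it halts. Therefore tape \<open>5\<close> records the moves on the last
  tape of \<open>M\<close>, and \<open>replay_prog\<close> undoes them to bring that head back to cell \<open>0\<close>.
\<close>

definition sim_prog :: "tm \<Rightarrow> prog" where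
  "sim_prog M = (num_states M, \<lambda>q r.
     let rs = map (\<lambda>i. r (6 + i)) [0..<num_tapes M] in
     if set rs \<subseteq> {..<num_symbols M} then (case delta M q rs of (q', as) \<Rightarrow>
       (q', \<lambda>i. if 6 \<le> i \<and> i < 6 + num_tapes M then as ! (i - 6)
               else if i = 5 then (move_code (snd (last as)), Move_Right) else (r i, Move_Stay)))
     else (num_states M, \<lambda>i. (r i, Move_Stay)))"

lemma tm_wfD:
  assumes "tm_wf M" "q < num_states M" "length rs = num_tapes M" "set rs \<subseteq> {..<num_symbols M}"
    "delta M q rs = (q', as)"
  shows "q' \<le> num_states M \<and> length as = num_tapes M \<and> fst ` set as \<subseteq> {..<num_symbols M}"
proof -
  have "\<forall>q < num_states M. \<forall>rs. length rs = num_tapes M \<and> set rs \<subseteq> {..<num_symbols M} \<longrightarrow>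
        (case delta M q rs of (q', as) \<Rightarrow>
           q' \<le> num_states M \<and> length as = num_tapes M \<and> fst ` set as \<subseteq> {..<num_symbols M})"
    using assms(1) unfolding tm_wf_def by (elim conjE)
  from this[rule_format, OF assms(2), of rs] show ?thesis using assms(3-5) by simp
qed

lemma tm_step_halted: "(tm_step M ^^ n) (num_states M, ts) = (num_states M, ts)"
  by (induction n) auto

lemma tm_step_ok:
  assumes "tm_wf M" "q \<le> num_states M" "length ts = num_tapes M"
    "\<forall>t \<in> set ts. \<forall>j. fst t j < num_symbols M" "tm_step M (q, ts) = (q', ts')"
  shows "q' \<le> num_states M" "length ts' = num_tapes M" "\<forall>t \<in> set ts'. \<forall>j. fst t j < num_symbols M"
proof -
  have "q' \<le> num_states M \<and> length ts' = num_tapes M \<and> (\<forall>t \<in> set ts'. \<forall>j. fst t j < num_symbols M)"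
  proof (cases "q < num_states M")
    case True
    define rs where "rs = map (\<lambda>(t, h). t h) ts"
    obtain q1 as where d: "delta M q rs = (q1, as)" by force
    have rs: "length rs = num_tapes M \<and> set rs \<subseteq> {..<num_symbols M}"
      using assms(3,4) by (auto simp: rs_def)
    have ok: "q1 \<le> num_states M \<and> length as = num_tapes M \<and> fst ` set as \<subseteq> {..<num_symbols M}"
      using tm_wfD[OF assms(1) True _ _ d] rs by simp
    have e: "q' = q1" "ts' = map2 act ts as"
      using assms(5) True d by (auto simp: rs_def)
    have "fst t j < num_symbols M" if t: "t \<in> set ts'" for t j
    proof -
      obtain i where i: "i < length ts" "i < length as" "t = act (ts ! i) (as ! i)"
        using t unfolding e in_set_conv_nth by auto
      have "fst (ts ! i) j < num_symbols M" "fst (as ! i) < num_symbols M"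
        using i assms(4) ok by (auto simp: subset_iff)
      then show ?thesis unfolding i(3) by (cases "ts ! i"; cases "as ! i") auto
    qed
    then show ?thesis using ok e assms(3) by auto
  next
    case False
    then show ?thesis using assms by auto
  qed
  then show "q' \<le> num_states M" "length ts' = num_tapes M" "\<forall>t \<in> set ts'. \<forall>j. fst t j < num_symbols M"
    by auto
qed

text \<open>\<open>M\<close> may reach its halting state before step \<open>n\<close>, after which
  \<open>tm_step\<close> idles; hence \<open>n' \<le> n\<close>. The invariant is that the moves
  recorded on tape \<open>5\<close> add up to the head position on the last tape of
  \<open>M\<close>.\<close>

lemma sim_steps:
  assumes "tm_wf M" "(tm_step M ^^ n) (q, ts) = (num_states M, ts')" "q \<le> num_states M"
    "length ts = num_tapes M" "\<forall>t \<in> set ts. \<forall>j. fst t j < num_symbols M"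
    "\<forall>i < num_tapes M. f (6 + i) = ts ! i" "f 5 = (ltape hs, int (length hs))" "0 \<notin> set hs"
    "snd (last ts) = sum_list (map code_shift hs)"
  shows "\<exists>n' f' hs'. n' \<le> n \<and> steps (sim_prog M) q f n' f' \<and>
    (\<forall>i < num_tapes M. f' (6 + i) = ts' ! i) \<and> f' 5 = (ltape hs', int (length hs')) \<and>
    0 \<notin> set hs' \<and> length hs' = length hs + n' \<and> snd (last ts') = sum_list (map code_shift hs') \<and>
    (\<forall>i. i \<notin> {5..<6 + num_tapes M} \<longrightarrow> f' i = f i)"
  using assms(2-)
proof (induction n arbitrary: q ts f hs)
  case 0
  then show ?case using steps.halt[of "sim_prog M" f]
    by (intro exI[of _ 0] exI[of _ f] exI[of _ hs]) (auto simp: sim_prog_def)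
next
  case (Suc n)
  show ?case
  proof (cases "q < num_states M")
    case False
    then have [simp]: "q = num_states M" using Suc.prems by simp
    have "ts' = ts" using Suc.prems(1) tm_step_halted[of "Suc n" M ts] by (simp del: funpow.simps)
    then show ?thesis using Suc.prems steps.halt[of "sim_prog M" f]
      by (intro exI[of _ 0] exI[of _ f] exI[of _ hs]) (auto simp: sim_prog_def)
  next
    case True
    obtain q1 ts1 where st: "tm_step M (q, ts) = (q1, ts1)" by force
    note ok = tm_step_ok[OF assms(1) Suc.prems(2,3,4) st]
    define rs where "rs = map (\<lambda>(t, h). t h) ts"
    obtain q2 as where d: "delta M q rs = (q2, as)" by force
    have q2: "q2 = q1" and ts1: "ts1 = map2 act ts as"
      using st d True by (auto simp: rs_def)
    have rs: "length rs = num_tapes M \<and> set rs \<subseteq> {..<num_symbols M}"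
      using Suc.prems(3,4) by (auto simp: rs_def)
    have la: "length as = num_tapes M"
      using tm_wfD[OF assms(1) True _ _ d] rs by simp
    have K: "num_tapes M \<ge> 1" using assms(1) by (simp add: tm_wf_def)
    have rsf: "map (\<lambda>i. rd f (6 + i)) [0..<num_tapes M] = rs"
      using Suc.prems(3,5) by (auto simp: rs_def list_eq_iff_nth_eq rd_def case_prod_beta)
    define A where "A = (\<lambda>i. if 6 \<le> i \<and> i < 6 + num_tapes M then as ! (i - 6)
               else if i = 5 then (move_code (snd (last as)), Move_Right) else (rd f i, Move_Stay))"
    have s1: "snd (sim_prog M) q (rd f) = (q1, A)"
      unfolding sim_prog_def snd_conv rsf Let_def using rs d q2 by (simp add: A_def)
    define g where "g = apply_acts f A"
    have g1: "\<forall>i < num_tapes M. g (6 + i) = ts1 ! i"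
      using Suc.prems(3,5) la by (auto simp: g_def A_def apply_acts_def ts1)
    have g5: "g 5 = (ltape (hs @ [move_code (snd (last as))]), int (length (hs @ [move_code (snd (last as))])))"
      using Suc.prems(6) by (auto simp: g_def A_def apply_acts_def ltape_snoc)
    have ne: "ts \<noteq> []" "as \<noteq> []" using K la Suc.prems(3) by auto
    have "last ts1 = act (last ts) (last as)"
      using ne la Suc.prems(3) by (simp add: ts1 last_map last_zip)
    then have gl: "snd (last ts1) = sum_list (map code_shift (hs @ [move_code (snd (last as))]))"
      using Suc.prems(8) by (cases "last ts"; cases "last as") (simp add: code_shift_move_code)
    have run: "(tm_step M ^^ n) (q1, ts1) = (num_states M, ts')"
      using Suc.prems(1) st by (simp add: funpow_swap1)
    have nz: "0 \<notin> set (hs @ [move_code (snd (last as))])"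
      using Suc.prems(7) code_shift_move_code(2)[of "snd (last as)"] by auto
    obtain n' f' hs' where IH: "n' \<le> n" "steps (sim_prog M) q1 g n' f'"
       "\<forall>i < num_tapes M. f' (6 + i) = ts' ! i" "f' 5 = (ltape hs', int (length hs'))"
       "0 \<notin> set hs'" "length hs' = length (hs @ [move_code (snd (last as))]) + n'"
       "snd (last ts') = sum_list (map code_shift hs')"
       "\<forall>i. i \<notin> {5..<6 + num_tapes M} \<longrightarrow> f' i = g i"
      using Suc.IH[OF run ok(1,2,3) g1 g5 nz gl] by blast
    have "steps (sim_prog M) q f (Suc n') f'"
      by (rule steps.step[where q' = q1 and A = A]) (use True s1 IH(2) in \<open>auto simp: g_def sim_prog_def\<close>)
    moreover have "\<forall>i. i \<notin> {5..<6 + num_tapes M} \<longrightarrow> g i = f i"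
      by (auto simp: g_def A_def apply_acts_def act_rd)
    ultimately show ?thesis using IH
      by (intro exI[of _ "Suc n'"] exI[of _ f'] exI[of _ hs']) auto
  qed
qed

definition replay_prog :: "nat \<Rightarrow> prog" where
  "replay_prog k = while_prog (\<lambda>r. r 5 \<noteq> 0)
     (\<lambda>r i. if i = 5 then (r 5, Move_Left)
        else if i = k then (r k, if r 5 = 1 then Move_Right else if r 5 = 3 then Move_Left else Move_Stay)
        else (r i, Move_Stay))
     (mv Move_Stay {})"

lemma replay_steps:
  assumes "f 5 = (ltape hs, int j - 1)" "j \<le> length hs" "0 \<notin> set hs" "k \<noteq> 5"
    "snd (f k) = sum_list (map code_shift (take j hs))"
  shows "\<exists>f'. steps (replay_prog k) 0 f (Suc j) f' \<and> f' k = (fst (f k), 0) \<and>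
    (\<forall>i. i \<noteq> 5 \<and> i \<noteq> k \<longrightarrow> f' i = f i)"
  using assms
proof (induction j arbitrary: f)
  case 0
  have "steps (replay_prog k) 0 f (Suc 0) (apply_acts f (mv Move_Stay {} (rd f)))"
    unfolding replay_prog_def using 0 by (intro while_exit) (auto simp: rd_def ltape_neg)
  then show ?case using 0
    by (intro exI[of _ "apply_acts f (mv Move_Stay {} (rd f))"])
      (auto simp: apply_mv shift_heads_def prod_eq_iff)
next
  case (Suc j)
  have r: "rd f 5 = hs ! j" "hs ! j \<noteq> 0" using Suc.prems by (auto simp: rd_def ltape_nth nth_neq_0)
  define A where "A = (\<lambda>i. if i = 5 then (rd f 5, Move_Left)
        else if i = k then (rd f k, if rd f 5 = 1 then Move_Right else if rd f 5 = 3 then Move_Left else Move_Stay)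
        else (rd f i, Move_Stay))"
  define g where "g = apply_acts f A"
  have t: "take (Suc j) hs = take j hs @ [hs ! j]" using Suc.prems(2) by (simp add: take_Suc_conv_app_nth)
  have g5: "g 5 = (ltape hs, int j - 1)"
    using Suc.prems by (auto simp: g_def A_def apply_acts_def rd_def fun_upd_idem)
  have go: "\<forall>i. i \<noteq> 5 \<and> i \<noteq> k \<longrightarrow> g i = f i"
    by (auto simp: g_def A_def apply_acts_def act_rd)
  have gk: "snd (g k) = sum_list (map code_shift (take j hs))" and gk': "fst (g k) = fst (f k)"
    using Suc.prems r by (auto simp: g_def A_def apply_acts_def act_rd t code_shift_def[of "hs ! j"])
  obtain f' where "steps (replay_prog k) 0 g (Suc j) f'" "f' k = (fst (g k), 0)"
    "\<forall>i. i \<noteq> 5 \<and> i \<noteq> k \<longrightarrow> f' i = g i"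
    using Suc.IH[OF g5 _ Suc.prems(3,4) gk] Suc.prems(2) by auto
  moreover from this(1) have "steps (replay_prog k) 0 f (Suc (Suc j)) f'"
    unfolding replay_prog_def
    by - (rule while_iter, use r in \<open>auto simp: g_def A_def\<close>)
  ultimately show ?case using go gk' by (intro exI[of _ f']) auto
qed

text \<open>An output that is too short shows up as a blank, which differs from \<open>1\<close> and
  \<open>2\<close>. One that is too long is caught by the exit step, where the cell on tape
  \<open>k\<close> must be blank.\<close>

definition compare_prog :: "nat \<Rightarrow> nat \<Rightarrow> prog" where
  "compare_prog k l = while_prog (\<lambda>r. r 4 = 1 \<or> r 4 = 2)
     (\<lambda>r. (mv Move_Right {4, k} r)(l := (if r 4 = r k then r l else 1, Move_Stay)))
     (\<lambda>r. (mv Move_Stay {} r)(l := (if r k = 0 then r l else 1, Move_Stay)))"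

lemma compare_steps:
  assumes "f 4 = (ltape D, int p)" "f k = (string_tape y, int m)" "f l = (ltape [bit_sym ok], 0)"
    "cs = takeWhile (\<lambda>c. c = 1 \<or> c = 2) (drop p D)" "4 < k" "k < l"
  shows "\<exists>f'. steps (compare_prog k l) 0 f (Suc (length cs)) f' \<and>
    f' l = (ltape [bit_sym (ok \<and> cs = map bit_sym (drop m y))], 0)"
  using assms
proof (induction cs arbitrary: f p m ok)
  case Nil
  then have np: "\<not> (p < length D \<and> (D ! p = 1 \<or> D ! p = 2))"
    using Nil.prems(4)[symmetric] unfolding takeWhile_drop_Nil by simp
  then have n: "\<not> (rd f 4 = 1 \<or> rd f 4 = 2)"
    using Nil.prems(1) by (auto simp: rd_def ltape_def)
  define f' where "f' = apply_acts f ((mv Move_Stay {} (rd f))(l := (if rd f k = 0 then rd f l else 1, Move_Stay)))"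
  have "steps (compare_prog k l) 0 f (Suc 0) f'"
    unfolding compare_prog_def f'_def by (rule while_exit) (use n in auto)
  moreover have "rd f k = 0 \<longleftrightarrow> drop m y = []"
    using Nil.prems(2) by (auto simp: rd_def string_tape_def)
  moreover from this have "f' l = (ltape [bit_sym (ok \<and> [] = map bit_sym (drop m y))], 0)"
    using Nil.prems(3) by (auto simp: f'_def apply_upd rd_def ltape_single bit_sym_def)
  ultimately show ?case by auto
next
  case (Cons c cs)
  have p: "p < length D" "D ! p = 1 \<or> D ! p = 2"
    using Cons.prems(4) takeWhile_drop_Nil[of "\<lambda>c. c = 1 \<or> c = 2" p D] by auto
  have c: "c = D ! p" "cs = takeWhile (\<lambda>c. c = 1 \<or> c = 2) (drop (Suc p) D)"
    using Cons.prems(4) takeWhile_drop_Cons[of p D "\<lambda>c. c = 1 \<or> c = 2"] p by auto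
  have r: "rd f 4 = c" "rd f k = string_tape y (int m)" "rd f l = bit_sym ok"
    using Cons.prems p c(1) by (auto simp: rd_def ltape_nth ltape_single)
  define g where "g = apply_acts f ((mv Move_Right {4, k} (rd f))(l := (if rd f 4 = rd f k then rd f l else 1, Move_Stay)))"
  have g: "g 4 = (ltape D, int (Suc p))" "g k = (string_tape y, int (Suc m))"
    "g l = (ltape [bit_sym (ok \<and> c = string_tape y (int m))], 0)"
    using Cons.prems r by (auto simp: g_def apply_upd apply_mv shift_heads_def ltape_single bit_sym_def)
  obtain f' where f': "steps (compare_prog k l) 0 g (Suc (length cs)) f'"
    "f' l = (ltape [bit_sym ((ok \<and> c = string_tape y (int m)) \<and> cs = map bit_sym (drop (Suc m) y))], 0)"
    using Cons.IH[OF g c(2) Cons.prems(5,6)] by blast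
  have "steps (compare_prog k l) 0 f (Suc (Suc (length cs))) f'"
    unfolding compare_prog_def
    by (rule while_iter) (use p c(1) r f'(1)[unfolded compare_prog_def] in \<open>auto simp: g_def\<close>)
  moreover have "(c = string_tape y (int m) \<and> cs = map bit_sym (drop (Suc m) y)) \<longleftrightarrow>
     c # cs = map bit_sym (drop m y)"
    using p c(1) by (cases "m < length y") (auto simp: string_tape_def bit_sym_def Cons_nth_drop_Suc[symmetric])
  ultimately show ?case using f'(2) by (intro exI[of _ f']) (auto simp: conj_assoc)
qed

text \<open>
  Tapes \<open>0\<close> to \<open>3\<close> hold copies of the whole input, with heads moved to the string \<open>x\<close> (tape \<open>0\<close>), the advice (\<open>1\<close>)
  and the witness (\<open>3\<close>); tape \<open>2\<close> counts, and later remembers the preceding bit. Tape \<open>4\<close> holds the decoded advice,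
  tapes \<open>6, \<dots>\<close> are those of \<open>M\<close>, and the last tape is the verdict.
  A witness \<open>True\<^sup>r False Y\<close> selects the block starting at position \<open>r\<close> of the advice.
\<close>

definition verifier_prog :: "tm \<Rightarrow> prog" where
  "verifier_prog M = (let k = 5 + num_tapes M; l = 6 + num_tapes M in
     copy_prog 0 {1, 2, 3} ;; rewind 0 {0, 1, 2, 3} ;; scan 0 {0, 1, 3} {0, 1, 3} ;;
     scan 2 {2, 3} {2} ;; scan 0 {0, 1} {0, 1} ;; scan 2 {1, 2} {} ;;
     once (\<lambda>r. (mv Move_Stay {} r)(l := (2, Move_Stay))) ;;
     decode_prog ;; rewind 4 {4} ;; skip_prog l ;; match_prog l ;;
     rewind 6 {6} ;; sim_prog M ;; once (mv Move_Left {5}) ;;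
     replay_prog k ;; compare_prog k l)"

text \<open>This describes the machine on every \<open>v\<close>, well-formed or not. If
  \<open>v\<close> is \<open>pair_enc (pair_enc x a) w\<close>, then \<open>n1\<close> is the length
  of the inner pair, \<open>n2\<close> that of \<open>x\<close>, and \<open>x\<close>,
  \<open>a\<close>, \<open>w\<close> start at \<open>hx\<close>, \<open>hx + n2\<close>,
  \<open>hw\<close>. The decoded word \<open>D\<close> runs on into \<open>w\<close>.\<close>

definition accepts :: "(bool list \<Rightarrow> bool list) \<Rightarrow> bool list \<Rightarrow> bool" where
  "accepts F v = (let n1 = ones_from v 0; n2 = ones_from v (n1 + 1); hx = n1 + 1 + n2 + 1;
       hw = n1 + 1 + n1; D = dec 0 (drop (hx + n2) v); r = ones_from v hw;
       cs = takeWhile (\<lambda>c. 1 \<le> c \<and> c \<le> 5) (drop (r + 1) D);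
       Y = map (\<lambda>i. string_tape v (int (hw + r + 1 + i)) = 2) [0..<length cs] in
     (\<forall>i < r. ltape D (int i) \<noteq> 8) \<and> ltape D (int r) = 6 \<and>
     matches cs (\<lambda>i. string_tape v i = 2) (int hx) (\<lambda>i. string_tape v i = 2) (int (hw + r + 1))
       (string_tape v (int (n1 + 1 + n2)) = 2) \<and>
     takeWhile (\<lambda>c. c = 1 \<or> c = 2) (drop (r + 1 + length cs + 1) D) = map bit_sym (F Y))"

lemma length_dec: "length (dec k bs) \<le> length bs + (if k = 0 then 0 else 1)"
  by (induction k bs rule: dec.induct) auto

lemma dec_nonzero: "0 \<notin> set (dec k bs)"
  by (induction k bs rule: dec.induct) auto

lemma poly_nat_mono: "a \<le> b \<Longrightarrow> poly p a \<le> poly p (b :: nat)"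
  by (induction p) (auto intro!: add_mono mult_le_mono)

text \<open>Twelve phases each sweep over at most \<open>length v\<close> cells; the simulation of
  \<open>M\<close> and the replay of its moves each contribute at most
  \<open>poly p (length v)\<close> steps.\<close>

lemma verifier_steps:
  assumes wf: "tm_wf M" and M: "\<And>x. \<exists>t \<le> poly p (length x). tm_outputs M x t (F x)"
    and f: "f = (\<lambda>i. (if i = 0 then string_tape v else (\<lambda>_. 0), 0))"
  shows "\<exists>n f'. n \<le> 12 * (length v + 2) + 2 * poly p (length v) \<and>
    steps (verifier_prog M) 0 f n f' \<and>
    f' (6 + num_tapes M) = (string_tape [accepts F v], 0)"
proof -
  let ?K = "num_tapes M"
  have K: "?K \<ge> 1" using wf by (simp add: tm_wf_def)
  define k l where "k = 5 + ?K" and "l = 6 + ?K"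
  define n where "n = length v"
  have kl: "k > 5" "k < l" "l > 6" using K by (auto simp: k_def l_def)
  have lt0: "ltape [] = (\<lambda>_. 0)" by (auto simp: ltape_def fun_eq_iff)
  define xs where "xs = map bit_sym v"
  have xs: "ltape xs = string_tape v" "length xs = n" "0 \<notin> set xs"
    by (auto simp: xs_def string_tape_ltape n_def bit_sym_def)
  define f1 where "f1 = (\<lambda>i. if i \<in> insert 0 {1, 2, 3} then (ltape xs, int (length xs) - 1) else f i)"
  have s1: "steps (copy_prog 0 {1, 2, 3}) 0 f (length xs - 0 + 1) f1"
    unfolding f1_def by (rule copy_prog_steps) (use xs in \<open>auto simp: f lt0\<close>)
  define f2 :: tapes where "f2 = (\<lambda>i. if i \<le> 3 then (string_tape v, 0) else ((\<lambda>_. 0), 0::int))"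
  have "steps (rewind 0 {0, 1, 2, 3}) 0 f1 (Suc n) (shift_heads (1 - int n) {0, 1, 2, 3} f1)"
    by (rule rewind_steps[where xs = xs]) (use xs in \<open>auto simp: f1_def\<close>)
  also have "shift_heads (1 - int n) {0, 1, 2, 3} f1 = f2"
    by (rule ext) (auto simp: shift_heads_def f1_def f2_def xs f)
  finally have s2: "steps (rewind 0 {0, 1, 2, 3}) 0 f1 (Suc n) f2" .
  define n1 n2 where "n1 = ones_from v 0" and "n2 = ones_from v (n1 + 1)"
  define hx hw where "hx = n1 + 1 + n2 + 1" and "hw = n1 + 1 + n1"
  have ones: "ones_from v h \<le> n" for h using ones_from_le[of v h] by (simp add: n_def)
  define f3 where "f3 = shift_heads 1 {0, 1, 3} (shift_heads (int n1) {0, 1, 3} f2)"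
  have s3: "steps (scan 0 {0, 1, 3} {0, 1, 3}) 0 f2 (Suc n1) f3"
    unfolding f3_def n1_def by (rule scan_steps) (auto simp: f2_def)
  define f4 where "f4 = shift_heads 1 {2} (shift_heads (int n1) {2, 3} f3)"
  have s4: "steps (scan 2 {2, 3} {2}) 0 f3 (Suc n1) f4"
    unfolding f4_def n1_def by (rule scan_steps) (auto simp: f2_def f3_def shift_heads_def)
  define f5 where "f5 = shift_heads 1 {0, 1} (shift_heads (int n2) {0, 1} f4)"
  have s5: "steps (scan 0 {0, 1} {0, 1}) 0 f4 (Suc n2) f5"
    unfolding f5_def n2_def by (rule scan_steps) (auto simp: f2_def f3_def f4_def shift_heads_def)
  \<comment> \<open>The empty exit set lets tape \<open>2\<close> stop on the separator before
    \<open>x\<close>, a cell that is not \<open>2\<close>; hence the bit preceding the first one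
    counts as \<open>False\<close>.\<close>
  define f6 where "f6 = shift_heads 1 {} (shift_heads (int n2) {1, 2} f5)"
  have s6: "steps (scan 2 {1, 2} {}) 0 f5 (Suc n2) f6"
    unfolding f6_def n2_def by (rule scan_steps) (auto simp: f2_def f3_def f4_def f5_def shift_heads_def)
  have f6: "f6 0 = (string_tape v, int hx)" "f6 1 = (string_tape v, int (hx + n2))"
    "f6 2 = (string_tape v, int (n1 + 1 + n2))" "f6 3 = (string_tape v, int hw)"
    "\<And>i. i > 3 \<Longrightarrow> f6 i = (\<lambda>_. 0, 0)"
    by (auto simp: f2_def f3_def f4_def f5_def f6_def shift_heads_def hx_def hw_def)
  define f7 where "f7 = f6(l := (ltape [bit_sym True], 0))"
  have s7: "steps (once (\<lambda>r. (mv Move_Stay {} r)(l := (2, Move_Stay)))) 0 f6 (Suc 0) f7"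
  proof (rule steps_once)
    have w: "(\<lambda>_. 0::nat)(0::int := 2) = ltape [bit_sym True]"
      by (auto simp: ltape_def fun_eq_iff bit_sym_def)
    have "l > 3" using kl by simp
    then show "f7 = apply_acts f6 ((mv Move_Stay {} (rd f6))(l := (2, Move_Stay)))"
      unfolding apply_upd apply_mv f7_def by (simp add: f6(5) w shift_heads_0)
  qed
  define D where "D = dec 0 (drop (hx + n2) v)"
  have lD: "length D \<le> n" "0 \<notin> set D"
    using length_dec[of 0 "drop (hx + n2) v"] dec_nonzero by (auto simp: D_def n_def)
  have "\<exists>j t. j \<le> length ([] @ dec 0 (drop (hx + n2) v)) \<and>
    steps decode_prog 0 f7 (Suc (length v - (hx + n2)))
      (f7(1 := t, 4 := (ltape ([] @ dec 0 (drop (hx + n2) v)), int j - 1)))"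
    by (rule decode_steps) (use kl f6 in \<open>auto simp: f7_def ltape_snoc_0[of "[]", simplified] lt0\<close>)
  then obtain j t where j: "j \<le> length D" and
    s8: "steps decode_prog 0 f7 (Suc (length v - (hx + n2))) (f7(1 := t, 4 := (ltape D, int j - 1)))"
    unfolding D_def by auto
  define f8 where "f8 = f7(1 := t, 4 := (ltape D, int j - 1))"
  define f9 where "f9 = shift_heads (1 - int j) {4} f8"
  have s9: "steps (rewind 4 {4}) 0 f8 (Suc j) f9"
    unfolding f9_def by (rule rewind_steps[where xs = D]) (use j lD in \<open>auto simp: f8_def\<close>)
  have f9: "f9 0 = (string_tape v, int hx)" "f9 2 = (string_tape v, int (n1 + 1 + n2))"
    "f9 3 = (string_tape v, int hw)" "f9 4 = (ltape D, int 0)" "f9 l = (ltape [bit_sym True], 0)"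
    "\<And>i. i > 4 \<Longrightarrow> i \<noteq> l \<Longrightarrow> f9 i = (\<lambda>_. 0, 0)"
    using f6 kl by (auto simp: f9_def f8_def f7_def shift_heads_def)
  define r where "r = ones_from v hw"
  define ok1 where "ok1 = ((\<forall>i < r. ltape D (int i) \<noteq> 8) \<and> ltape D (int r) = 6)"
  define f10 where "f10 = f9(3 := (string_tape v, int (hw + r + 1)), 4 := (ltape D, int (r + 1)),
       l := (ltape [bit_sym ok1], 0))"
  have s10: "steps (skip_prog l) 0 f9 (Suc r) f10"
    using skip_steps[of f9 v hw D 0 l True] f9 kl by (simp add: f10_def ok1_def r_def)
  define cs where "cs = takeWhile (\<lambda>c. 1 \<le> c \<and> c \<le> 5) (drop (r + 1) D)"
  define Y where "Y = map (\<lambda>i. string_tape v (int (hw + r + 1 + i)) = 2) [0..<length cs]"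
  have lcs: "length cs \<le> n" 
    using lD length_takeWhile_le[of "\<lambda>c. 1 \<le> c \<and> c \<le> 5" "drop (r + 1) D"] by (simp add: cs_def)
  define ok2 where "ok2 = (ok1 \<and> matches cs (\<lambda>i. string_tape v i = 2) (int hx)
     (\<lambda>i. string_tape v i = 2) (int (hw + r + 1)) (string_tape v (int (n1 + 1 + n2)) = 2))"
  obtain f11 where s11: "steps (match_prog l) 0 f10 (Suc (length cs)) f11"
    and "f11 4 = (ltape D, int (r + 1 + length cs + 1))"
    "f11 6 = (ltape ([] @ map (\<lambda>i. bit_sym (string_tape v (int (hw + r + 1) + int i) = 2)) [0..<length cs]),
            int (length ([] :: nat list) + length cs) - 1)"
    "f11 l = (ltape [bit_sym ok2], 0)"
    "\<forall>i. i \<notin> {0, 2, 3, 4, 6, l} \<longrightarrow> f11 i = f10 i"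
    using match_steps[of f10 "string_tape v" "int hx" "string_tape v" "int (n1 + 1 + n2)" "string_tape v"
      "int (hw + r + 1)" D "r + 1" "[]" l ok1 cs] f9 kl K
    by (auto simp: f10_def ok2_def cs_def lt0 l_def)
  then have f11: "f11 4 = (ltape D, int (r + 1 + length cs + 1))"
    "f11 6 = (ltape (map bit_sym Y), int (length cs) - 1)" "f11 l = (ltape [bit_sym ok2], 0)"
    "\<And>i. i > 4 \<Longrightarrow> i \<noteq> 6 \<Longrightarrow> i \<noteq> l \<Longrightarrow> f11 i = (\<lambda>_. 0, 0)"
    using f9(6) by (auto simp: Y_def f10_def comp_def add.assoc)
  have lY: "length Y = length cs" by (simp add: Y_def)
  define f12 where "f12 = shift_heads (1 - int (length cs)) {6} f11"
  have s12: "steps (rewind 6 {6}) 0 f11 (Suc (length cs)) f12"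
    unfolding f12_def
    by (rule rewind_steps[where xs = "map bit_sym Y"]) (use f11 lY in \<open>auto simp: bit_sym_def\<close>)
  have f12: "f12 4 = (ltape D, int (r + 1 + length cs + 1))"
    "f12 6 = (string_tape Y, 0)" "f12 l = (ltape [bit_sym ok2], 0)"
    "\<And>i. i > 4 \<Longrightarrow> i \<noteq> 6 \<Longrightarrow> i \<noteq> l \<Longrightarrow> f12 i = (\<lambda>_. 0, 0)"
    using f11 kl by (auto simp: f12_def shift_heads_def string_tape_ltape)
  obtain tt ts' where tt: "tt \<le> poly p (length Y)" "(tm_step M ^^ tt) (tm_init M Y) = (num_states M, ts')"
    "fst (last ts') = string_tape (F Y)"
    using M[of Y] by (auto simp: tm_outputs_def)
  define ts where "ts = map (\<lambda>i. (if i = 0 then string_tape Y else (\<lambda>_. 0), 0::int)) [0..<?K]"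
  have run: "(tm_step M ^^ tt) (0, ts) = (num_states M, ts')" using tt by (simp add: tm_init_def ts_def)
  have S3: "num_symbols M \<ge> 3" using wf by (simp add: tm_wf_def)
  have lts: "length ts = ?K" "\<forall>t \<in> set ts. \<forall>j. fst t j < num_symbols M" "snd (last ts) = 0"
    using S3 K by (auto simp: ts_def string_tape_def last_map split: if_splits)
  have tsi: "\<forall>i < ?K. f12 (6 + i) = ts ! i"
    using f12(2,4) by (auto simp: ts_def l_def)
  have "length ts' = ?K"
  proof -
    have "length (snd ((tm_step M ^^ m) (0, ts))) = ?K \<and> fst ((tm_step M ^^ m) (0, ts)) \<le> num_states M \<and>
      (\<forall>t \<in> set (snd ((tm_step M ^^ m) (0, ts))). \<forall>j. fst t j < num_symbols M)" for m
    proof (induction m)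
      case 0
      then show ?case using lts by simp
    next
      case (Suc m)
      obtain q1 t1 where "(tm_step M ^^ m) (0, ts) = (q1, t1)" by force
      moreover obtain q2 t2 where "tm_step M (q1, t1) = (q2, t2)" by force
      ultimately show ?case using Suc tm_step_ok[OF wf, of q1 t1 q2 t2] by simp
    qed
    from this[of tt] show ?thesis using run by simp
  qed
  obtain n13 f13 hs where s13: "n13 \<le> tt" "steps (sim_prog M) 0 f12 n13 f13"
    and f13: "\<forall>i < ?K. f13 (6 + i) = ts' ! i" "f13 5 = (ltape hs, int (length hs))"
    "0 \<notin> set hs" "length hs = n13" "snd (last ts') = sum_list (map code_shift hs)"
    "\<forall>i. i \<notin> {5..<6 + ?K} \<longrightarrow> f13 i = f12 i"
    using sim_steps[OF wf run _ lts(1,2) tsi, of "[]"] f12(4)[of 5] lts(3) kl lt0 by auto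
  have f13k: "f13 k = last ts'"
    using f13(1)[rule_format, of "?K - 1"] K \<open>length ts' = ?K\<close> by (simp add: k_def last_conv_nth flip: length_greater_0_conv)
  define f14 where "f14 = shift_heads (-1) {5} f13"
  have s14: "steps (once (mv Move_Left {5})) 0 f13 (Suc 0) f14"
    by (rule steps_once) (simp add: apply_mv f14_def)
  have f14: "f14 5 = (ltape hs, int n13 - 1)" "f14 k = last ts'"
    "f14 4 = (ltape D, int (r + 1 + length cs + 1))" "f14 l = (ltape [bit_sym ok2], 0)"
    using f13 f12 f13k kl by (auto simp: f14_def shift_heads_def l_def)
  obtain f15 where s15: "steps (replay_prog k) 0 f14 (Suc n13) f15" and
    f15: "f15 k = (string_tape (F Y), 0)" "\<forall>i. i \<noteq> 5 \<and> i \<noteq> k \<longrightarrow> f15 i = f14 i"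
    using replay_steps[of f14 hs n13 k] f14 f13 kl tt(3) by auto
  define ds where "ds = takeWhile (\<lambda>c. c = 1 \<or> c = 2) (drop (r + 1 + length cs + 1) D)"
  have lds: "length ds \<le> n"
    using lD length_takeWhile_le[of "\<lambda>c. c = 1 \<or> c = 2" "drop (r + 1 + length cs + 1) D"] by (simp add: ds_def)
  obtain f16 where s16: "steps (compare_prog k l) 0 f15 (Suc (length ds)) f16"
    and f16: "f16 l = (ltape [bit_sym (ok2 \<and> ds = map bit_sym (F Y))], 0)"
    using compare_steps[of f15 D "r + 1 + length cs + 1" k "F Y" 0 l ok2 ds] f15 f14 kl
    by (auto simp: ds_def)
  have acc: "accepts F v = (ok2 \<and> ds = map bit_sym (F Y))"
    by (simp add: accepts_def Let_def ok2_def ok1_def ds_def Y_def cs_def r_def D_def hx_def hw_def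
        n2_def n1_def conj_assoc)
  have "steps (verifier_prog M) 0 f
    ((length xs - 0 + 1) + (Suc n + (Suc n1 + (Suc n1 + (Suc n2 + (Suc n2 + (Suc 0 +
     (Suc (length v - (hx + n2)) + (Suc j + (Suc r + (Suc (length cs) + (Suc (length cs) + (n13 +
     (Suc 0 + (Suc n13 + Suc (length ds)))))))))))))))) f16"
    unfolding verifier_prog_def Let_def k_def[symmetric] l_def[symmetric]
    by (intro steps_pseq[OF s1] steps_pseq[OF s2] steps_pseq[OF s3] steps_pseq[OF s4] steps_pseq[OF s5]
       steps_pseq[OF s6] steps_pseq[OF s7] steps_pseq[OF s8[folded f8_def]] steps_pseq[OF s9]
       steps_pseq[OF s10] steps_pseq[OF s11] steps_pseq[OF s12] steps_pseq[OF s13(2)]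
       steps_pseq[OF s14] steps_pseq[OF s15] s16)
  note steps = this
  have "n13 \<le> poly p n"
    using s13(1) tt(1) poly_nat_mono[OF lcs, of p] lY by simp
  moreover have "n1 \<le> n" "n2 \<le> n" "r \<le> n" using ones by (auto simp: n1_def n2_def r_def)
  moreover define e where "e = n - (hx + n2)"
  moreover have "e \<le> n" by (simp add: e_def)
  ultimately have "(length xs - 0 + 1) + (Suc n + (Suc n1 + (Suc n1 + (Suc n2 + (Suc n2 + (Suc 0 +
     (Suc (length v - (hx + n2)) + (Suc j + (Suc r + (Suc (length cs) + (Suc (length cs) + (n13 +
     (Suc 0 + (Suc n13 + Suc (length ds))))))))))))))) \<le> 12 * (length v + 2) + 2 * poly p (length v)"
    using lcs lds j lD(1) xs(2) unfolding n_def[symmetric] diff_zero e_def[symmetric] by simp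
  moreover have "f16 (6 + num_tapes M) = (string_tape [accepts F v], 0)"
    using f16 acc by (simp add: l_def string_tape_ltape)
  ultimately show ?thesis using steps by blast
qed

text \<open>The \<open>9\<close> symbols are the blank and the symbols \<open>1\<close> to
  \<open>8\<close> of the decoded advice.\<close>

lemma prog_ok_verifier:
  assumes wf: "tm_wf M" and S: "S \<ge> 9" "S \<ge> num_symbols M"
  shows "prog_ok (7 + num_tapes M) S (verifier_prog M)"
proof -
  let ?k = "5 + num_tapes M" and ?l = "6 + num_tapes M"
  have bs: "bit_sym b < S" for b using S by (auto simp: bit_sym_def)
  have sim: "prog_ok (7 + num_tapes M) S (sim_prog M)"
  proof (rule prog_okI)
    fix q r q' A
    assume q: "q < fst (sim_prog M)" and r: "\<forall>i. r i < S" and e: "snd (sim_prog M) q r = (q', A)"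
    define rs where "rs = map (\<lambda>i. r (6 + i)) [0..<num_tapes M]"
    obtain q1 as where d: "delta M q rs = (q1, as)" by force
    show "q' \<le> fst (sim_prog M) \<and> (\<forall>i. fst (A i) < S) \<and> (\<forall>i \<ge> 7 + num_tapes M. A i = (r i, Move_Stay))"
    proof (cases "set rs \<subseteq> {..<num_symbols M}")
      case True
      have ok: "q1 \<le> num_states M \<and> length as = num_tapes M \<and> fst ` set as \<subseteq> {..<num_symbols M}"
        using tm_wfD[OF wf _ _ True d] q by (simp add: rs_def sim_prog_def)
      have as: "fst (as ! i) < num_symbols M" if "i < num_tapes M" for i
        using ok that by (auto simp: subset_iff)
      have "q' = q1" "A = (\<lambda>i. if 6 \<le> i \<and> i < 6 + num_tapes M then as ! (i - 6)
               else if i = 5 then (move_code (snd (last as)), Move_Right) else (r i, Move_Stay))"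
        using e True unfolding sim_prog_def snd_conv Let_def rs_def[symmetric] by (auto simp: d)
      then show ?thesis using ok r as code_shift_move_code(3)[of "snd (last as)"]
        using S as[THEN less_le_trans[OF _ S(2)]] by (auto simp: sim_prog_def)
    next
      case False
      then have "q' = num_states M" "A = (\<lambda>i. (r i, Move_Stay))"
        using e unfolding sim_prog_def snd_conv Let_def rs_def[symmetric] by auto
      then show ?thesis using r by (simp add: sim_prog_def)
    qed
  qed
  have "prog_ok (7 + num_tapes M) S (once (\<lambda>r. (mv Move_Stay {} r)(?l := (2, Move_Stay))))"
    "prog_ok (7 + num_tapes M) S (once (mv Move_Left {5}))"
    unfolding once_def using S by (intro prog_ok_while; simp add: mv_def)+
  moreover have "prog_ok (7 + num_tapes M) S decode_prog"
    unfolding decode_prog_def using S by (intro prog_ok_while) (auto simp: mv_def min_def)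
  moreover have "prog_ok (7 + num_tapes M) S (skip_prog ?l)"
    unfolding skip_prog_def using S by (intro prog_ok_while) (simp_all add: mv_def)
  moreover have "prog_ok (7 + num_tapes M) S (match_prog ?l)"
    unfolding match_prog_def using S by (intro prog_ok_while) (simp_all add: mv_def bs)
  moreover have "prog_ok (7 + num_tapes M) S (replay_prog ?k)"
    unfolding replay_prog_def using S by (intro prog_ok_while) (simp_all add: mv_def)
  moreover have "prog_ok (7 + num_tapes M) S (compare_prog ?k ?l)"
    unfolding compare_prog_def using S by (intro prog_ok_while) (simp_all add: mv_def)
  ultimately show ?thesis
    unfolding verifier_prog_def Let_def
    by (intro prog_ok_pseq prog_ok_copy prog_ok_rewind prog_ok_scan sim) simp_all
qed

theorem accepts_in_P:
  assumes "poly_time F"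
  shows "{v. accepts F v} \<in> class_P"
proof -
  obtain M p where wf: "tm_wf M" and M: "\<And>x. \<exists>t \<le> poly p (length x). tm_outputs M x t (F x)"
    using assms by (auto simp: poly_time_def)
  define S where "S = max 9 (num_symbols M)"
  define C where "C = compile (7 + num_tapes M) S (verifier_prog M)"
  have S: "S \<ge> 9" "S \<ge> num_symbols M" by (auto simp: S_def)
  have "tm_wf C" unfolding C_def by (rule tm_wf_compile[OF prog_ok_verifier[OF wf S]]) (use S in auto)
  moreover have "\<exists>t \<le> poly ([:24, 12:] + smult 2 p) (length v). tm_outputs C v t [v \<in> {v. accepts F v}]" for v
  proof -
    define f :: tapes where "f = (\<lambda>i. (if i = 0 then string_tape v else (\<lambda>_. 0), 0))"
    obtain n f' where n: "n \<le> 12 * (length v + 2) + 2 * poly p (length v)"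
      and s: "steps (verifier_prog M) 0 f n f'"
      and f': "f' (6 + num_tapes M) = (string_tape [accepts F v], 0)"
      using verifier_steps[OF wf M f_def] by blast
    have "(tm_step C ^^ n) (0, map f [0..<7 + num_tapes M]) = (fst (verifier_prog M), map f' [0..<7 + num_tapes M])"
      unfolding C_def by (rule compile_steps[OF s prog_ok_verifier[OF wf S]]) (use S in \<open>auto simp: f_def string_tape_def\<close>)
    moreover have "tm_init C v = (0, map f [0..<7 + num_tapes M])"
      by (simp add: tm_init_def C_def compile_def f_def)
    moreover have "last (map f' [0..<7 + num_tapes M]) = f' (6 + num_tapes M)"
      by (simp add: last_map)
    ultimately have "tm_outputs C v n [v \<in> {v. accepts F v}]"
      using f' by (simp add: tm_outputs_def C_def compile_def)
    then show ?thesis using n by (intro exI[of _ n]) (auto simp: algebra_simps)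
  qed
  ultimately show ?thesis unfolding class_P_def poly_time_def by blast
qed

section \<open>Advice words and their certificates\<close>

definition enc_syms :: "nat list \<Rightarrow> bool list" where
  "enc_syms cs = concat (map (\<lambda>c. replicate c True @ [False]) cs)"

lemma dec_replicate: "k + c \<le> 8 \<Longrightarrow> dec k (replicate c True @ bs) = dec (k + c) bs"
  by (induction c arbitrary: k) auto

lemma dec_enc_syms: "\<forall>c \<in> set cs. 1 \<le> c \<and> c \<le> 8 \<Longrightarrow> dec 0 (enc_syms cs @ bs) = cs @ dec 0 bs"
  by (induction cs) (auto simp: enc_syms_def dec_replicate)

lemma length_enc_syms: "length cs \<le> length (enc_syms cs)"
  by (induction cs) (auto simp: enc_syms_def)

lemma length_enc_syms_le: "\<forall>c \<in> set cs. c \<le> 8 \<Longrightarrow> length (enc_syms cs) \<le> 9 * length cs"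
  by (induction cs) (auto simp: enc_syms_def)

text \<open>The number of \<open>4\<close>s before position \<open>i\<close> is how far the head on
  \<open>x\<close> has advanced by then.\<close>

definition fits :: "nat list \<Rightarrow> bool list \<Rightarrow> bool list \<Rightarrow> bool" where
  "fits ts x Y \<longleftrightarrow> length Y = length ts \<and> (\<forall>i < length ts.
     symbol_ok (ts ! i) (x ! count_list (take i ts) 4) (Y ! i) (if i = 0 then False else Y ! (i - 1)))"

lemma all_less_Suc_conv: "(\<forall>i < Suc m. P i) \<longleftrightarrow> P 0 \<and> (\<forall>i < m. P (Suc i))"
  using less_Suc_eq_0_disj by auto

lemma matches_iff:
  "matches cs X hx W hw prev \<longleftrightarrow> (\<forall>i < length cs. symbol_ok (cs ! i)
     (X (hx + int (count_list (take i cs) 4))) (W (hw + int i)) (if i = 0 then prev else W (hw + int i - 1)))"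
proof (induction cs arbitrary: hx hw prev)
  case Nil
  then show ?case by simp
next
  case (Cons c cs)
  have e: "symbol_ok d x b (if i = 0 then W hw else W (hw + 1 + int i - 1)) =
     symbol_ok d x b (W (hw + int i))" for d x b i
    by (cases i) (simp_all add: algebra_simps)
  show ?case
    unfolding matches.simps Cons.IH length_Cons all_less_Suc_conv e by (simp add: algebra_simps)
qed

definition block :: "nat list \<times> bool list \<Rightarrow> nat list" where
  "block b = 6 # fst b @ 7 # map bit_sym (snd b)"

definition blocks :: "(nat list \<times> bool list) list \<Rightarrow> nat list" where
  "blocks B = concat (map block B)"

lemma bit_sym_inj: "map bit_sym y = map bit_sym y' \<longleftrightarrow> y = y'"
proof -
  have "inj bit_sym" by (auto simp: inj_def bit_sym_def)
  then show ?thesis by (simp add: inj_map_eq_map)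
qed

lemma set_blocks:
  assumes "\<forall>b \<in> set B. set (fst b) \<subseteq> {1..5}" "c \<in> set (blocks B)"
  shows "1 \<le> c" "c \<le> 7"
proof -
  obtain b where b: "b \<in> set B" "c \<in> set (block b)" using assms(2) by (auto simp: blocks_def)
  have "set (fst b) \<subseteq> {1..5}" using assms(1) b(1) by blast
  then show "1 \<le> c" "c \<le> 7" using b(2) by (auto simp: block_def bit_sym_def)
qed

text \<open>Templates use only \<open>1\<close> to \<open>5\<close> and expected outputs only
  \<open>1\<close> and \<open>2\<close>, so a \<open>6\<close> can only be the start of a block, and
  its position identifies the block.\<close>

lemma blocks_nth_6:
  assumes "\<forall>b \<in> set B. set (fst b) \<subseteq> {1..5}" "r < length (blocks B)" "blocks B ! r = 6"
  shows "\<exists>B1 b B2. B = B1 @ b # B2 \<and> r = length (blocks B1)"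
  using assms
proof (induction B arbitrary: r)
  case Nil
  then show ?case by (simp add: blocks_def)
next
  case (Cons b B)
  have bl: "blocks (b # B) = block b @ blocks B" by (simp add: blocks_def)
  show ?case
  proof (cases "r < length (block b)")
    case True
    have "r = 0"
    proof (rule ccontr)
      assume "r \<noteq> 0"
      then obtain r' where r': "r = Suc r'" by (cases r) auto
      have "block b ! r = 6" using Cons.prems(3) True unfolding bl nth_append by simp
      then have "(fst b @ 7 # map bit_sym (snd b)) ! r' = 6" "r' < length (fst b @ 7 # map bit_sym (snd b))"
        using True by (auto simp: block_def r')
      then have "6 \<in> set (fst b @ 7 # map bit_sym (snd b))" by (metis nth_mem)
      then show False using Cons.prems(1) by (auto simp: bit_sym_def split: if_splits)
    qed
    then show ?thesis by (intro exI[of _ "[]"] exI[of _ b] exI[of _ B]) (auto simp: blocks_def)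
  next
    case False
    then have "r - length (block b) < length (blocks B)" "blocks B ! (r - length (block b)) = 6"
      using Cons.prems(2,3) by (auto simp: bl nth_append)
    then obtain B1 b' B2 where "B = B1 @ b' # B2" "r - length (block b) = length (blocks B1)"
      using Cons.IH[of "r - length (block b)"] Cons.prems(1) by fastforce
    then show ?thesis using False
      by (intro exI[of _ "b # B1"] exI[of _ b'] exI[of _ B2]) (auto simp: blocks_def)
  qed
qed

lemma string_tape_append: "string_tape (u @ w) (int (length u + i)) = 2 \<longleftrightarrow> i < length w \<and> w ! i"
  unfolding string_tape_eq_2 by (simp add: nth_append)

lemma takeWhile_replicate_True: "takeWhile id (replicate n True @ False # w) = replicate n True"
  by (induction n) auto

lemma symbol_ok_irrelevant: "c \<noteq> 4 \<Longrightarrow> symbol_ok c x b p = symbol_ok c x' b p"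
  by (auto simp: symbol_ok_def)

text \<open>The blanks behind a short \<open>w\<close> count as \<open>False\<close>, so that
  \<open>Y\<close> always has the length of the template. The bound on the number of
  \<open>4\<close>s keeps the head on \<open>x\<close> from running into the advice.\<close>

lemma accepts_at:
  fixes w :: "bool list"
  assumes B: "\<forall>b \<in> set (B1 @ b # B2). set (fst b) \<subseteq> {1..5}"
    and c4: "count_list (fst b) 4 \<le> length x"
    and z: "z = pair_enc x (enc_syms (blocks (B1 @ b # B2) @ [8]))"
    and r: "length (takeWhile id w) = length (blocks B1)"
    and Y: "Y = map (\<lambda>i. length (blocks B1) + 1 + i < length w \<and> w ! (length (blocks B1) + 1 + i)) [0..<length (fst b)]"
  shows "accepts F (pair_enc z w) \<longleftrightarrow> fits (fst b) x Y \<and> F Y = snd b"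
proof -
  define v where "v = pair_enc z w"
  define a where "a = enc_syms (blocks (B1 @ b # B2) @ [8])"
  have za: "z = replicate (length x) True @ False # x @ a" by (simp add: z pair_enc_def a_def)
  have v: "v = replicate (length z) True @ False # z @ w" by (simp add: v_def pair_enc_def)
  have n1: "ones_from v 0 = length z" by (simp add: ones_from_def v takeWhile_replicate_True)
  have d1: "drop (length z + 1) v = z @ w" by (simp add: v)
  have n2: "ones_from v (length z + 1) = length x"
    unfolding ones_from_def d1 by (simp add: za takeWhile_replicate_True)
  define hx hw where "hx = length z + 1 + length x + 1" and "hw = length z + 1 + length z"
  have vx: "v = (replicate (length z) True @ False # replicate (length x) True @ [False]) @ x @ a @ w"
    by (simp add: v za)
  have vw: "v = (replicate (length z) True @ False # z) @ w" by (simp add: v)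
  have X: "string_tape v (int hx + int i) = 2 \<longleftrightarrow> x ! i" if "i < length x" for i
    using that string_tape_append[of "replicate (length z) True @ False # replicate (length x) True @ [False]" "x @ a @ w" i]
    unfolding vx[symmetric] by (simp add: hx_def nth_append add.assoc)
  have W: "string_tape v (int (hw + i)) = 2 \<longleftrightarrow> i < length w \<and> w ! i" for i
    using string_tape_append[of "replicate (length z) True @ False # z" w i]
    unfolding vw[symmetric] by (simp add: hw_def)
  have P: "\<not> string_tape v (int (length z + 1 + length x)) = 2"
    unfolding string_tape_eq_2 vx by (simp add: nth_append)
  have da: "drop (hx + length x) v = a @ w" unfolding vx hx_def by simp
  have dw: "drop hw v = w" unfolding vw hw_def by simp
  have syms: "\<forall>c \<in> set (blocks (B1 @ b # B2) @ [8]). 1 \<le> c \<and> c \<le> 8"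
    using set_blocks[OF B] by fastforce
  define R where "R = blocks B2 @ [8] @ dec 0 w"
  define D where "D = dec 0 (drop (hx + length x) v)"
  have D: "D = blocks B1 @ 6 # fst b @ 7 # map bit_sym (snd b) @ R"
    unfolding D_def da a_def dec_enc_syms[OF syms] by (simp add: blocks_def block_def R_def)
  \<comment> \<open>Behind a block comes a \<open>6\<close> or the final \<open>8\<close>, and
    either one ends the expected output.\<close>
  have R: "\<exists>c R'. R = c # R' \<and> c \<notin> {1..5} \<and> c \<noteq> 1 \<and> c \<noteq> 2"
    by (cases B2) (auto simp: R_def blocks_def block_def)
  define r where "r = length (blocks B1)"
  have rr: "ones_from v hw = r" unfolding ones_from_def dw using r by (simp add: r_def)
  define cs where "cs = takeWhile (\<lambda>c. 1 \<le> c \<and> c \<le> 5) (drop (r + 1) D)"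
  have d2: "drop (r + 1) D = fst b @ 7 # map bit_sym (snd b) @ R" by (simp add: D r_def)
  have cs: "cs = fst b"
  proof -
    have "\<forall>c \<in> set (fst b). 1 \<le> c \<and> c \<le> 5" using B by auto
    then show ?thesis unfolding cs_def d2 by (simp add: takeWhile_append2)
  qed
  have d3: "drop (r + 1 + length cs + 1) D = map bit_sym (snd b) @ R"
    by (simp add: D r_def cs)
  have tw: "takeWhile (\<lambda>c. c = 1 \<or> c = 2) (drop (r + 1 + length cs + 1) D) = map bit_sym (snd b)"
  proof -
    obtain c R' where "R = c # R'" "c \<noteq> 1" "c \<noteq> 2" using R by blast
    then have "takeWhile (\<lambda>c. c = 1 \<or> c = 2) R = []" by simp
    moreover have "c = 1 \<or> c = 2" if "c \<in> set (map bit_sym (snd b))" for c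
      using that by (auto simp: bit_sym_def)
    ultimately show ?thesis unfolding d3 by (subst takeWhile_append2) auto
  qed
  have no8: "ltape D (int i) \<noteq> 8" if i: "i < r" for i
  proof -
    have "ltape D (int i) = blocks B1 ! i" using i by (simp add: ltape_def D r_def nth_append)
    moreover have "blocks B1 ! i \<in> set (blocks B1)" using i by (simp add: r_def)
    moreover have "8 \<notin> set (blocks B1)" using set_blocks(2)[of B1 8] B by auto
    ultimately show ?thesis by metis
  qed
  have is6: "ltape D (int r) = 6" by (simp add: ltape_def D r_def nth_append)
  have YY: "map (\<lambda>i. string_tape v (int (hw + r + 1 + i)) = 2) [0..<length cs] = Y"
    unfolding Y cs r_def[symmetric] by (rule map_cong[OF refl]) (simp only: add.assoc W)
  have Yi: "Y ! i \<longleftrightarrow> string_tape v (int (hw + r + 1) + int i) = 2" if "i < length (fst b)" for i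
    using that W[of "r + 1 + i"] by (simp add: Y r_def add.assoc)
  have lY: "length Y = length (fst b)" by (simp add: Y)
  have M: "matches cs (\<lambda>i. string_tape v i = 2) (int hx) (\<lambda>i. string_tape v i = 2) (int (hw + r + 1))
       (string_tape v (int (length z + 1 + length x)) = 2) \<longleftrightarrow> fits (fst b) x Y"
  proof -
    have "symbol_ok (fst b ! i) (string_tape v (int hx + int (count_list (take i (fst b)) 4)) = 2)
        (string_tape v (int (hw + r + 1) + int i) = 2)
        (if i = 0 then string_tape v (int (length z + 1 + length x)) = 2
         else string_tape v (int (hw + r + 1) + int i - 1) = 2) \<longleftrightarrow>
      symbol_ok (fst b ! i) (x ! count_list (take i (fst b)) 4) (Y ! i) (if i = 0 then False else Y ! (i - 1))"
      if i: "i < length (fst b)" for i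
    proof -
      have prev: "(if i = 0 then string_tape v (int (length z + 1 + length x)) = 2
         else string_tape v (int (hw + r + 1) + int i - 1) = 2) = (if i = 0 then False else Y ! (i - 1))"
      proof (cases i)
        case 0
        then show ?thesis using P by simp
      next
        case (Suc i')
        then show ?thesis using Yi[of i'] i by (simp add: algebra_simps)
      qed
      show ?thesis
      proof (cases "fst b ! i = 4")
        case True
        have "fst b = take i (fst b) @ 4 # drop (Suc i) (fst b)"
          using i True by (metis id_take_nth_drop)
        then have "count_list (fst b) 4 = count_list (take i (fst b) @ 4 # drop (Suc i) (fst b)) 4"
          by (rule arg_cong)
        then have "count_list (take i (fst b)) 4 < length x" using c4 by simp
        from X[OF this] show ?thesis using prev Yi[OF i] by simp
      next
        case False
        show ?thesis unfolding prev Yi[OF i, symmetric] by (rule symbol_ok_irrelevant[OF False])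
      qed
    qed
    then show ?thesis unfolding matches_iff fits_def cs using lY by auto
  qed
  show "accepts F (pair_enc z w) \<longleftrightarrow> fits (fst b) x Y \<and> F Y = snd b"
    unfolding v_def[symmetric] accepts_def Let_def n1 n2 hx_def[symmetric] hw_def[symmetric] rr
      D_def[symmetric] cs_def[symmetric] YY M tw bit_sym_inj
    using no8 is6 by auto
qed

text \<open>Here the end mark pays off: all that follows it is decoded from the witness, and the
  walk to the selected position must not pass it.\<close>

lemma accepts_block:
  assumes B: "\<forall>b \<in> set B. set (fst b) \<subseteq> {1..5}"
    and z: "z = pair_enc x (enc_syms (blocks B @ [8]))"
    and acc: "accepts F (pair_enc z w)"
  shows "\<exists>B1 b B2. B = B1 @ b # B2 \<and> length (takeWhile id w) = length (blocks B1)"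
proof -
  define v where "v = pair_enc z w"
  define a where "a = enc_syms (blocks B @ [8])"
  have za: "z = replicate (length x) True @ False # x @ a" by (simp add: z pair_enc_def a_def)
  have v: "v = replicate (length z) True @ False # z @ w" by (simp add: v_def pair_enc_def)
  have n1: "ones_from v 0 = length z" by (simp add: ones_from_def v takeWhile_replicate_True)
  have d1: "drop (length z + 1) v = z @ w" by (simp add: v)
  have n2: "ones_from v (length z + 1) = length x"
    unfolding ones_from_def d1 by (simp add: za takeWhile_replicate_True)
  have vx: "v = (replicate (length z) True @ False # replicate (length x) True @ [False]) @ x @ a @ w"
    by (simp add: v za)
  have vw: "v = (replicate (length z) True @ False # z) @ w" by (simp add: v)
  have da: "drop (length z + 1 + length x + 1 + length x) v = a @ w" unfolding vx by simp
  have dw: "drop (length z + 1 + length z) v = w" unfolding vw by simp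
  have syms: "\<forall>c \<in> set (blocks B @ [8]). 1 \<le> c \<and> c \<le> 8"
    using set_blocks[OF B] by fastforce
  define r where "r = length (takeWhile id w)"
  define D where "D = blocks B @ 8 # dec 0 w"
  have D: "dec 0 (drop (length z + 1 + length x + 1 + length x) v) = D"
    unfolding da a_def dec_enc_syms[OF syms] by (simp add: D_def)
  have 1: "\<forall>i < r. ltape D (int i) \<noteq> 8" "ltape D (int r) = 6"
    using acc unfolding v_def[symmetric] accepts_def Let_def n1 n2 D unfolding ones_from_def dw r_def
    by blast+
  have l8: "ltape D (int (length (blocks B))) = 8" by (simp add: D_def ltape_def nth_append)
  have "r < length (blocks B)"
  proof (rule ccontr)
    assume "\<not> r < length (blocks B)"
    then consider "r = length (blocks B)" | "length (blocks B) < r" by linarith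
    then show False using 1 l8 by cases auto
  qed
  moreover from this have "blocks B ! r = 6" using 1(2) by (simp add: ltape_def D_def nth_append)
  ultimately show ?thesis using blocks_nth_6[OF B] unfolding r_def by blast
qed

theorem ex_witness_iff:
  assumes B: "\<forall>b \<in> set B. set (fst b) \<subseteq> {1..5} \<and> count_list (fst b) 4 \<le> length x"
    and z: "z = pair_enc x (enc_syms (blocks B @ [8]))"
  shows "(\<exists>w. length w \<le> length z \<and> accepts F (pair_enc z w)) \<longleftrightarrow>
    (\<exists>b \<in> set B. \<exists>Y. fits (fst b) x Y \<and> F Y = snd b)"
proof
  assume "\<exists>w. length w \<le> length z \<and> accepts F (pair_enc z w)"
  then obtain w where acc: "accepts F (pair_enc z w)" by blast
  have B': "\<forall>b \<in> set B. set (fst b) \<subseteq> {1..5}" using B by blast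
  obtain B1 b B2 where b: "B = B1 @ b # B2" "length (takeWhile id w) = length (blocks B1)"
    using accepts_block[OF B' z acc] by blast
  have c4: "count_list (fst b) 4 \<le> length x" using B b(1) by auto
  from accepts_at[OF B'[unfolded b(1)] c4 z[unfolded b(1)] b(2) refl, of F] acc
  show "\<exists>b \<in> set B. \<exists>Y. fits (fst b) x Y \<and> F Y = snd b" using b(1) by auto
next
  assume "\<exists>b \<in> set B. \<exists>Y. fits (fst b) x Y \<and> F Y = snd b"
  then obtain b Y where bY: "b \<in> set B" "fits (fst b) x Y" "F Y = snd b" by blast
  obtain B1 B2 where b: "B = B1 @ b # B2" using bY(1) by (meson split_list)
  define w where "w = replicate (length (blocks B1)) True @ False # Y"
  have B': "\<forall>b \<in> set B. set (fst b) \<subseteq> {1..5}" and c4: "count_list (fst b) 4 \<le> length x"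
    using B b(1) by auto
  have tw: "length (takeWhile id w) = length (blocks B1)" by (simp add: w_def takeWhile_replicate_True)
  have lY: "length Y = length (fst b)" using bY(2) by (simp add: fits_def)
  have Y: "Y = map (\<lambda>i. length (blocks B1) + 1 + i < length w \<and> w ! (length (blocks B1) + 1 + i)) [0..<length (fst b)]"
    by (rule nth_equalityI) (auto simp: w_def lY nth_append)
  have "accepts F (pair_enc z w)"
    using accepts_at[OF B'[unfolded b] c4 z[unfolded b] tw Y, of F] bY by blast
  \<comment> \<open>The selected block stands in the advice behind the symbols counted by the prefix
    of \<open>w\<close>, and its template is as long as \<open>Y\<close>. So the witness is never
    longer than \<open>z\<close>, and the identity serves as length bound for
    \<open>NP\<close>.\<close>
  moreover have "length w \<le> length z"
  proof -
    have "length w \<le> length (blocks B @ [8])"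
      by (simp add: w_def lY b blocks_def block_def)
    also have "\<dots> \<le> length z" using length_enc_syms[of "blocks B @ [8]"] by (simp add: z pair_enc_def)
    finally show ?thesis .
  qed
  ultimately show "\<exists>w. length w \<le> length z \<and> accepts F (pair_enc z w)" by blast
qed

section \<open>Polynomial-size formulas for Turing machine runs\<close>

definition poly_bounded :: "(nat \<Rightarrow> nat) \<Rightarrow> bool" where
  "poly_bounded f \<longleftrightarrow> (\<exists>p :: nat poly. \<forall>n. f n \<le> poly p n)"

lemma poly_bounded_const: "poly_bounded (\<lambda>_. c)"
  unfolding poly_bounded_def by (intro exI[of _ "[:c:]"]) simp

lemma poly_bounded_id: "poly_bounded (\<lambda>n. n)"
  unfolding poly_bounded_def by (intro exI[of _ "[:0, 1:]"]) simp

lemma poly_bounded_add: "poly_bounded f \<Longrightarrow> poly_bounded g \<Longrightarrow> poly_bounded (\<lambda>n. f n + g n)"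
  unfolding poly_bounded_def by (metis add_mono poly_add)

lemma poly_bounded_mult: "poly_bounded f \<Longrightarrow> poly_bounded g \<Longrightarrow> poly_bounded (\<lambda>n. f n * g n)"
  unfolding poly_bounded_def by (metis mult_le_mono poly_mult)

lemma poly_bounded_Suc: "poly_bounded f \<Longrightarrow> poly_bounded (\<lambda>n. Suc (f n))"
  using poly_bounded_add[OF _ poly_bounded_const[of 1]] by simp

lemma poly_bounded_power: "poly_bounded f \<Longrightarrow> poly_bounded (\<lambda>n. f n ^ k)"
  by (induction k) (auto intro: poly_bounded_const poly_bounded_mult)

lemma poly_bounded_poly: "poly_bounded f \<Longrightarrow> poly_bounded (\<lambda>n. poly p (f n))"
  unfolding poly_bounded_def by (metis poly_nat_mono poly_pcompose)

lemma poly_bounded_mono: "poly_bounded g \<Longrightarrow> (\<And>n. f n \<le> g n) \<Longrightarrow> poly_bounded f"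
  unfolding poly_bounded_def by (meson le_trans)

lemmas poly_bounded_intros = poly_bounded_const poly_bounded_id poly_bounded_add poly_bounded_mult
  poly_bounded_Suc poly_bounded_power poly_bounded_poly

definition sat :: "('v \<Rightarrow> bool) \<Rightarrow> ('v \<times> bool) set set \<Rightarrow> bool" where
  "sat \<alpha> \<Phi> \<longleftrightarrow> (\<forall>C \<in> \<Phi>. \<exists>l \<in> C. \<alpha> (fst l) = snd l)"

definition horn :: "'v set \<Rightarrow> 'v \<Rightarrow> ('v \<times> bool) set" where
  "horn A c = (\<lambda>v. (v, False)) ` A \<union> {(c, True)}"

lemma horn_true: "(\<exists>l \<in> horn A c. \<alpha> (fst l) = snd l) \<longleftrightarrow> ((\<forall>v \<in> A. \<alpha> v) \<longrightarrow> \<alpha> c)"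
  by (auto simp: horn_def)

lemma sat_Un: "sat \<alpha> (A \<union> B) \<longleftrightarrow> sat \<alpha> A \<and> sat \<alpha> B"
  by (auto simp: sat_def)

text \<open>
  At time \<open>t\<close>: the state is \<open>q\<close> (\<open>St t q\<close>), the head on tape \<open>i\<close> is at \<open>h\<close> (\<open>Hd t i h\<close>), cell \<open>h\<close> of tape \<open>i\<close>
  contains \<open>c\<close> (\<open>Ce t i h c\<close>). The step clauses are Horn clauses: every satisfying assignment makes at
  least the facts of the actual run true, so no uniqueness clauses are needed.
\<close>

datatype cvar = St nat nat | Hd nat nat int | Ce nat nat int nat

lemma act_self: "act t (fst t (snd t), Move_Stay) = t"
  by (cases t) auto

lemma snd_act: "snd (act t a) = snd t + shift (snd a)"
  by (cases t; cases a) auto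

lemma string_tape_of_nat: "string_tape v (int j) = (if j < length v then bit_sym (v ! j) else 0)"
  by (simp add: string_tape_def bit_sym_def)

lemma string_tape_append_int:
  "string_tape (u @ w) h = (if h < int (length u) then string_tape u h else string_tape w (h - int (length u)))"
proof (cases "h < 0")
  case True
  then show ?thesis by (simp add: string_tape_def)
next
  case False
  then obtain j where j: "h = int j" by (metis nonneg_int_cases linorder_not_less)
  show ?thesis
  proof (cases "j < length u")
    case True
    then show ?thesis unfolding j string_tape_of_nat by (simp add: nth_append)
  next
    case False
    then have "int j - int (length u) = int (j - length u)" by simp
    then show ?thesis unfolding j string_tape_of_nat using False
      by (simp only: string_tape_of_nat) (auto simp: nth_append)
  qed
qed

text \<open>\<open>m\<close> is the length of the input, \<open>pl\<close> bounds the length of a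
  witness and \<open>T\<close> the running time on their pair.\<close>

locale run_formula =
  fixes M :: tm and m pl T :: nat
  assumes wf: "tm_wf M"
begin

abbreviation "K \<equiv> num_tapes M"
abbreviation "S \<equiv> num_symbols M"
abbreviation "Q \<equiv> num_states M"

definition len :: nat where "len = 2 * m + 1 + pl"
text \<open>Heads stay within distance \<open>T\<close> of cell \<open>0\<close>, and the input lies
  below cell \<open>len\<close>. The extra \<open>1\<close> leaves room for the move of a head at
  the border of the range in \<open>local_confs\<close>.\<close>

definition R :: int where "R = int (T + len + 1)"
definition pos :: "int set" where "pos = {-R..R}"

definition vars :: "cvar set" where
  "vars = (\<lambda>(t, q). St t q) ` ({..T} \<times> {..Q}) \<union>
     (\<lambda>(t, i, h). Hd t i h) ` ({..T} \<times> {..<K} \<times> pos) \<union>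
     (\<lambda>(t, i, h, c). Ce t i h c) ` ({..T} \<times> {..<K} \<times> pos \<times> {..<S})"

text \<open>These are the cells of \<open>pair_enc x w\<close> that are the same for all
  \<open>x\<close> and \<open>w\<close>: the length prefix, the separator, and the blanks around the
  word.\<close>

definition init_sym :: "int \<Rightarrow> nat" where
  "init_sym h = (if 0 \<le> h \<and> h < int m then 2 else if h = int m then 1 else 0)"

text \<open>The bits of \<open>x\<close> and \<open>w\<close> stay free. A witness may be shorter
  than \<open>pl\<close>, so its cells may be blank; the last family makes blanks propagate to the
  right, so that the cells hold a word without gaps.\<close>

definition init_clauses :: "(cvar \<times> bool) set set" where
  "init_clauses =
     (\<lambda>_. horn {} (St 0 0)) ` {()} \<union>
     (\<lambda>i. horn {} (Hd 0 i 0)) ` {..<K} \<union>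
     (\<lambda>(i, h). horn {} (Ce 0 i h 0)) ` ({1..<K} \<times> pos) \<union>
     (\<lambda>h. horn {} (Ce 0 0 h (init_sym h))) ` (pos - {int m + 1..<int len}) \<union>
     (\<lambda>h. {(Ce 0 0 h 1, True), (Ce 0 0 h 2, True)}) ` {int m + 1..<2 * int m + 1} \<union>
     (\<lambda>h. {(Ce 0 0 h 0, True), (Ce 0 0 h 1, True), (Ce 0 0 h 2, True)}) ` {2 * int m + 1..<int len} \<union>
     (\<lambda>h. horn {Ce 0 0 h 0} (Ce 0 0 (h + 1) 0)) ` {2 * int m + 1..<int len}"

text \<open>A halted machine idles, so the answer of every run, however short, can be inspected at
  the common time \<open>T\<close>.\<close>

definition next_act :: "nat \<Rightarrow> nat list \<Rightarrow> nat \<times> (nat \<times> move) list" where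
  "next_act q rs = (if q < Q then delta M q rs else (q, map (\<lambda>c. (c, Move_Stay)) rs))"

text \<open>All that a single step depends on. Since the number of tapes is constant, listing every
  tuple of head positions costs only a fixed power of the width of the window.\<close>

definition local_confs :: "(nat \<times> nat \<times> int list \<times> nat list) set" where
  "local_confs = {..<T} \<times> {..Q} \<times> {hs. set hs \<subseteq> {-R + 1..R - 1} \<and> length hs = K} \<times>
     {rs. set rs \<subseteq> {..<S} \<and> length rs = K}"

definition local_facts :: "nat \<Rightarrow> nat \<Rightarrow> int list \<Rightarrow> nat list \<Rightarrow> cvar set" where
  "local_facts t q hs rs = insert (St t q) ((\<lambda>i. Hd t i (hs ! i)) ` {..<K} \<union> (\<lambda>i. Ce t i (hs ! i) (rs ! i)) ` {..<K})"

text \<open>The tautologies for \<open>h' = h\<close> only serve to keep the index set a product.\<close>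

definition step_clauses :: "(cvar \<times> bool) set set" where
  "step_clauses =
     (\<lambda>(t, q, hs, rs). horn (local_facts t q hs rs) (St (Suc t) (fst (next_act q rs)))) ` local_confs \<union>
     (\<lambda>((t, q, hs, rs), i). horn (local_facts t q hs rs)
        (Hd (Suc t) i (hs ! i + shift (snd (snd (next_act q rs) ! i))))) ` (local_confs \<times> {..<K}) \<union>
     (\<lambda>((t, q, hs, rs), i). horn (local_facts t q hs rs)
        (Ce (Suc t) i (hs ! i) (fst (snd (next_act q rs) ! i)))) ` (local_confs \<times> {..<K}) \<union>
     (\<lambda>(t, i, h, h', c). if h' = h then horn {Ce t i h c} (Ce t i h c)
        else horn {Hd t i h, Ce t i h' c} (Ce (Suc t) i h' c)) ` ({..<T} \<times> {..<K} \<times> pos \<times> pos \<times> {..<S})"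

text \<open>The answer \<open>[False]\<close> is the symbol \<open>1\<close> in cell
  \<open>0\<close> of the last tape. A satisfying assignment makes the true content of this cell
  true, so excluding \<open>1\<close> leaves only runs that answer \<open>True\<close>.\<close>

definition final_clauses :: "(cvar \<times> bool) set set" where
  "final_clauses = {{(Ce T (K - 1) 0 1, False)}}"

definition formula :: "(cvar \<times> bool) set set" where
  "formula = init_clauses \<union> step_clauses \<union> final_clauses"

section \<open>Runs and satisfying assignments\<close>

definition cfg :: "bool list \<Rightarrow> nat \<Rightarrow> config" where
  "cfg v t = (tm_step M ^^ t) (tm_init M v)"

abbreviation "tape v t i \<equiv> snd (cfg v t) ! i"

lemma K1: "K \<ge> 1" and S3: "S \<ge> 3"
  using wf by (auto simp: tm_wf_def)

lemma cfg_ok: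
  "fst (cfg v t) \<le> Q \<and> length (snd (cfg v t)) = K \<and> (\<forall>tp \<in> set (snd (cfg v t)). \<forall>j. fst tp j < S)"
proof (induction t)
  case 0
  then show ?case using S3 by (auto simp: cfg_def tm_init_def string_tape_def)
next
  case (Suc t)
  obtain q ts where c: "cfg v t = (q, ts)" by force
  obtain q' ts' where c': "tm_step M (q, ts) = (q', ts')" by force
  have "cfg v (Suc t) = (q', ts')" using c c' by (simp add: cfg_def)
  then show ?case using tm_step_ok[OF wf _ _ _ c'] Suc c by simp
qed

definition reads :: "bool list \<Rightarrow> nat \<Rightarrow> nat list" where
  "reads v t = map (\<lambda>(t, h). t h) (snd (cfg v t))"

definition heads :: "bool list \<Rightarrow> nat \<Rightarrow> int list" where
  "heads v t = map snd (snd (cfg v t))"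

lemma length_reads: "length (reads v t) = K" "length (heads v t) = K"
  using cfg_ok[of v t] by (auto simp: reads_def heads_def)

lemma reads_nth: "i < K \<Longrightarrow> reads v t ! i = fst (tape v t i) (snd (tape v t i))"
  "i < K \<Longrightarrow> heads v t ! i = snd (tape v t i)"
  using cfg_ok[of v t] by (auto simp: reads_def heads_def case_prod_beta)

lemma tape_less: "i < K \<Longrightarrow> fst (tape v t i) j < S"
  using cfg_ok[of v t] by auto

lemma set_reads: "set (reads v t) \<subseteq> {..<S}"
  using cfg_ok[of v t] by (auto simp: reads_def)

lemma next_act_ok:
  assumes "q \<le> Q" "length rs = K" "set rs \<subseteq> {..<S}"
  shows "fst (next_act q rs) \<le> Q" "length (snd (next_act q rs)) = K"
    "i < K \<Longrightarrow> fst (snd (next_act q rs) ! i) < S"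
proof -
  obtain q' as where d: "delta M q rs = (q', as)" by force
  have *: "fst (next_act q rs) \<le> Q \<and> length (snd (next_act q rs)) = K \<and>
     fst ` set (snd (next_act q rs)) \<subseteq> {..<S}"
  proof (cases "q < Q")
    case True
    then show ?thesis using tm_wfD[OF wf True assms(2,3) d] by (simp add: next_act_def d)
  next
    case False
    then show ?thesis using assms by (auto simp: next_act_def)
  qed
  then show "fst (next_act q rs) \<le> Q" "length (snd (next_act q rs)) = K" by auto
  show "fst (snd (next_act q rs) ! i) < S" if "i < K"
    using * that by (auto simp: subset_iff)
qed

lemma cfg_Suc:
  assumes "next_act (fst (cfg v t)) (reads v t) = (q', as)"
  shows "fst (cfg v (Suc t)) = q'" "i < K \<Longrightarrow> tape v (Suc t) i = act (tape v t i) (as ! i)"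
proof -
  obtain q ts where c: "cfg v t = (q, ts)" by force
  have rs: "reads v t = map (\<lambda>(t, h). t h) ts" by (simp add: reads_def c)
  have lts: "length ts = K" using cfg_ok[of v t] c by simp
  have s: "cfg v (Suc t) = tm_step M (q, ts)" using c by (simp add: cfg_def)
  have las: "length as = K"
    using next_act_ok(2)[of "fst (cfg v t)" "reads v t"] cfg_ok[of v t] length_reads set_reads assms by simp
  have *: "cfg v (Suc t) = (q', map2 act ts as)"
  proof (cases "q < Q")
    case True
    then show ?thesis using s assms c rs by (simp add: next_act_def)
  next
    case False
    then have "q' = q" "as = map (\<lambda>c. (c, Move_Stay)) (reads v t)"
      using assms c by (auto simp: next_act_def)
    moreover have "map2 act ts (map (\<lambda>c. (c, Move_Stay)) (reads v t)) = ts"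
      by (rule nth_equalityI) (auto simp: rs case_prod_beta act_self)
    ultimately show ?thesis using s False by simp
  qed
  then show "fst (cfg v (Suc t)) = q'" by simp
  show "tape v (Suc t) i = act (tape v t i) (as ! i)" if "i < K"
    using * that lts las c by simp
qed

lemma head_bound: "i < K \<Longrightarrow> \<bar>snd (tape v t i)\<bar> \<le> int t"
proof (induction t)
  case 0
  then show ?case by (simp add: cfg_def tm_init_def)
next
  case (Suc t)
  obtain q' as where a: "next_act (fst (cfg v t)) (reads v t) = (q', as)" by force
  have sh: "\<bar>shift mo\<bar> \<le> 1" for mo by (cases mo) auto
  have "snd (tape v (Suc t) i) = snd (tape v t i) + shift (snd (as ! i))"
    using cfg_Suc(2)[OF a Suc.prems] by (simp add: snd_act)
  then show ?case using Suc.IH[OF Suc.prems] sh[of "snd (as ! i)"] by linarith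
qed

definition facts :: "(cvar \<Rightarrow> bool) \<Rightarrow> bool list \<Rightarrow> nat \<Rightarrow> bool" where
  "facts \<alpha> v t \<longleftrightarrow> \<alpha> (St t (fst (cfg v t))) \<and> (\<forall>i < K. \<alpha> (Hd t i (snd (tape v t i)))) \<and>
     (\<forall>i < K. \<forall>h \<in> pos. \<alpha> (Ce t i h (fst (tape v t i) h)))"

lemma head_in_pos: "i < K \<Longrightarrow> t \<le> T \<Longrightarrow> snd (tape v t i) \<in> {-R + 1..R - 1}"
  using head_bound[of i v t] by (auto simp: R_def)

lemma head_in_pos': "i < K \<Longrightarrow> t \<le> T \<Longrightarrow> snd (tape v t i) \<in> pos"
  using head_in_pos[of i t v] by (auto simp: pos_def)

text \<open>The state, head positions and symbols of the actual configuration form a local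
  configuration whose Horn clauses have only true premises; cells away from the head are carried
  over by the last family.\<close>

lemma facts_Suc:
  assumes "sat \<alpha> step_clauses" "facts \<alpha> v t" "t < T"
  shows "facts \<alpha> v (Suc t)"
proof -
  let ?q = "fst (cfg v t)" and ?hs = "heads v t" and ?rs = "reads v t"
  obtain q' as where a: "next_act ?q ?rs = (q', as)" by force
  have lc: "(t, ?q, ?hs, ?rs) \<in> local_confs"
  proof -
    have "y \<in> {-R + 1..R - 1}" if y: "y \<in> set ?hs" for y
    proof -
      obtain i where "i < length ?hs" "y = ?hs ! i" using y unfolding in_set_conv_nth by auto
      then have "i < K" "y = ?hs ! i" using length_reads(2)[of v t] by simp_all
      then show ?thesis
        using head_in_pos[OF \<open>i < K\<close> less_imp_le[OF assms(3)], of v] reads_nth(2)[OF \<open>i < K\<close>, of v t]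
        by (simp only:)
    qed
    then have "set ?hs \<subseteq> {-R + 1..R - 1}" by (rule subsetI)
    then show ?thesis
      using assms(3) conjunct1[OF cfg_ok[of v t]] length_reads[of v t] set_reads[of v t]
      unfolding local_confs_def by (simp only: mem_Times_iff fst_conv snd_conv mem_Collect_eq lessThan_iff atMost_iff simp_thms)
  qed
  have lf: "\<forall>x \<in> local_facts t ?q ?hs ?rs. \<alpha> x"
    using assms(2,3) head_in_pos'[of _ t v] by (auto simp: local_facts_def facts_def reads_nth)
  have s: "\<And>t q hs rs. (t, q, hs, rs) \<in> local_confs \<Longrightarrow> \<forall>x \<in> local_facts t q hs rs. \<alpha> x \<Longrightarrow>
        \<alpha> (St (Suc t) (fst (next_act q rs)))"
    "\<And>t q hs rs i. (t, q, hs, rs) \<in> local_confs \<Longrightarrow> i < K \<Longrightarrow> \<forall>x \<in> local_facts t q hs rs. \<alpha> x \<Longrightarrow>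
        \<alpha> (Hd (Suc t) i (hs ! i + shift (snd (snd (next_act q rs) ! i))))"
    "\<And>t q hs rs i. (t, q, hs, rs) \<in> local_confs \<Longrightarrow> i < K \<Longrightarrow> \<forall>x \<in> local_facts t q hs rs. \<alpha> x \<Longrightarrow>
        \<alpha> (Ce (Suc t) i (hs ! i) (fst (snd (next_act q rs) ! i)))"
    "\<And>t i h h' c. t < T \<Longrightarrow> i < K \<Longrightarrow> h \<in> pos \<Longrightarrow> h' \<in> pos \<Longrightarrow> c < S \<Longrightarrow> h' \<noteq> h \<Longrightarrow>
        \<alpha> (Hd t i h) \<Longrightarrow> \<alpha> (Ce t i h' c) \<Longrightarrow> \<alpha> (Ce (Suc t) i h' c)"
  proof -
    have sat_hornD: "(\<forall>x \<in> A. \<alpha> x) \<Longrightarrow> \<alpha> c" if "horn A c \<in> step_clauses" for A c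
      using assms(1) that horn_true[of A c \<alpha>] unfolding sat_def by blast
    fix t q hs rs i
    assume lc: "(t, q, hs, rs) \<in> local_confs" and lf: "\<forall>x \<in> local_facts t q hs rs. \<alpha> x"
    show "\<alpha> (St (Suc t) (fst (next_act q rs)))"
      by (rule sat_hornD[OF _ lf])
        (unfold step_clauses_def, intro UnI1, rule rev_image_eqI[OF lc], simp)
    assume i: "i < K"
    have lci: "((t, q, hs, rs), i) \<in> local_confs \<times> {..<K}" using lc i by simp
    show "\<alpha> (Hd (Suc t) i (hs ! i + shift (snd (snd (next_act q rs) ! i))))"
      by (rule sat_hornD[OF _ lf])
        (unfold step_clauses_def, rule UnI1, rule UnI1, rule UnI2, rule rev_image_eqI[OF lci], simp)
    show "\<alpha> (Ce (Suc t) i (hs ! i) (fst (snd (next_act q rs) ! i)))"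
      by (rule sat_hornD[OF _ lf])
        (unfold step_clauses_def, rule UnI1, rule UnI2, rule rev_image_eqI[OF lci], simp)
  next
    have sat_hornD: "(\<forall>x \<in> A. \<alpha> x) \<Longrightarrow> \<alpha> c" if "horn A c \<in> step_clauses" for A c
      using assms(1) that horn_true[of A c \<alpha>] unfolding sat_def by blast
    fix t i h h' c
    assume a: "t < T" "i < K" "h \<in> pos" "h' \<in> pos" "c < S" "h' \<noteq> h" "\<alpha> (Hd t i h)" "\<alpha> (Ce t i h' c)"
    have m: "(t, i, h, h', c) \<in> {..<T} \<times> {..<K} \<times> pos \<times> pos \<times> {..<S}" using a by simp
    show "\<alpha> (Ce (Suc t) i h' c)"
      by (rule sat_hornD[of "{Hd t i h, Ce t i h' c}"])
        (unfold step_clauses_def, rule UnI2, rule rev_image_eqI[OF m], use a in simp_all)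
  qed
  show ?thesis
    unfolding facts_def
  proof (intro conjI allI impI ballI)
    show "\<alpha> (St (Suc t) (fst (cfg v (Suc t))))"
      using s(1)[OF lc lf] cfg_Suc(1)[OF a] a by simp
  next
    fix i assume i: "i < K"
    show "\<alpha> (Hd (Suc t) i (snd (tape v (Suc t) i)))"
      using s(2)[OF lc i lf] cfg_Suc(2)[OF a i] a reads_nth[OF i]
      by (cases "tape v t i"; cases "as ! i") simp
  next
    fix i h assume i: "i < K" and h: "h \<in> pos"
    show "\<alpha> (Ce (Suc t) i h (fst (tape v (Suc t) i) h))"
    proof (cases "h = snd (tape v t i)")
      case True
      then show ?thesis using s(3)[OF lc i lf] cfg_Suc(2)[OF a i] a reads_nth[OF i]
        by (cases "tape v t i"; cases "as ! i") simp
    next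
      case False
      have "\<alpha> (Ce (Suc t) i h (fst (tape v t i) h))"
        by (rule s(4)[OF assms(3) i _ h _ False])
          (use i h assms(2,3) head_in_pos'[of i t v] tape_less[OF i] in \<open>auto simp: facts_def\<close>)
      moreover have "fst (tape v (Suc t) i) h = fst (tape v t i) h"
        using False cfg_Suc(2)[OF a i] by (cases "tape v t i"; cases "as ! i") simp
      ultimately show ?thesis by simp
    qed
  qed
qed

lemma facts_all:
  assumes "sat \<alpha> step_clauses" "facts \<alpha> v 0" "t \<le> T"
  shows "facts \<alpha> v t"
  using assms(3) by (induction t) (auto intro: facts_Suc assms(1,2))

definition run_assignment :: "bool list \<Rightarrow> cvar \<Rightarrow> bool" where
  "run_assignment v x = (case x of St t q \<Rightarrow> q = fst (cfg v t) | Hd t i h \<Rightarrow> h = snd (tape v t i)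
     | Ce t i h c \<Rightarrow> c = fst (tape v t i) h)"

text \<open>Under the assignment read off from a run, the premises of a step clause hold only for
  the actual local configuration, and then the conclusion describes the actual next one.\<close>

lemma run_sat_step: "sat (run_assignment v) step_clauses"
proof -
  let ?\<alpha> = "run_assignment v"
  have lf: "q = fst (cfg v t) \<and> hs = heads v t \<and> rs = reads v t"
    if "(t, q, hs, rs) \<in> local_confs" "\<forall>x \<in> local_facts t q hs rs. ?\<alpha> x" for t q hs rs
  proof -
    have l: "length hs = K" "length rs = K" using that(1) by (auto simp: local_confs_def)
    have "q = fst (cfg v t)" "\<forall>i < K. hs ! i = snd (tape v t i)"
      "\<forall>i < K. rs ! i = fst (tape v t i) (hs ! i)"
    proof -
      have "?\<alpha> (St t q)" "\<forall>i < K. ?\<alpha> (Hd t i (hs ! i))" "\<forall>i < K. ?\<alpha> (Ce t i (hs ! i) (rs ! i))"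
        using that(2) unfolding local_facts_def by blast+
      then show "q = fst (cfg v t)" "\<forall>i < K. hs ! i = snd (tape v t i)"
        "\<forall>i < K. rs ! i = fst (tape v t i) (hs ! i)"
        by (simp_all add: run_assignment_def)
    qed
    then show ?thesis using l length_reads[of v t]
      by (auto intro!: nth_equalityI simp: reads_nth)
  qed
  have st: "?\<alpha> (St (Suc t) (fst (next_act (fst (cfg v t)) (reads v t))))"
    "i < K \<Longrightarrow> ?\<alpha> (Hd (Suc t) i (heads v t ! i + shift (snd (snd (next_act (fst (cfg v t)) (reads v t)) ! i))))"
    "i < K \<Longrightarrow> ?\<alpha> (Ce (Suc t) i (heads v t ! i) (fst (snd (next_act (fst (cfg v t)) (reads v t)) ! i)))" for t i
  proof -
    obtain q' as where a: "next_act (fst (cfg v t)) (reads v t) = (q', as)" by force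
    show "?\<alpha> (St (Suc t) (fst (next_act (fst (cfg v t)) (reads v t))))"
      using cfg_Suc(1)[OF a] by (simp add: a run_assignment_def)
    assume i: "i < K"
    show "?\<alpha> (Hd (Suc t) i (heads v t ! i + shift (snd (snd (next_act (fst (cfg v t)) (reads v t)) ! i))))"
      "?\<alpha> (Ce (Suc t) i (heads v t ! i) (fst (snd (next_act (fst (cfg v t)) (reads v t)) ! i)))"
      using cfg_Suc(2)[OF a i] reads_nth[OF i]
      by (cases "tape v t i"; cases "as ! i"; simp add: a run_assignment_def)+
  qed
  have st': "?\<alpha> (St (Suc t) (fst (next_act q rs)))"
    "i < K \<Longrightarrow> ?\<alpha> (Hd (Suc t) i (hs ! i + shift (snd (snd (next_act q rs) ! i))))"
    "i < K \<Longrightarrow> ?\<alpha> (Ce (Suc t) i (hs ! i) (fst (snd (next_act q rs) ! i)))"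
    if "(t, q, hs, rs) \<in> local_confs" "\<forall>x \<in> local_facts t q hs rs. ?\<alpha> x" for t q hs rs i
    using lf[OF that] st(1)[of t] st(2,3)[of i t] by simp_all
  have frame: "?\<alpha> (Ce (Suc t) i h' c)" if "i < K" "?\<alpha> (Hd t i h)" "?\<alpha> (Ce t i h' c)" "h' \<noteq> h" for t i h h' c
  proof -
    obtain q' as where a: "next_act (fst (cfg v t)) (reads v t) = (q', as)" by force
    show ?thesis using cfg_Suc(2)[OF a that(1)] that
      by (cases "tape v t i"; cases "as ! i") (auto simp: run_assignment_def)
  qed
  show ?thesis
    unfolding step_clauses_def sat_Un
  proof (intro conjI)
    show "sat ?\<alpha> ((\<lambda>(t, q, hs, rs). horn (local_facts t q hs rs) (St (Suc t) (fst (next_act q rs)))) ` local_confs)"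
      unfolding sat_def by (auto simp: horn_true intro!: st'(1))
    show "sat ?\<alpha> ((\<lambda>((t, q, hs, rs), i). horn (local_facts t q hs rs)
        (Hd (Suc t) i (hs ! i + shift (snd (snd (next_act q rs) ! i))))) ` (local_confs \<times> {..<K}))"
      unfolding sat_def by (auto simp: horn_true intro!: st'(2))
    show "sat ?\<alpha> ((\<lambda>((t, q, hs, rs), i). horn (local_facts t q hs rs)
        (Ce (Suc t) i (hs ! i) (fst (snd (next_act q rs) ! i)))) ` (local_confs \<times> {..<K}))"
      unfolding sat_def by (auto simp: horn_true intro!: st'(3))
    show "sat ?\<alpha> ((\<lambda>(t, i, h, h', c). if h' = h then horn {Ce t i h c} (Ce t i h c)
        else horn {Hd t i h, Ce t i h' c} (Ce (Suc t) i h' c)) ` ({..<T} \<times> {..<K} \<times> pos \<times> pos \<times> {..<S}))"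
      unfolding sat_def using frame by (auto simp: horn_true)
  qed
qed

lemma tape_init: "i < K \<Longrightarrow> tape v 0 i = (if i = 0 then string_tape v else (\<lambda>_. 0), 0)"
  "fst (cfg v 0) = 0"
  by (auto simp: cfg_def tm_init_def)

lemma string_tape_pair_enc:
  assumes "length x = m"
  shows "string_tape (pair_enc x w) h =
    (if h < 0 then 0 else if h < int m then 2 else if h = int m then 1
     else if h < 2 * int m + 1 then bit_sym (x ! nat (h - int m - 1))
     else string_tape w (h - 2 * int m - 1))"
proof -
  have 1: "string_tape (replicate m True) h = (if 0 \<le> h \<and> h < int m then 2 else 0)" for h
    by (auto simp: string_tape_def nat_less_iff)
  have 2: "string_tape [False] h = (if h = 0 then 1 else 0)" for h
    by (auto simp: string_tape_def)
  have 3: "string_tape x h = (if 0 \<le> h \<and> h < int m then bit_sym (x ! nat h) else 0)" for h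
    using assms by (auto simp: string_tape_def bit_sym_def)
  have e: "string_tape (pair_enc x w) h =
    (if h < int m then string_tape (replicate m True) h
     else if h - int m < 1 then string_tape [False] (h - int m)
     else if h - int m - 1 < int m then string_tape x (h - int m - 1)
     else string_tape w (h - int m - 1 - int m))"
    unfolding pair_enc_def string_tape_append_int by (simp add: assms)
  have a: "h - int m - 1 - int m = h - 2 * int m - 1" by simp
  consider "h < 0" | "0 \<le> h" "h < int m" | "h = int m" | "int m < h" "h < 2 * int m + 1" | "2 * int m + 1 \<le> h"
    by linarith
  then show ?thesis
    unfolding e 1 2 3 a by cases simp_all
qed

definition input_var :: "nat \<Rightarrow> cvar" where
  "input_var l = Ce 0 0 (int m + 1 + int l) 2"

end

lemma sat_image: "sat \<alpha> (f ` I) \<longleftrightarrow> (\<forall>x \<in> I. \<exists>l \<in> f x. \<alpha> (fst l) = snd l)"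
  by (simp add: sat_def)

lemma string_tape_neq_0: "string_tape w h \<noteq> 0 \<longleftrightarrow> 0 \<le> h \<and> h < int (length w)"
  by (simp add: string_tape_def)

lemma string_tape_values: "string_tape w h = 0 \<or> string_tape w h = 1 \<or> string_tape w h = 2"
  by (simp add: string_tape_def)

context run_formula
begin

lemma sat_init_iff: "sat \<alpha> init_clauses \<longleftrightarrow>
   \<alpha> (St 0 0) \<and> (\<forall>i \<in> {..<K}. \<alpha> (Hd 0 i 0)) \<and> (\<forall>i \<in> {1..<K}. \<forall>h \<in> pos. \<alpha> (Ce 0 i h 0)) \<and>
   (\<forall>h \<in> pos - {int m + 1..<int len}. \<alpha> (Ce 0 0 h (init_sym h))) \<and>
   (\<forall>h \<in> {int m + 1..<2 * int m + 1}. \<alpha> (Ce 0 0 h 1) \<or> \<alpha> (Ce 0 0 h 2)) \<and>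
   (\<forall>h \<in> {2 * int m + 1..<int len}. \<alpha> (Ce 0 0 h 0) \<or> \<alpha> (Ce 0 0 h 1) \<or> \<alpha> (Ce 0 0 h 2)) \<and>
   (\<forall>h \<in> {2 * int m + 1..<int len}. \<alpha> (Ce 0 0 h 0) \<longrightarrow> \<alpha> (Ce 0 0 (h + 1) 0))"
proof -
  have p: "(\<forall>x \<in> A \<times> B. \<exists>l \<in> (case x of (i, h) \<Rightarrow> horn {} (Ce 0 i h 0)). \<alpha> (fst l) = snd l) \<longleftrightarrow>
     (\<forall>i \<in> A. \<forall>h \<in> B. \<alpha> (Ce 0 i h 0))" for A B
    by (auto simp: horn_true)
  show ?thesis
    unfolding init_clauses_def sat_Un sat_image p by (simp add: horn_true)
qed

text \<open>An assignment may make several symbols of a cell true. The witness is read off by giving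
  priority to the blank, whose first occurrence ends the word, and then to the symbol
  \<open>2\<close>.\<close>

lemma init_facts:
  assumes "sat \<alpha> init_clauses" "length x = m" "\<forall>l < m. \<alpha> (input_var l) = x ! l"
  shows "\<exists>w. length w \<le> pl \<and> facts \<alpha> (pair_enc x w) 0"
proof -
  note c = assms(1)[unfolded sat_init_iff]
  let ?b = "\<lambda>j s. \<alpha> (Ce 0 0 (2 * int m + 1 + int j) s)"
  define n where "n = length (takeWhile (\<lambda>j. \<not> ?b j 0) [0..<pl])"
  have n: "n \<le> pl" unfolding n_def using length_takeWhile_le[of _ "[0..<pl]"] by simp
  have before: "\<not> ?b j 0" if "j < n" for j
  proof -
    have "takeWhile (\<lambda>j. \<not> ?b j 0) [0..<pl] ! j \<in> set (takeWhile (\<lambda>j. \<not> ?b j 0) [0..<pl])"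
      using that by (simp add: n_def)
    moreover have "takeWhile (\<lambda>j. \<not> ?b j 0) [0..<pl] ! j = j"
      using that n by (subst takeWhile_nth) (auto simp: n_def)
    ultimately show ?thesis using set_takeWhileD by metis
  qed
  have at: "?b n 0" if "n < pl"
    using nth_length_takeWhile[of "\<lambda>j. \<not> ?b j 0" "[0..<pl]"] that by (simp add: n_def)
  have after: "?b (n + j) 0" if "n + j < pl" for j
    using that
  proof (induction j)
    case 0
    then show ?case using at by simp
  next
    case (Suc j)
    have "?b (n + j) 0" using Suc by simp
    moreover have "2 * int m + 1 + int (n + j) \<in> {2 * int m + 1..<int len}" using Suc by (auto simp: len_def)
    ultimately have "\<alpha> (Ce 0 0 (2 * int m + 1 + int (n + j) + 1) 0)" using c by blast
    then show ?case by (simp add: algebra_simps)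
  qed
  define w where "w = map (\<lambda>j. ?b j 2) [0..<n]"
  have lw: "length w = n" by (simp add: w_def)
  have wj: "?b j (string_tape w (int j))" if j: "j < pl" for j
  proof (cases "j < n")
    case True
    have "2 * int m + 1 + int j \<in> {2 * int m + 1..<int len}" using j by (auto simp: len_def)
    then have "?b j 0 \<or> ?b j 1 \<or> ?b j 2" using c by blast
    then show ?thesis using before[OF True] True by (auto simp: string_tape_of_nat w_def bit_sym_def)
  next
    case False
    then have "string_tape w (int j) = 0" by (simp add: string_tape_of_nat lw)
    then show ?thesis using after[of "j - n"] False j by simp
  qed
  let ?v = "pair_enc x w"
  have cell: "\<alpha> (Ce 0 0 h (string_tape ?v h))" if h: "h \<in> pos" for h
  proof -
    consider "h \<notin> {int m + 1..<int len}" | "h \<in> {int m + 1..<2 * int m + 1}" | "h \<in> {2 * int m + 1..<int len}"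
      by (cases "h < 2 * int m + 1"; cases "h \<in> {int m + 1..<int len}") auto
    then show ?thesis
    proof cases
      case 1
      then have "\<alpha> (Ce 0 0 h (init_sym h))" using c h by blast
      moreover have "string_tape ?v h = init_sym h"
      proof (cases "h \<ge> int len")
        case True
        then have "h \<ge> 2 * int m + 1 + int n" using n by (simp add: len_def)
        then have "string_tape w (h - 2 * int m - 1) = 0" by (simp add: string_tape_def lw)
        then show ?thesis unfolding string_tape_pair_enc[OF assms(2)] init_sym_def
          using True by (auto simp: len_def)
      next
        case False
        then show ?thesis unfolding string_tape_pair_enc[OF assms(2)] init_sym_def
          using 1 by auto
      qed
      ultimately show ?thesis by simp
    next
      case 2
      define l where "l = nat (h - int m - 1)"
      have l: "l < m" "h = int m + 1 + int l" using 2 by (auto simp: l_def)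
      have "string_tape ?v h = bit_sym (x ! l)"
        unfolding string_tape_pair_enc[OF assms(2)] l_def using 2 by auto
      moreover have "\<alpha> (Ce 0 0 h 2) = x ! l" using assms(3) l by (simp add: input_var_def)
      moreover have "\<alpha> (Ce 0 0 h 1) \<or> \<alpha> (Ce 0 0 h 2)" using c 2 by blast
      ultimately show ?thesis by (cases "x ! l") (auto simp: bit_sym_def)
    next
      case 3
      define j where "j = nat (h - 2 * int m - 1)"
      have j: "j < pl" "h = 2 * int m + 1 + int j" using 3 by (auto simp: j_def len_def)
      have "string_tape ?v h = string_tape w (int j)"
        unfolding string_tape_pair_enc[OF assms(2)] using j by auto
      then show ?thesis using wj[OF j(1)] j(2) by simp
    qed
  qed
  have "facts \<alpha> ?v 0"
    unfolding facts_def
  proof (intro conjI allI impI ballI)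
    show "\<alpha> (St 0 (fst (cfg ?v 0)))" using c by (simp add: tape_init)
  next
    fix i assume i: "i < K"
    then show "\<alpha> (Hd 0 i (snd (tape ?v 0 i)))" using c by (simp add: tape_init)
  next
    fix i h assume i: "i < K" and h: "h \<in> pos"
    show "\<alpha> (Ce 0 i h (fst (tape ?v 0 i) h))"
    proof (cases "i = 0")
      case True
      then show ?thesis using cell[OF h] i by (simp add: tape_init)
    next
      case False
      then have "i \<in> {1..<K}" using i by simp
      then have "\<alpha> (Ce 0 i h 0)" using c h by blast
      then show ?thesis using False i by (simp add: tape_init)
    qed
  qed
  then show ?thesis using lw n by blast
qed

lemma run_sat_init:
  assumes "length x = m" "length w \<le> pl"
  shows "sat (run_assignment (pair_enc x w)) init_clauses"
proof -
  let ?v = "pair_enc x w"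
  have K: "0 < K" using K1 by simp
  have ce: "run_assignment ?v (Ce 0 0 h c) \<longleftrightarrow> c = string_tape ?v h" for h c
    using K by (simp add: run_assignment_def tape_init)
  note st = string_tape_pair_enc[OF assms(1)]
  show ?thesis
    unfolding sat_init_iff ce
  proof (intro conjI ballI)
    show "run_assignment ?v (St 0 0)" by (simp add: run_assignment_def tape_init)
    show "run_assignment ?v (Hd 0 i 0)" if "i \<in> {..<K}" for i
      using that by (simp add: run_assignment_def tape_init)
    show "run_assignment ?v (Ce 0 i h 0)" if "i \<in> {1..<K}" "h \<in> pos" for i h
      using that by (simp add: run_assignment_def tape_init)
  next
    fix h assume h: "h \<in> pos - {int m + 1..<int len}"
    have "string_tape w (h - 2 * int m - 1) = 0" if "2 * int m + 1 \<le> h"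
    proof -
      have "h \<ge> int len" using h that by auto
      then show ?thesis using assms(2) by (simp add: len_def string_tape_def)
    qed
    then show "init_sym h = string_tape ?v h"
      unfolding st init_sym_def using h by (auto simp: len_def)
  next
    fix h assume h: "h \<in> {int m + 1..<2 * int m + 1}"
    then show "1 = string_tape ?v h \<or> 2 = string_tape ?v h"
      unfolding st by (auto simp: bit_sym_def)
  next
    fix h assume h: "h \<in> {2 * int m + 1..<int len}"
    show "0 = string_tape ?v h \<or> 1 = string_tape ?v h \<or> 2 = string_tape ?v h"
      using string_tape_values[of ?v h] by auto
    have e: "string_tape ?v h = string_tape w (h - 2 * int m - 1)"
      "string_tape ?v (h + 1) = string_tape w (h - 2 * int m - 1 + 1)"
      using h unfolding st by (auto simp: algebra_simps)
    show "0 = string_tape ?v h \<longrightarrow> 0 = string_tape ?v (h + 1)"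
      unfolding e using string_tape_neq_0[of w "h - 2 * int m - 1"] string_tape_neq_0[of w "h - 2 * int m - 1 + 1"] h
      by auto
  qed
qed

theorem formula_correct:
  assumes dec: "\<And>v. length v \<le> len \<Longrightarrow> \<exists>t \<le> T. tm_outputs M v t [v \<in> V]" and x: "length x = m"
  shows "(\<exists>w. length w \<le> pl \<and> pair_enc x w \<in> V) \<longleftrightarrow>
    (\<exists>\<alpha>. sat \<alpha> formula \<and> (\<forall>l < m. \<alpha> (input_var l) = x ! l))"
proof -
  have out: "fst (tape v T (K - 1)) 0 = bit_sym (v \<in> V)" if v: "length v \<le> len" for v
  proof -
    obtain t ts where t: "t \<le> T" "cfg v t = (Q, ts)" "fst (last ts) = string_tape [v \<in> V]"
      using dec[OF v] by (auto simp: tm_outputs_def cfg_def)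
    have "cfg v T = (tm_step M ^^ (T - t)) (cfg v t)"
      using t(1) by (simp add: cfg_def funpow_add[symmetric, unfolded comp_def, THEN fun_cong])
    then have "cfg v T = (Q, ts)" using t(2) tm_step_halted by metis
    moreover have "length ts = K" using cfg_ok[of v t] t(2) by simp
    moreover from this have "last ts = ts ! (K - 1)" using K1 by (simp add: last_conv_nth flip: length_greater_0_conv)
    ultimately show ?thesis using t(3) string_tape_of_nat[of "[v \<in> V]" 0] by simp
  qed
  have len: "length (pair_enc x w) \<le> len" if "length w \<le> pl" for w
    using that x by (simp add: pair_enc_def len_def)
  show ?thesis
  proof
    assume "\<exists>w. length w \<le> pl \<and> pair_enc x w \<in> V"
    then obtain w where w: "length w \<le> pl" "pair_enc x w \<in> V" by blast
    let ?\<alpha> = "run_assignment (pair_enc x w)"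
    have "sat ?\<alpha> final_clauses"
      using out[OF len[OF w(1)]] w(2)
      by (simp add: final_clauses_def sat_def run_assignment_def bit_sym_def)
    then have "sat ?\<alpha> formula"
      unfolding formula_def sat_Un using run_sat_init[OF x w(1)] run_sat_step by blast
    moreover have "?\<alpha> (input_var l) = x ! l" if l: "l < m" for l
    proof -
      have "0 < K" using K1 by simp
      moreover have "string_tape (pair_enc x w) (int m + 1 + int l) = bit_sym (x ! l)"
        unfolding string_tape_pair_enc[OF x] using l by auto
      ultimately show ?thesis by (simp add: input_var_def run_assignment_def tape_init bit_sym_def)
    qed
    ultimately show "\<exists>\<alpha>. sat \<alpha> formula \<and> (\<forall>l < m. \<alpha> (input_var l) = x ! l)" by blast
  next
    assume "\<exists>\<alpha>. sat \<alpha> formula \<and> (\<forall>l < m. \<alpha> (input_var l) = x ! l)"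
    then obtain \<alpha> where a: "sat \<alpha> formula" "\<forall>l < m. \<alpha> (input_var l) = x ! l" by blast
    have s: "sat \<alpha> init_clauses" "sat \<alpha> step_clauses" "sat \<alpha> final_clauses"
      using a(1) by (simp_all add: formula_def sat_Un)
    obtain w where w: "length w \<le> pl" "facts \<alpha> (pair_enc x w) 0" using init_facts[OF s(1) x a(2)] by blast
    have f: "facts \<alpha> (pair_enc x w) T" by (rule facts_all[OF s(2) w(2)]) simp
    have "K - 1 < K" "0 \<in> pos" using K1 by (auto simp: pos_def R_def)
    then have "\<alpha> (Ce T (K - 1) 0 (bit_sym (pair_enc x w \<in> V)))"
      using f out[OF len[OF w(1)]] unfolding facts_def by metis
    moreover have "\<not> \<alpha> (Ce T (K - 1) 0 1)" using s(3) by (simp add: final_clauses_def sat_def)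
    ultimately have "pair_enc x w \<in> V" by (auto simp: bit_sym_def split: if_splits)
    then show "\<exists>w. length w \<le> pl \<and> pair_enc x w \<in> V" using w(1) by blast
  qed
qed

section \<open>Variables and size of the formula\<close>

lemma in_vars_iff:
  "St t q \<in> vars \<longleftrightarrow> t \<le> T \<and> q \<le> Q"
  "Hd t i h \<in> vars \<longleftrightarrow> t \<le> T \<and> i < K \<and> h \<in> pos"
  "Ce t i h c \<in> vars \<longleftrightarrow> t \<le> T \<and> i < K \<and> h \<in> pos \<and> c < S"
  unfolding vars_def by (auto simp: image_iff)

lemma input_var_in_vars: "l < m \<Longrightarrow> input_var l \<in> vars"
  using K1 S3 by (auto simp: input_var_def in_vars_iff pos_def R_def len_def)

lemma horn_vars: "A \<subseteq> vars \<Longrightarrow> c \<in> vars \<Longrightarrow> horn A c \<noteq> {} \<and> fst ` horn A c \<subseteq> vars"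
  by (auto simp: horn_def)

lemma local_facts_vars:
  assumes "(t, q, hs, rs) \<in> local_confs"
  shows "local_facts t q hs rs \<subseteq> vars"
proof -
  have l: "t < T" "q \<le> Q" "set hs \<subseteq> {-R + 1..R - 1}" "length hs = K" "set rs \<subseteq> {..<S}" "length rs = K"
    using assms by (auto simp: local_confs_def)
  have "hs ! i \<in> pos" "rs ! i < S" if "i < K" for i
  proof -
    have "hs ! i \<in> set hs" "rs ! i \<in> set rs" using that l(4,6) by simp_all
    then have "hs ! i \<in> {-R + 1..R - 1}" "rs ! i \<in> {..<S}" using l(3,5) by blast+
    then show "hs ! i \<in> pos" "rs ! i < S" by (auto simp: pos_def)
  qed
  then show ?thesis using l by (auto simp: local_facts_def in_vars_iff)
qed

lemma formula_vars: "C \<in> formula \<Longrightarrow> C \<noteq> {} \<and> fst ` C \<subseteq> vars"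
proof -
  assume "C \<in> formula"
  then consider "C \<in> init_clauses" | "C \<in> step_clauses" | "C \<in> final_clauses" by (auto simp: formula_def)
  then show ?thesis
  proof cases
    case 1
    have K: "0 < K" using K1 by simp
    have R0: "0 \<in> pos" by (auto simp: pos_def R_def)
    have isym: "init_sym h < S" for h using S3 by (simp add: init_sym_def)
    have p1: "h \<in> pos" if "h \<in> {int m + 1..<2 * int m + 1}" for h using that by (auto simp: pos_def R_def len_def)
    have p2: "h \<in> pos" "h + 1 \<in> pos" if "h \<in> {2 * int m + 1..<int len}" for h using that by (auto simp: pos_def R_def)
    show ?thesis using 1 unfolding init_clauses_def Un_iff
    proof (elim disjE)
      assume "C \<in> (\<lambda>_. horn {} (St 0 0)) ` {()}"
      then show ?thesis using horn_vars[of "{}"] by (simp add: in_vars_iff)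
    next
      assume "C \<in> (\<lambda>i. horn {} (Hd 0 i 0)) ` {..<K}"
      then show ?thesis using R0 by (auto simp: in_vars_iff horn_def)
    next
      assume "C \<in> (\<lambda>(i, h). horn {} (Ce 0 i h 0)) ` ({1..<K} \<times> pos)"
      then show ?thesis using S3 by (auto simp: in_vars_iff horn_def)
    next
      assume "C \<in> (\<lambda>h. horn {} (Ce 0 0 h (init_sym h))) ` (pos - {int m + 1..<int len})"
      then show ?thesis using isym K by (auto simp: in_vars_iff horn_def)
    next
      assume "C \<in> (\<lambda>h. {(Ce 0 0 h 1, True), (Ce 0 0 h 2, True)}) ` {int m + 1..<2 * int m + 1}"
      then show ?thesis using p1 K S3 by (auto simp: in_vars_iff)
    next
      assume "C \<in> (\<lambda>h. {(Ce 0 0 h 0, True), (Ce 0 0 h 1, True), (Ce 0 0 h 2, True)}) ` {2 * int m + 1..<int len}"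
      then show ?thesis using p2 K S3 by (auto simp: in_vars_iff)
    next
      assume "C \<in> (\<lambda>h. horn {Ce 0 0 h 0} (Ce 0 0 (h + 1) 0)) ` {2 * int m + 1..<int len}"
      then obtain h where h: "h \<in> {2 * int m + 1..<int len}" "C = horn {Ce 0 0 h 0} (Ce 0 0 (h + 1) 0)" by blast
      then show ?thesis using p2[OF h(1)] K S3 horn_vars[of "{Ce 0 0 h 0}" "Ce 0 0 (h + 1) 0"]
        by (simp add: in_vars_iff)
    qed
  next
    case 2
    have lc: "t < T" "q \<le> Q" "length rs = K" "set rs \<subseteq> {..<S}" "length hs = K" "set hs \<subseteq> {-R + 1..R - 1}"
      if "(t, q, hs, rs) \<in> local_confs" for t q hs rs
      using that by (auto simp: local_confs_def)
    have hp: "hs ! i \<in> {-R + 1..R - 1}" if "(t, q, hs, rs) \<in> local_confs" "i < K" for t q hs rs i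
    proof -
      have "hs ! i \<in> set hs" using lc(5)[OF that(1)] that(2) by simp
      then show ?thesis using lc(6)[OF that(1)] by blast
    qed
    have sh: "\<bar>shift mo\<bar> \<le> 1" for mo by (cases mo) auto
    show ?thesis using 2 unfolding step_clauses_def Un_iff
    proof (elim disjE)
      assume "C \<in> (\<lambda>(t, q, hs, rs). horn (local_facts t q hs rs) (St (Suc t) (fst (next_act q rs)))) ` local_confs"
      then obtain t q hs rs where l: "(t, q, hs, rs) \<in> local_confs"
        "C = horn (local_facts t q hs rs) (St (Suc t) (fst (next_act q rs)))" by auto
      show ?thesis unfolding l(2)
        by (rule horn_vars[OF local_facts_vars[OF l(1)]])
          (use lc[OF l(1)] next_act_ok(1)[of q rs] in \<open>simp add: in_vars_iff\<close>)
    next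
      assume "C \<in> (\<lambda>((t, q, hs, rs), i). horn (local_facts t q hs rs)
        (Hd (Suc t) i (hs ! i + shift (snd (snd (next_act q rs) ! i))))) ` (local_confs \<times> {..<K})"
      then obtain t q hs rs i where l: "(t, q, hs, rs) \<in> local_confs" "i < K"
        "C = horn (local_facts t q hs rs) (Hd (Suc t) i (hs ! i + shift (snd (snd (next_act q rs) ! i))))" by auto
      have "hs ! i + shift (snd (snd (next_act q rs) ! i)) \<in> pos"
        using hp[OF l(1,2)] sh[of "snd (snd (next_act q rs) ! i)"] by (auto simp: pos_def)
      then show ?thesis unfolding l(3)
        by (intro horn_vars[OF local_facts_vars[OF l(1)]])
          (use lc[OF l(1)] l(2) in \<open>simp add: in_vars_iff\<close>)
    next
      assume "C \<in> (\<lambda>((t, q, hs, rs), i). horn (local_facts t q hs rs)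
        (Ce (Suc t) i (hs ! i) (fst (snd (next_act q rs) ! i)))) ` (local_confs \<times> {..<K})"
      then obtain t q hs rs i where l: "(t, q, hs, rs) \<in> local_confs" "i < K"
        "C = horn (local_facts t q hs rs) (Ce (Suc t) i (hs ! i) (fst (snd (next_act q rs) ! i)))" by auto
      have "hs ! i \<in> pos" using hp[OF l(1,2)] by (auto simp: pos_def)
      then show ?thesis unfolding l(3)
        by (intro horn_vars[OF local_facts_vars[OF l(1)]])
          (use lc[OF l(1)] l(2) next_act_ok(3)[of q rs i] in \<open>simp add: in_vars_iff\<close>)
    next
      assume "C \<in> (\<lambda>(t, i, h, h', c). if h' = h then horn {Ce t i h c} (Ce t i h c)
        else horn {Hd t i h, Ce t i h' c} (Ce (Suc t) i h' c)) ` ({..<T} \<times> {..<K} \<times> pos \<times> pos \<times> {..<S})"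
      then obtain t i h h' c where l: "t < T" "i < K" "h \<in> pos" "h' \<in> pos" "c < S"
        "C = (if h' = h then horn {Ce t i h c} (Ce t i h c)
          else horn {Hd t i h, Ce t i h' c} (Ce (Suc t) i h' c))" by auto
      then show ?thesis
        using horn_vars[of "{Ce t i h c}" "Ce t i h c"] horn_vars[of "{Hd t i h, Ce t i h' c}" "Ce (Suc t) i h' c"]
        by (simp add: in_vars_iff)
    qed
  next
    case 3
    then show ?thesis using K1 S3 by (auto simp: final_clauses_def in_vars_iff pos_def R_def)
  qed
qed

definition width :: nat where "width = 2 * (T + len + 1) + 1"

lemma finite_pos: "finite pos" "card pos = width"
  by (auto simp: pos_def R_def width_def)

lemma finite_vars: "finite vars"
  by (auto simp: vars_def finite_pos)

lemma card_vars: "card vars \<le> Suc T * Suc Q + Suc T * (K * width) + Suc T * (K * (width * S))"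
proof -
  have "card ((\<lambda>(t, q). St t q) ` ({..T} \<times> {..Q})) \<le> Suc T * Suc Q"
    by (rule order_trans[OF card_image_le]) auto
  moreover have "card ((\<lambda>(t, i, h). Hd t i h) ` ({..T} \<times> {..<K} \<times> pos)) \<le> Suc T * (K * width)"
    by (rule order_trans[OF card_image_le]) (auto simp: finite_pos)
  moreover have "card ((\<lambda>(t, i, h, c). Ce t i h c) ` ({..T} \<times> {..<K} \<times> pos \<times> {..<S})) \<le> Suc T * (K * (width * S))"
    by (rule order_trans[OF card_image_le]) (auto simp: finite_pos)
  ultimately show ?thesis
    unfolding vars_def by (meson add_mono card_Un_le order_trans)
qed

lemma card_local_confs: "finite local_confs" "card local_confs \<le> T * (Suc Q * (width ^ K * S ^ K))"
proof -
  have f: "finite {hs. set hs \<subseteq> {-R + 1..R - 1} \<and> length hs = K}" "finite {rs. set rs \<subseteq> {..<S} \<and> length rs = K}"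
    by (auto intro: finite_lists_length_eq)
  then show "finite local_confs" by (auto simp: local_confs_def)
  have "card {-R + 1..R - 1} \<le> width" by (auto simp: R_def width_def)
  then have "card {hs. set hs \<subseteq> {-R + 1..R - 1} \<and> length hs = K} \<le> width ^ K"
    by (subst card_lists_length_eq) (auto intro: power_mono)
  then show "card local_confs \<le> T * (Suc Q * (width ^ K * S ^ K))"
    unfolding local_confs_def card_cartesian_product
    by (intro mult_le_mono) (simp_all add: card_lists_length_eq)
qed

lemma finite_formula: "finite formula"
  using card_local_confs(1) by (auto simp: formula_def init_clauses_def step_clauses_def final_clauses_def finite_pos)

lemma card_formula:
  "card formula \<le> (1 + K + K * width + width + width + width + width) +
     (T * (Suc Q * (width ^ K * S ^ K)) + T * (Suc Q * (width ^ K * S ^ K)) * K +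
      T * (Suc Q * (width ^ K * S ^ K)) * K + T * (K * (width * (width * S)))) + 1"
proof -
  have Un: "card (A \<union> B) \<le> a + b" if "card A \<le> a" "card B \<le> b" for A B :: "(cvar \<times> bool) set set" and a b
    using that card_Un_le[of A B] by linarith
  have im: "card (f ` A) \<le> a" if "finite A" "card A \<le> a" for f :: "'z \<Rightarrow> (cvar \<times> bool) set" and A a
    using that card_image_le[of A f] by linarith
  have sub: "finite A \<and> card A \<le> width" if "A \<subseteq> pos" for A
    using that finite_pos card_mono[of pos A] finite_subset by metis
  have s: "pos - {int m + 1..<int len} \<subseteq> pos" "{int m + 1..<2 * int m + 1} \<subseteq> pos" "{2 * int m + 1..<int len} \<subseteq> pos"
    by (auto simp: pos_def R_def len_def)
  have i: "card init_clauses \<le> 1 + K + K * width + width + width + width + width"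
    unfolding init_clauses_def
    by (intro Un im) (use sub[OF s(1)] sub[OF s(2)] sub[OF s(3)] in \<open>auto simp: finite_pos\<close>)
  have st: "card step_clauses \<le> T * (Suc Q * (width ^ K * S ^ K)) + T * (Suc Q * (width ^ K * S ^ K)) * K +
      T * (Suc Q * (width ^ K * S ^ K)) * K + T * (K * (width * (width * S)))"
    unfolding step_clauses_def
    by (intro Un im) (use card_local_confs in \<open>auto simp: finite_pos card_cartesian_product\<close>)
  have fi: "card final_clauses \<le> 1" by (simp add: final_clauses_def)
  show ?thesis unfolding formula_def by (intro Un i st fi)
qed

end

text \<open>Only existence and size of the formulas matter, not how they are computed, because they
  enter the argument through the advice.\<close>

theorem cook_levin:
  assumes "L \<in> NP"
  obtains vars :: "nat \<Rightarrow> cvar set" and \<Phi> :: "nat \<Rightarrow> (cvar \<times> bool) set set" and X :: "nat \<Rightarrow> nat \<Rightarrow> cvar"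
  where "\<And>m. finite (vars m)" "\<And>m. finite (\<Phi> m)" "\<And>m C. C \<in> \<Phi> m \<Longrightarrow> C \<noteq> {} \<and> fst ` C \<subseteq> vars m"
    "\<And>m l. l < m \<Longrightarrow> X m l \<in> vars m"
    "poly_bounded (\<lambda>m. card (vars m))" "poly_bounded (\<lambda>m. card (\<Phi> m))"
    "\<And>x. x \<in> L \<longleftrightarrow> (\<exists>\<alpha>. sat \<alpha> (\<Phi> (length x)) \<and> (\<forall>l < length x. \<alpha> (X (length x) l) = x ! l))"
proof -
  obtain V and p :: "nat poly" where V: "V \<in> class_P"
    and L: "\<And>x. x \<in> L \<longleftrightarrow> (\<exists>w. length w \<le> poly p (length x) \<and> pair_enc x w \<in> V)"
    using assms by (auto simp: NP_def)
  obtain M and p' :: "nat poly" where wf: "tm_wf M"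
    and M: "\<And>v. \<exists>t \<le> poly p' (length v). tm_outputs M v t [v \<in> V]"
    using V by (auto simp: class_P_def poly_time_def)
  interpret rf: run_formula M m "poly p m" "poly p' (2 * m + 1 + poly p m)" for m
    by unfold_locales (rule wf)
  have len: "rf.len m = 2 * m + 1 + poly p m" for m by (simp add: rf.len_def)
  have T: "poly_bounded (\<lambda>m. poly p' (2 * m + 1 + poly p m))"
    by (intro poly_bounded_intros)
  have w: "poly_bounded (\<lambda>m. rf.width m)"
    unfolding rf.width_def len by (intro poly_bounded_intros)
  show thesis
  proof (rule that[of rf.vars rf.formula rf.input_var])
    show "finite (rf.vars m)" "finite (rf.formula m)" for m
      by (rule rf.finite_vars, rule rf.finite_formula)
    show "C \<noteq> {} \<and> fst ` C \<subseteq> rf.vars m" if "C \<in> rf.formula m" for m C using that by (rule rf.formula_vars)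
    show "rf.input_var m l \<in> rf.vars m" if "l < m" for m l using that by (rule rf.input_var_in_vars)
    show "poly_bounded (\<lambda>m. card (rf.vars m))"
      by (rule poly_bounded_mono[OF _ rf.card_vars]) (intro poly_bounded_intros T w)
    show "poly_bounded (\<lambda>m. card (rf.formula m))"
      by (rule poly_bounded_mono[OF _ rf.card_formula]) (intro poly_bounded_intros T w)
    show "x \<in> L \<longleftrightarrow> (\<exists>\<alpha>. sat \<alpha> (rf.formula (length x)) \<and> (\<forall>l < length x. \<alpha> (rf.input_var (length x) l) = x ! l))" for x
      unfolding L
    proof (rule rf.formula_correct)
      fix v :: "bool list" assume "length v \<le> rf.len (length x)"
      then have "poly p' (length v) \<le> poly p' (2 * length x + 1 + poly p (length x))"
        unfolding len by (rule poly_nat_mono)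
      then show "\<exists>t \<le> poly p' (2 * length x + 1 + poly p (length x)). tm_outputs M v t [v \<in> V]"
        using M[of v] by (meson le_trans)
    qed simp
  qed
qed

section \<open>Spanners and hitting sets\<close>

text \<open>Distances in terms of relation powers, for vertices of any type. Walks can stand in for
  paths, as a shortest walk is a path.\<close>

definition stretch_ok :: "(nat \<Rightarrow> real) \<Rightarrow> 'v set \<Rightarrow> 'v rel \<Rightarrow> 'v rel \<Rightarrow> bool" where
  "stretch_ok g V E H \<longleftrightarrow> (\<forall>u \<in> V. \<forall>v \<in> V. \<forall>d. (u, v) \<in> E ^^ d \<and> (\<forall>d' < d. (u, v) \<notin> E ^^ d') \<longrightarrow>
     (\<exists>k. real k \<le> g d \<and> (u, v) \<in> H ^^ k))"

lemma awalk_length_relpow: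
  assumes "pair_wf_digraph D" "u \<in> pverts D"
  shows "(\<exists>p. pre_digraph.awalk (with_proj D) u p v \<and> length p = k) \<longleftrightarrow> (u, v) \<in> parcs D ^^ k"
proof -
  interpret pair_wf_digraph D by (rule assms(1))
  show ?thesis
    using assms(2)
  proof (induction k arbitrary: u)
    case 0
    then show ?case by (auto simp: awalk_Nil_iff)
  next
    case (Suc k)
    show ?case
    proof
      assume "\<exists>p. awalk u p v \<and> length p = Suc k"
      then obtain e p where "awalk u (e # p) v" "length p = k" by (auto simp: length_Suc_conv)
      then have "e \<in> parcs D" "u = fst e" "awalk (snd e) p v" by (auto simp: awalk_Cons_iff)
      moreover from this have "(snd e, v) \<in> parcs D ^^ k"
        using Suc.IH[of "snd e"] \<open>length p = k\<close> by (auto intro: awalk_hd_in_verts)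
      ultimately show "(u, v) \<in> parcs D ^^ Suc k" by (metis relpow_Suc_I2 prod.collapse)
    next
      assume "(u, v) \<in> parcs D ^^ Suc k"
      then obtain y where y: "(u, y) \<in> parcs D" "(y, v) \<in> parcs D ^^ k" by (meson relpow_Suc_D2)
      then obtain p where "awalk y p v" "length p = k" using Suc.IH[of y] in_arcsD2 by blast
      then have "awalk u ((u, y) # p) v" using y by (auto simp: awalk_Cons_iff)
      then show "\<exists>p. awalk u p v \<and> length p = Suc k" using \<open>length p = k\<close> by (intro exI[of _ "(u, y) # p"]) auto
    qed
  qed
qed

lemma length_awalk_to_apath:
  assumes "pair_wf_digraph D" "pre_digraph.awalk (with_proj D) u p v"
  shows "\<exists>q. pre_digraph.apath (with_proj D) u q v \<and> length q \<le> length p"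
proof -
  interpret pair_wf_digraph D by (rule assms(1))
  show ?thesis using assms(2)
  proof (induct rule: awalk_to_apath_induct)
    case (path p)
    then show ?case by (auto simp: apath_def)
  next
    case (decomp p q r s)
    then have "is_awalk_cyc_decomp p (q, r, s)"
      using awalk_cyc_decomp_has_prop[of u p v] by auto
    then have "length (q @ s) \<le> length p" by auto
    then show ?case using decomp by auto
  qed
qed

lemma ddist_le_iff:
  assumes "pair_wf_digraph D" "u \<in> pverts D"
  shows "ddist D u v \<le> enat k \<longleftrightarrow> (\<exists>j \<le> k. (u, v) \<in> parcs D ^^ j)"
proof -
  let ?A = "{p. pre_digraph.apath (with_proj D) u p v}"
  have "ddist D u v \<le> enat k \<longleftrightarrow> (\<exists>p \<in> ?A. length p \<le> k)"
  proof
    assume le: "ddist D u v \<le> enat k"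
    have "ddist D u v < enat (Suc k)" using le by (simp add: order_le_less_trans)
    then obtain p where "p \<in> ?A" "enat (length p) < enat (Suc k)"
      unfolding ddist_def INF_less_iff by blast
    then show "\<exists>p \<in> ?A. length p \<le> k" by auto
  next
    assume "\<exists>p \<in> ?A. length p \<le> k"
    then show "ddist D u v \<le> enat k" unfolding ddist_def by (auto intro: INF_lower2)
  qed
  also have "\<dots> \<longleftrightarrow> (\<exists>p. pre_digraph.awalk (with_proj D) u p v \<and> length p \<le> k)"
    using length_awalk_to_apath[OF assms(1)] by (auto simp: pre_digraph.apath_def) (meson le_trans)
  also have "\<dots> \<longleftrightarrow> (\<exists>j \<le> k. (u, v) \<in> parcs D ^^ j)"
    unfolding awalk_length_relpow[OF assms, symmetric] by blast
  finally show ?thesis .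
qed

lemma ddist_eq_iff:
  assumes "pair_wf_digraph D" "u \<in> pverts D"
  shows "ddist D u v = enat d \<longleftrightarrow> (u, v) \<in> parcs D ^^ d \<and> (\<forall>d' < d. (u, v) \<notin> parcs D ^^ d')"
proof
  assume d: "ddist D u v = enat d"
  then obtain j where j: "j \<le> d" "(u, v) \<in> parcs D ^^ j"
    using ddist_le_iff[OF assms, of v d] by auto
  have nj: "(u, v) \<notin> parcs D ^^ d'" if "d' < d" for d'
    using ddist_le_iff[OF assms, of v d'] d that by auto
  then show "(u, v) \<in> parcs D ^^ d \<and> (\<forall>d' < d. (u, v) \<notin> parcs D ^^ d')"
    using j by (metis le_neq_implies_less)
next
  assume a: "(u, v) \<in> parcs D ^^ d \<and> (\<forall>d' < d. (u, v) \<notin> parcs D ^^ d')"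
  then have "ddist D u v \<le> enat d" using ddist_le_iff[OF assms, of v d] by blast
  then obtain e where e: "ddist D u v = enat e" "e \<le> d" by (cases "ddist D u v") auto
  then obtain j where "j \<le> e" "(u, v) \<in> parcs D ^^ j"
    using ddist_le_iff[OF assms, of v e] by auto
  then have "e = d" using a e by (metis le_neq_implies_less le_trans leD)
  then show "ddist D u v = enat d" using e by simp
qed

lemma ereal_ddist_le_iff:
  assumes "pair_wf_digraph D" "u \<in> pverts D"
  shows "ereal_of_enat (ddist D u v) \<le> ereal r \<longleftrightarrow> (\<exists>k. real k \<le> r \<and> (u, v) \<in> parcs D ^^ k)"
proof
  assume a: "ereal_of_enat (ddist D u v) \<le> ereal r"
  then obtain e where e: "ddist D u v = enat e" by (cases "ddist D u v") auto
  then have "(u, v) \<in> parcs D ^^ e" using ddist_eq_iff[OF assms] by blast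
  then show "\<exists>k. real k \<le> r \<and> (u, v) \<in> parcs D ^^ k" using a e by auto
next
  assume "\<exists>k. real k \<le> r \<and> (u, v) \<in> parcs D ^^ k"
  then obtain k where k: "real k \<le> r" "(u, v) \<in> parcs D ^^ k" by blast
  then have "ddist D u v \<le> enat k" using ddist_le_iff[OF assms, of v k] by blast
  then obtain e where "ddist D u v = enat e" "e \<le> k" by (cases "ddist D u v") auto
  then show "ereal_of_enat (ddist D u v) \<le> ereal r" using k(1) by simp
qed

lemma linear_spanner_iff:
  assumes "pair_wf_digraph D"
  shows "linear_spanner f\<^sub>\<alpha> f\<^sub>\<beta> D H \<longleftrightarrow> pverts H = pverts D \<and> parcs H \<subseteq> parcs D \<and>
    stretch_ok (\<lambda>d. f\<^sub>\<alpha> d * real d + f\<^sub>\<beta> d) (pverts D) (parcs D) (parcs H)"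
proof -
  have sp: "spanning (with_proj H) (with_proj D) \<longleftrightarrow> pverts H = pverts D \<and> parcs H \<subseteq> parcs D"
  proof -
    have "pair_wf_digraph H" if "pverts H = pverts D" "parcs H \<subseteq> parcs D"
      using assms that unfolding pair_wf_digraph_def by (metis subsetD)
    then show ?thesis
      using assms by (auto simp: spanning_def subgraph_def compatible_def wf_digraph_wp_iff)
  qed
  show ?thesis
  proof (cases "pverts H = pverts D \<and> parcs H \<subseteq> parcs D")
    case True
    then have "pair_wf_digraph H" using assms unfolding pair_wf_digraph_def by (metis subsetD)
    then show ?thesis
      unfolding linear_spanner_def stretch_ok_def sp
      using True ddist_eq_iff[OF assms] ereal_ddist_le_iff[of H] by simp
  next
    case False
    then show ?thesis unfolding linear_spanner_def sp by blast
  qed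
qed

text \<open>This carries walks over from the structured vertices of the gadget to their
  numbers.\<close>

lemma relpow_image:
  assumes "inj_on h V" "E \<subseteq> V \<times> V" "u \<in> V" "v \<in> V"
  shows "(h u, h v) \<in> (map_prod h h ` E) ^^ k \<longleftrightarrow> (u, v) \<in> E ^^ k"
  using assms(3)
proof (induction k arbitrary: u)
  case 0
  then show ?case using assms(1,4) by (auto dest: inj_onD)
next
  case (Suc k)
  show ?case
  proof
    assume "(h u, h v) \<in> (map_prod h h ` E) ^^ Suc k"
    then obtain y where y: "(h u, y) \<in> map_prod h h ` E" "(y, h v) \<in> (map_prod h h ` E) ^^ k"
      by (meson relpow_Suc_D2)
    then obtain a c where ac: "(a, c) \<in> E" "h u = h a" "y = h c" by auto
    then have "a = u" "c \<in> V" using assms(1,2) Suc.prems by (auto dest: inj_onD)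
    then show "(u, v) \<in> E ^^ Suc k" using ac y(2) Suc.IH[of c] by (metis relpow_Suc_I2)
  next
    assume "(u, v) \<in> E ^^ Suc k"
    then obtain y where y: "(u, y) \<in> E" "(y, v) \<in> E ^^ k" by (meson relpow_Suc_D2)
    then have "(h u, h y) \<in> map_prod h h ` E" "y \<in> V" using assms(2) by force+
    then show "(h u, h v) \<in> (map_prod h h ` E) ^^ Suc k" using y(2) Suc.IH[of y] by (metis relpow_Suc_I2)
  qed
qed

lemma stretch_ok_image:
  assumes "inj_on h V" "E \<subseteq> V \<times> V" "H \<subseteq> V \<times> V"
  shows "stretch_ok g (h ` V) (map_prod h h ` E) (map_prod h h ` H) \<longleftrightarrow> stretch_ok g V E H"
  unfolding stretch_ok_def using relpow_image[OF assms(1,2)] relpow_image[OF assms(1,3)] by simp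

section \<open>The gadget digraph\<close>

datatype ('p, 'c) gadget_vertex = Src nat | Lit 'p | Chain 'p nat | Cls 'c

text \<open>
  \<open>Chain p\<close> is a path from every source to \<open>Lit p\<close> of total length \<open>b\<close>. If the arc from \<open>Src i\<close> to \<open>Lit p\<close>
  is kept, then \<open>Src i \<rightarrow> Lit p \<rightarrow> Cls c\<close> has length \<open>2 \<le> b\<close>; if it is deleted, the way
  from \<open>Src i\<close> through \<open>Lit p\<close> to \<open>Cls c\<close> has length \<open>b + 1\<close>.
\<close>

locale gadget =
  fixes P :: "'p set" and C :: "'c set" and s :: nat and Cu :: "nat \<Rightarrow> 'c set"
    and lits :: "'c \<Rightarrow> 'p set" and b :: nat
  assumes fin: "finite P" "finite C" and Cu: "\<And>i. i < s \<Longrightarrow> Cu i \<subseteq> C"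
    and lits: "\<And>c. c \<in> C \<Longrightarrow> lits c \<noteq> {} \<and> lits c \<subseteq> P" and b: "b \<ge> 2"
begin

definition V :: "('p, 'c) gadget_vertex set" where
  "V = Src ` {..<s} \<union> Lit ` P \<union> (\<lambda>(p, r). Chain p r) ` (P \<times> {..<b - 1}) \<union> Cls ` C"

text \<open>These arcs are the only way between their ends, so every spanner keeps them; see
  \<open>fixed_in_spanner\<close>.\<close>

definition fixed :: "('p, 'c) gadget_vertex rel" where
  "fixed = {(Src i, Chain p 0) | i p. i < s \<and> p \<in> P} \<union>
     {(Chain p r, Chain p (Suc r)) | p r. p \<in> P \<and> Suc r < b - 1} \<union>
     {(Chain p (b - 2), Lit p) | p. p \<in> P} \<union> {(Lit p, Cls c) | p c. c \<in> C \<and> p \<in> lits c}"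

definition opt :: "(nat \<Rightarrow> 'p set) \<Rightarrow> (nat \<Rightarrow> 'c set) \<Rightarrow> ('p, 'c) gadget_vertex rel" where
  "opt A R = {(Src i, Lit p) | i p. i < s \<and> p \<in> A i} \<union> {(Src i, Cls c) | i c. i < s \<and> c \<in> R i}"

definition E :: "('p, 'c) gadget_vertex rel" where
  "E = fixed \<union> opt (\<lambda>_. P) Cu"

lemma in_V_iff:
  "Src i \<in> V \<longleftrightarrow> i < s" "Lit p \<in> V \<longleftrightarrow> p \<in> P" "Chain p r \<in> V \<longleftrightarrow> p \<in> P \<and> r < b - 1" "Cls c \<in> V \<longleftrightarrow> c \<in> C"
  by (auto simp: V_def)

lemma lits_subset: "c \<in> C \<Longrightarrow> p \<in> lits c \<Longrightarrow> p \<in> P"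
  using lits by blast

lemma fixed_subset: "fixed \<subseteq> V \<times> V"
  using b by (auto simp: fixed_def in_V_iff lits_subset)

lemma E_subset: "E \<subseteq> V \<times> V"
  using fixed_subset subsetD[OF Cu] by (auto simp: E_def opt_def in_V_iff)

lemma finite_V: "finite V"
  using fin by (auto simp: V_def)

fun rank :: "('p, 'c) gadget_vertex \<Rightarrow> nat" where
  "rank (Src i) = 0"
| "rank (Chain p r) = Suc r"
| "rank (Lit p) = b"
| "rank (Cls c) = Suc b"

lemma rank_less: "(u, v) \<in> E \<Longrightarrow> rank u < rank v"
  using b by (auto simp: E_def fixed_def opt_def)

lemma acyclic_E: "acyclic E"
proof -
  have "(u, v) \<in> E\<^sup>+ \<Longrightarrow> rank u < rank v" for u v
    by (induction rule: trancl_induct) (auto dest: rank_less)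
  then show ?thesis unfolding acyclic_def by blast
qed

lemma card_fixed_opt:
  assumes "\<And>i. i < s \<Longrightarrow> A i \<subseteq> P" "\<And>i. i < s \<Longrightarrow> R i \<subseteq> Cu i"
  shows "card (fixed \<union> opt A R) = card fixed + (\<Sum>i<s. card (A i) + card (R i))"
proof -
  have finA: "finite (A i)" "finite (R i)" if "i < s" for i
    using assms[OF that] Cu[OF that] fin by (auto intro: finite_subset)
  let ?A = "(\<lambda>(i, p). (Src i, Lit p)) ` (SIGMA i:{..<s}. A i) :: ('p, 'c) gadget_vertex rel"
  let ?R = "(\<lambda>(i, c). (Src i, Cls c)) ` (SIGMA i:{..<s}. R i) :: ('p, 'c) gadget_vertex rel"
  have o: "opt A R = ?A \<union> ?R" by (auto simp: opt_def)
  have fA: "finite ?A" "finite ?R" using finA by auto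
  have cA: "card ?A = (\<Sum>i<s. card (A i))"
    using finA by (subst card_image) (auto simp: inj_on_def card_SigmaI)
  have cR: "card ?R = (\<Sum>i<s. card (R i))"
    using finA by (subst card_image) (auto simp: inj_on_def card_SigmaI)
  have "card (opt A R) = (\<Sum>i<s. card (A i) + card (R i))"
    unfolding o using fA by (subst card_Un_disjoint) (auto simp: cA cR sum.distrib)
  moreover have "finite fixed" using fixed_subset finite_V by (meson finite_SigmaI finite_subset)
  moreover have "fixed \<inter> opt A R = {}" by (auto simp: fixed_def opt_def)
  ultimately show ?thesis using fA by (subst card_Un_disjoint) (auto simp: o)
qed

lemma relpow_into_Src: "(x, Src j) \<in> E ^^ k \<Longrightarrow> k = 0 \<and> x = Src j"
  by (cases k) (auto simp: E_def fixed_def opt_def elim!: relcompE)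

lemma relpow_from_Cls: "(Cls c, y) \<in> E ^^ k \<Longrightarrow> k = 0 \<and> y = Cls c"
proof (cases k)
  case (Suc k')
  assume "(Cls c, y) \<in> E ^^ k"
  then obtain z where "(Cls c, z) \<in> E" using Suc by (meson relpow_Suc_D2)
  then show ?thesis by (auto simp: E_def fixed_def opt_def)
qed auto

lemma relpow_Src_Chain: "(Src i, Chain p r) \<in> E ^^ k \<Longrightarrow> k = Suc r"
proof (induction r arbitrary: k)
  case 0
  then obtain k' y where "k = Suc k'" "(Src i, y) \<in> E ^^ k'" "(y, Chain p 0) \<in> E"
    by (cases k) auto
  moreover from this(3) obtain j where "y = Src j" by (auto simp: E_def fixed_def opt_def)
  ultimately show ?case using relpow_into_Src[of "Src i" j k'] by simp
next
  case (Suc r)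
  then obtain k' y where k': "k = Suc k'" "(Src i, y) \<in> E ^^ k'" "(y, Chain p (Suc r)) \<in> E"
    by (cases k) auto
  then have "y = Chain p r" by (auto simp: E_def fixed_def opt_def)
  then show ?case using Suc.IH k' by simp
qed

lemma relpow_subset: "H \<subseteq> E \<Longrightarrow> H ^^ k \<subseteq> E ^^ k"
  by (induction k) (auto simp: relcomp_mono)

lemma relpow_last:
  assumes "(u, v) \<in> H ^^ k" "u \<noteq> v"
  shows "\<exists>k' y. k = Suc k' \<and> (u, y) \<in> H ^^ k' \<and> (y, v) \<in> H"
  using assms by (cases k) auto

text \<open>The only alternative to the arc is the chain, and it takes exactly \<open>b\<close>
  steps.\<close>

lemma short_path_to_Lit:
  assumes "H \<subseteq> E" "(Src i, Lit p) \<in> H ^^ m" "m < b"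
  shows "(Src i, Lit p) \<in> H"
proof -
  obtain k y where k: "m = Suc k" "(Src i, y) \<in> H ^^ k" "(y, Lit p) \<in> H"
    using relpow_last[OF assms(2)] by auto
  have kE: "(Src i, y) \<in> E ^^ k" using k(2) relpow_subset[OF assms(1)] by blast
  have "(y, Lit p) \<in> E" using k(3) assms(1) by blast
  then consider j where "y = Src j" | "y = Chain p (b - 2)" by (auto simp: E_def fixed_def opt_def)
  then show ?thesis
  proof cases
    case 1
    then show ?thesis using relpow_into_Src[of "Src i" j k] kE k(3) by auto
  next
    case 2
    then have "k = Suc (b - 2)" using relpow_Src_Chain kE by blast
    then show ?thesis using assms(3) k(1) b by simp
  qed
qed

text \<open>A walk that replaces the arc must end with it, because no other arc into its head is
  reachable from its tail. For arcs from literals to clauses the first step is used instead: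
  literals lead only to clauses, and these are sinks.\<close>

lemma fixed_in_spanner:
  assumes H: "H \<subseteq> E" and sp: "\<And>u v. (u, v) \<in> E \<Longrightarrow> \<exists>k. (u, v) \<in> H ^^ k"
  shows "fixed \<subseteq> H"
proof (rule subrelI)
  fix u v assume uv: "(u, v) \<in> fixed"
  then have "(u, v) \<in> E" by (simp add: E_def)
  then have ne: "u \<noteq> v" using rank_less[of u v] by auto
  obtain k where k: "(u, v) \<in> H ^^ k" using sp \<open>(u, v) \<in> E\<close> by blast
  obtain k' y where y: "k = Suc k'" "(u, y) \<in> H ^^ k'" "(y, v) \<in> H" using relpow_last[OF k ne] by blast
  have yE: "(u, y) \<in> E ^^ k'" "(y, v) \<in> E" using y relpow_subset[OF H] H by blast+
  from uv consider (1) i p where "u = Src i" "v = Chain p 0" | (2) p r where "u = Chain p r" "v = Chain p (Suc r)"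
    | (3) p where "u = Chain p (b - 2)" "v = Lit p" | (4) p c where "u = Lit p" "v = Cls c"
    by (auto simp: fixed_def)
  then show "(u, v) \<in> H"
  proof cases
    case 1
    then obtain j where "y = Src j" using yE(2) by (auto simp: E_def fixed_def opt_def)
    then show ?thesis using relpow_into_Src[of u j k'] yE(1) y(3) by auto
  next
    case 2
    then have "y = u" using yE(2) by (auto simp: E_def fixed_def opt_def)
    then show ?thesis using y(3) by simp
  next
    case 3
    then consider j where "y = Src j" | "y = u" using yE(2) by (auto simp: E_def fixed_def opt_def)
    then show ?thesis using relpow_into_Src[of u _ k'] yE(1) y(3) by cases auto
  next
    case 4
    obtain x where x: "(u, x) \<in> H" "(x, v) \<in> H ^^ k'" using k unfolding y(1) by (meson relpow_Suc_D2)
    then obtain c' where "x = Cls c'" using H 4 by (auto simp: E_def fixed_def opt_def)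
    then show ?thesis using relpow_from_Cls[of c' v k'] x relpow_subset[OF H] by blast
  qed
qed

text \<open>A kept arc to a clause is traded for one literal of this clause, which does not increase
  the cost. A deleted one has a detour of length at most \<open>b\<close>; it reaches a literal of
  the clause in fewer than \<open>b\<close> steps, so the arc to this literal was kept.\<close>

lemma spanner_to_hitting:
  assumes H: "H \<subseteq> E" and sp: "stretch_ok g V E H" and g: "\<And>k. real k \<le> g 1 \<Longrightarrow> k \<le> b"
  shows "\<exists>K. (\<forall>i < s. K i \<subseteq> P \<and> (\<forall>c \<in> Cu i. K i \<inter> lits c \<noteq> {})) \<and>
    card fixed + (\<Sum>i<s. card (K i)) \<le> card H"
proof -
  have arc: "\<exists>k \<le> b. (u, v) \<in> H ^^ k" if "(u, v) \<in> E" for u v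
  proof -
    have "u \<noteq> v" using rank_less[OF that] by auto
    then have "\<forall>d' < 1. (u, v) \<notin> E ^^ d'" by auto
    moreover have "(u, v) \<in> E ^^ 1" "u \<in> V" "v \<in> V" using that E_subset by auto
    ultimately obtain k where "real k \<le> g 1" "(u, v) \<in> H ^^ k" using sp unfolding stretch_ok_def by blast
    then show ?thesis using g by blast
  qed
  then have fx: "fixed \<subseteq> H" using fixed_in_spanner[OF H] by blast
  define A where "A i = {p \<in> P. (Src i, Lit p) \<in> H}" for i
  define R where "R i = {c \<in> Cu i. (Src i, Cls c) \<in> H}" for i
  have "H = fixed \<union> opt A R"
    using H fx by (auto simp: E_def opt_def A_def R_def)
  then have cH: "card H = card fixed + (\<Sum>i<s. card (A i) + card (R i))"
    using card_fixed_opt[of A R] by (simp add: A_def R_def)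
  define pick where "pick c = (SOME p. p \<in> lits c)" for c
  have pick: "pick c \<in> lits c" if "c \<in> C" for c
    using lits[OF that] unfolding pick_def by (meson ex_in_conv someI_ex)
  define K where "K i = A i \<union> pick ` R i" for i
  have "K i \<subseteq> P \<and> (\<forall>c \<in> Cu i. K i \<inter> lits c \<noteq> {})" if i: "i < s" for i
  proof (intro conjI ballI)
    show "K i \<subseteq> P" using pick lits_subset Cu[OF i] by (auto simp: K_def A_def R_def)
  next
    fix c assume c: "c \<in> Cu i"
    then have cC: "c \<in> C" using Cu[OF i] by blast
    show "K i \<inter> lits c \<noteq> {}"
    proof (cases "(Src i, Cls c) \<in> H")
      case True
      then have "pick c \<in> K i" using c by (auto simp: K_def R_def)
      then show ?thesis using pick[OF cC] by blast
    next
      case False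
      have "(Src i, Cls c) \<in> E" using i c by (auto simp: E_def opt_def)
      then obtain k where k: "k \<le> b" "(Src i, Cls c) \<in> H ^^ k" using arc by blast
      obtain k' y where y: "k = Suc k'" "(Src i, y) \<in> H ^^ k'" "(y, Cls c) \<in> H"
        using relpow_last[OF k(2)] by auto
      have yE: "(Src i, y) \<in> E ^^ k'" "(y, Cls c) \<in> E" using y relpow_subset[OF H] H by blast+
      then consider j where "y = Src j" | p where "y = Lit p" "p \<in> lits c"
        by (auto simp: E_def fixed_def opt_def)
      then show ?thesis
      proof cases
        case 1
        then show ?thesis using relpow_into_Src[of "Src i" j k'] yE(1) y(3) False by auto
      next
        case 2
        have "(Src i, Lit p) \<in> H"
          by (rule short_path_to_Lit[OF H, where m = k']) (use 2 y k in auto)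
        then have "p \<in> K i" using 2 lits[OF cC] by (auto simp: K_def A_def)
        then show ?thesis using 2 by blast
      qed
    qed
  qed
  moreover have "(\<Sum>i<s. card (K i)) \<le> (\<Sum>i<s. card (A i) + card (R i))"
  proof (rule sum_mono)
    fix i assume "i \<in> {..<s}"
    then have "finite (R i)" using Cu fin by (auto simp: R_def intro: finite_subset)
    then show "card (K i) \<le> card (A i) + card (R i)"
      unfolding K_def by (meson add_left_mono card_Un_le card_image_le le_trans)
  qed
  ultimately show ?thesis using cH by (intro exI[of _ K]) auto
qed

lemma path_to_Chain:
  assumes "fixed \<subseteq> H" "i < s" "p \<in> P" "r < b - 1"
  shows "(Src i, Chain p r) \<in> H ^^ Suc r"
  using assms(4)
proof (induction r)
  case 0
  then show ?case using assms by (auto simp: fixed_def)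
next
  case (Suc r)
  then have "(Chain p r, Chain p (Suc r)) \<in> H" using assms by (auto simp: fixed_def)
  then show ?case using Suc by (auto intro: relpow_Suc_I)
qed

text \<open>All arcs from sources to clauses are dropped. Literals remain within \<open>b\<close>
  steps and the clauses of \<open>Cu i\<close> within \<open>2\<close>. Any other clause was at
  distance at least \<open>2\<close> from \<open>Src i\<close>, where the bound admits the
  \<open>b + 1\<close> steps through a chain. Walks that do not start in a source use fixed arcs
  only.\<close>

lemma hitting_to_spanner:
  assumes K: "\<And>i. i < s \<Longrightarrow> K i \<subseteq> P" "\<And>i c. i < s \<Longrightarrow> c \<in> Cu i \<Longrightarrow> K i \<inter> lits c \<noteq> {}"
    and g: "g 0 \<ge> 0" "\<And>d. d \<ge> 1 \<Longrightarrow> real (b + d - 1) \<le> g d"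
  shows "stretch_ok g V E (fixed \<union> opt K (\<lambda>_. {}))"
  unfolding stretch_ok_def
proof (intro ballI allI impI)
  let ?H = "fixed \<union> opt K (\<lambda>_. {})"
  fix u v d
  assume u: "u \<in> V" and v: "v \<in> V" and "(u, v) \<in> E ^^ d \<and> (\<forall>d' < d. (u, v) \<notin> E ^^ d')"
  then have d: "(u, v) \<in> E ^^ d" by blast
  show "\<exists>k. real k \<le> g d \<and> (u, v) \<in> ?H ^^ k"
  proof (cases "d = 0")
    case True
    then show ?thesis using d g(1) by (intro exI[of _ 0]) auto
  next
    case False
    then have gd: "real (b + d - 1) \<le> g d" using g(2) by simp
    have bd: "real k \<le> g d" if "k \<le> b + d - 1" for k using gd that by linarith
    have toLit: "(Src i, Lit p) \<in> ?H ^^ b" if "i < s" "p \<in> P" for i p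
    proof -
      have "(Src i, Chain p (b - 2)) \<in> ?H ^^ Suc (b - 2)"
        by (rule path_to_Chain) (use that b in auto)
      moreover have "(Chain p (b - 2), Lit p) \<in> ?H" using that by (auto simp: fixed_def)
      ultimately have "(Src i, Lit p) \<in> ?H ^^ Suc (Suc (b - 2))" by (rule relpow_Suc_I)
      then show ?thesis using b by (simp add: numeral_2_eq_2 Suc_diff_Suc del: relpow.simps)
    qed
    show ?thesis
    proof (cases "\<exists>i. u = Src i")
      case False
      have "(u, v) \<in> fixed ^^ d" using d False
      proof (induction d arbitrary: u)
        case 0
        then show ?case by simp
      next
        case (Suc d)
        obtain y where y: "(u, y) \<in> E" "(y, v) \<in> E ^^ d" using Suc.prems(1) by (meson relpow_Suc_D2)
        then have "(u, y) \<in> fixed" "\<nexists>i. y = Src i" using Suc.prems(2)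
          by (auto simp: E_def opt_def fixed_def)
        then show ?case using Suc.IH[OF y(2)] by (meson relpow_Suc_I2)
      qed
      moreover have "fixed ^^ d \<subseteq> ?H ^^ d" by (induction d) (auto simp: relcomp_mono)
      ultimately show ?thesis using bd[of d] b by (intro exI[of _ d]) auto
    next
      case True
      then obtain i where i: "u = Src i" "i < s" using u by (auto simp: V_def)
      from v consider j where "v = Src j" | p where "v = Lit p" "p \<in> P"
        | p r where "v = Chain p r" "p \<in> P" "r < b - 1" | c where "v = Cls c" "c \<in> C"
        by (auto simp: V_def)
      then show ?thesis
      proof cases
        case 1
        then show ?thesis using d relpow_into_Src \<open>d \<noteq> 0\<close> by blast
      next
        case 2
        then show ?thesis using toLit[of i p] i bd[of b] \<open>d \<noteq> 0\<close> by (intro exI[of _ b]) auto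
      next
        case 3
        then show ?thesis using path_to_Chain[of ?H i p r] i bd[of "Suc r"]
          by (intro exI[of _ "Suc r"]) (auto simp del: relpow.simps)
      next
        case 4
        show ?thesis
        proof (cases "c \<in> Cu i")
          case True
          then obtain p where p: "p \<in> K i" "p \<in> lits c" using K(2)[OF i(2)] by blast
          then have 1: "(Src i, Lit p) \<in> ?H" "(Lit p, Cls c) \<in> ?H"
            using i 4 by (auto simp: opt_def fixed_def)
          have "(Src i, Cls c) \<in> ?H ^^ Suc 1" by (rule relpow_Suc_I[of _ "Lit p"]) (use 1 in auto)
          then show ?thesis using i 4 bd[of "Suc 1"] b \<open>d \<noteq> 0\<close>
            by (intro exI[of _ "Suc 1"]) (auto simp del: relpow.simps)
        next
          case False
          then have "(Src i, Cls c) \<notin> E" by (auto simp: E_def opt_def fixed_def)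
          then have "d \<noteq> 1" using d i 4 by auto
          then have d2: "d \<ge> 2" using \<open>d \<noteq> 0\<close> by simp
          obtain p where p: "p \<in> lits c" "p \<in> P" using lits[OF 4(2)] by blast
          then have "(Lit p, Cls c) \<in> ?H" using 4 by (auto simp: fixed_def)
          then have "(Src i, Cls c) \<in> ?H ^^ Suc b" using toLit[OF i(2) p(2)] by (meson relpow_Suc_I)
          then show ?thesis using i 4 bd[of "Suc b"] d2
            by (intro exI[of _ "Suc b"]) (auto simp del: relpow.simps)
        qed
      qed
    qed
  qed
qed

theorem spanner_iff_hitting:
  assumes g: "g 0 \<ge> 0" "\<And>d. d \<ge> 1 \<Longrightarrow> real (b + d - 1) \<le> g d" "\<And>k. real k \<le> g 1 \<Longrightarrow> k \<le> b"
  shows "(\<exists>H. H \<subseteq> E \<and> stretch_ok g V E H \<and> card H + k \<le> card E) \<longleftrightarrow>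
    (\<exists>K. (\<forall>i < s. K i \<subseteq> P \<and> (\<forall>c \<in> Cu i. K i \<inter> lits c \<noteq> {})) \<and>
      (\<Sum>i<s. card (K i)) + k \<le> (\<Sum>i<s. card P + card (Cu i)))"
proof -
  have cE: "card E = card fixed + (\<Sum>i<s. card P + card (Cu i))"
    unfolding E_def by (rule card_fixed_opt) auto
  show ?thesis
  proof
    assume "\<exists>H. H \<subseteq> E \<and> stretch_ok g V E H \<and> card H + k \<le> card E"
    then obtain H where H: "H \<subseteq> E" "stretch_ok g V E H" "card H + k \<le> card E" by blast
    obtain K where K: "\<forall>i < s. K i \<subseteq> P \<and> (\<forall>c \<in> Cu i. K i \<inter> lits c \<noteq> {})"
      "card fixed + (\<Sum>i<s. card (K i)) \<le> card H"
      using spanner_to_hitting[OF H(1,2) g(3)] by blast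
    then show "\<exists>K. (\<forall>i < s. K i \<subseteq> P \<and> (\<forall>c \<in> Cu i. K i \<inter> lits c \<noteq> {})) \<and>
      (\<Sum>i<s. card (K i)) + k \<le> (\<Sum>i<s. card P + card (Cu i))"
      using H(3) cE by (intro exI[of _ K]) simp
  next
    assume "\<exists>K. (\<forall>i < s. K i \<subseteq> P \<and> (\<forall>c \<in> Cu i. K i \<inter> lits c \<noteq> {})) \<and>
      (\<Sum>i<s. card (K i)) + k \<le> (\<Sum>i<s. card P + card (Cu i))"
    then obtain K where K: "\<forall>i < s. K i \<subseteq> P \<and> (\<forall>c \<in> Cu i. K i \<inter> lits c \<noteq> {})"
      "(\<Sum>i<s. card (K i)) + k \<le> (\<Sum>i<s. card P + card (Cu i))" by blast
    let ?H = "fixed \<union> opt K (\<lambda>_. {})"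
    have "?H \<subseteq> E" using K(1) by (auto simp: E_def opt_def)
    moreover have "stretch_ok g V E ?H" by (rule hitting_to_spanner) (use K(1) g in auto)
    moreover have "card ?H = card fixed + (\<Sum>i<s. card (K i))"
      using card_fixed_opt[of K "\<lambda>_. {}"] K(1) by simp
    ultimately show "\<exists>H. H \<subseteq> E \<and> stretch_ok g V E H \<and> card H + k \<le> card E"
      using K(2) cE by (intro exI[of _ ?H]) simp
  qed
qed

end

section \<open>Disjunctions of instances\<close>

type_synonym 'v or_lit = "(('v + nat) \<times> bool) option"
type_synonym 'v or_clause = "'v or_lit set + nat \<times> nat \<times> bool"
type_synonym 'v or_vertex = "('v or_lit, 'v or_clause) gadget_vertex"

text \<open>
  \<open>Inr j\<close> is the variable selecting column \<open>j\<close>, and \<open>None\<close> is the escape literal. It belongs to all clauses but the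
  pairs \<open>{v, \<not> v}\<close>; hence a hitting set of size \<open>card Vs\<close> is a satisfying assignment, while one of size
  \<open>card Vs + 1\<close> always exists.
\<close>

locale or_gadget =
  fixes vars :: "'v set" and \<Phi> :: "('v \<times> bool) set set" and X :: "nat \<Rightarrow> 'v" and m s :: nat
  assumes fin_vars: "finite vars" and fin_\<Phi>: "finite \<Phi>"
    and \<Phi>_vars: "\<And>C. C \<in> \<Phi> \<Longrightarrow> fst ` C \<subseteq> vars" and X_vars: "\<And>l. l < m \<Longrightarrow> X l \<in> vars"
begin

definition Vs :: "('v + nat) set" where "Vs = Inl ` vars \<union> Inr ` {..<s}"

definition P :: "'v or_lit set" where
  "P = insert None (Some ` (Vs \<times> UNIV))"

definition lift_clause :: "('v \<times> bool) set \<Rightarrow> 'v or_lit set" where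
  "lift_clause C = insert None ((\<lambda>l. Some (Inl (fst l), snd l)) ` C)"

definition base :: "'v or_lit set set" where
  "base = lift_clause ` \<Phi> \<union> {insert None ((\<lambda>j. Some (Inr j, True)) ` {..<s})} \<union>
     (\<lambda>v. {Some (v, True), Some (v, False)}) ` Vs"

definition lits :: "'v or_clause \<Rightarrow> 'v or_lit set" where
  "lits c = (case c of Inl A \<Rightarrow> A | Inr (j, l, \<sigma>) \<Rightarrow> {None, Some (Inr j, False), Some (Inl (X l), \<sigma>)})"

text \<open>For each \<open>j\<close> and \<open>l\<close> both polarities are present as vertices
  shared by all rows; the string \<open>x i j\<close> only decides to which of the two
  \<open>Src i\<close> has an arc. Thus the vertex set does not depend on \<open>x\<close>.\<close>

definition C :: "('v or_clause) set" where
  "C = Inl ` base \<union> Inr ` ({..<s} \<times> {..<m} \<times> UNIV)"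

definition Cu :: "(nat \<Rightarrow> nat \<Rightarrow> bool list) \<Rightarrow> nat \<Rightarrow>
    ('v or_clause) set" where
  "Cu x i = Inl ` base \<union> (\<lambda>(j, l). Inr (j, l, x i j ! l)) ` ({..<s} \<times> {..<m})"

lemma finite_Vs: "finite Vs" and card_Vs: "card Vs = card vars + s"
proof -
  show "finite Vs" using fin_vars by (simp add: Vs_def)
  show "card Vs = card vars + s" unfolding Vs_def using fin_vars
    by (subst card_Un_disjoint) (auto simp: card_image)
qed

lemma finite_P: "finite P" and card_P: "card P = 2 * card Vs + 1"
  using finite_Vs by (auto simp: P_def card_insert_if card_image card_cartesian_product)

lemma finite_base: "finite base"
  using fin_\<Phi> finite_Vs by (simp add: base_def)

lemma card_base: "card base \<le> card \<Phi> + 1 + card Vs"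
proof -
  have "card (lift_clause ` \<Phi>) \<le> card \<Phi>" "card ((\<lambda>v. {Some (v, True), Some (v, False)}) ` Vs) \<le> card Vs"
    using fin_\<Phi> finite_Vs by (simp_all add: card_image_le)
  then show ?thesis unfolding base_def
    using card_Un_le[of "lift_clause ` \<Phi> \<union> {insert None ((\<lambda>j. Some (Inr j, True)) ` {..<s})}"
        "(\<lambda>v. {Some (v, True), Some (v, False)}) ` Vs"]
      card_Un_le[of "lift_clause ` \<Phi>" "{insert None ((\<lambda>j. Some (Inr j, True)) ` {..<s})}"]
    by simp
qed

lemma finite_C: "finite C"
  using finite_base by (simp add: C_def)

lemma card_C: "card C \<le> card base + 2 * s * m"
proof -
  have "card C \<le> card (Inl ` base :: 'v or_clause set) +
      card (Inr ` ({..<s} \<times> {..<m} \<times> (UNIV :: bool set)) :: 'v or_clause set)"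
    unfolding C_def by (rule card_Un_le)
  also have "\<dots> = card base + 2 * s * m" by (simp add: card_image card_cartesian_product)
  finally show ?thesis .
qed

lemma card_Cu: "card (Cu x i) = card base + s * m"
proof -
  let ?A = "Inl ` base :: 'v or_clause set"
  let ?B = "(\<lambda>(j, l). Inr (j, l, x i j ! l)) ` ({..<s} \<times> {..<m}) ::
    ('v or_clause) set"
  have "card ?A = card base" by (simp add: card_image)
  moreover have "card ?B = s * m" by (subst card_image) (auto simp: inj_on_def)
  moreover have "?A \<inter> ?B = {}" by auto
  moreover have "finite ?A" "finite ?B" using finite_base by auto
  ultimately show ?thesis unfolding Cu_def by (subst card_Un_disjoint) auto
qed

lemma base_ok: "A \<in> base \<Longrightarrow> A \<noteq> {} \<and> A \<subseteq> P"
proof -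
  assume "A \<in> base"
  then consider D where "D \<in> \<Phi>" "A = lift_clause D" | "A = insert None ((\<lambda>j. Some (Inr j, True)) ` {..<s})"
    | v where "v \<in> Vs" "A = {Some (v, True), Some (v, False)}" by (auto simp: base_def)
  then show ?thesis
  proof cases
    case 1
    then show ?thesis using \<Phi>_vars[of D] by (auto simp: lift_clause_def P_def Vs_def)
  next
    case 2
    then show ?thesis by (auto simp: P_def Vs_def)
  next
    case 3
    then show ?thesis by (auto simp: P_def)
  qed
qed

lemma gadget: "b \<ge> 2 \<Longrightarrow> gadget P C s (Cu x) lits b"
proof
  show "finite P" "finite C" by (rule finite_P, rule finite_C)
  show "Cu x i \<subseteq> C" for i by (auto simp: Cu_def C_def)
  show "lits c \<noteq> {} \<and> lits c \<subseteq> P" if c: "c \<in> C" for c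
  proof (cases c)
    case (Inl A)
    then have "A \<in> base" using c by (auto simp: C_def)
    then show ?thesis using base_ok Inl by (simp add: lits_def)
  next
    case (Inr y)
    then show ?thesis using c X_vars by (auto simp: C_def lits_def P_def Vs_def)
  qed
qed

definition hits :: "'v or_lit set \<Rightarrow> (nat \<Rightarrow> nat \<Rightarrow> bool list) \<Rightarrow> nat \<Rightarrow> bool" where
  "hits K x i \<longleftrightarrow> K \<subseteq> P \<and> (\<forall>c \<in> Cu x i. K \<inter> lits c \<noteq> {})"

lemma hits_iff: "hits K x i \<longleftrightarrow> K \<subseteq> P \<and> (\<forall>A \<in> base. K \<inter> A \<noteq> {}) \<and>
   (\<forall>j < s. \<forall>l < m. K \<inter> {None, Some (Inr j, False), Some (Inl (X l), x i j ! l)} \<noteq> {})"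
proof -
  have "(\<forall>c \<in> Cu x i. K \<inter> lits c \<noteq> {}) \<longleftrightarrow> (\<forall>A \<in> base. K \<inter> lits (Inl A) \<noteq> {}) \<and>
     (\<forall>j < s. \<forall>l < m. K \<inter> lits (Inr (j, l, x i j ! l)) \<noteq> {})"
    unfolding Cu_def by auto
  then show ?thesis unfolding hits_def by (simp add: lits_def)
qed

text \<open>The pairs \<open>{v, \<not> v}\<close> already force one literal per variable, so size
  \<open>card Vs\<close> leaves exactly one for each and no room for \<open>None\<close>. The true
  selector then binds the input variables to its column.\<close>

lemma small_hitting_set_sat:
  assumes K: "hits K x i" "card K \<le> card Vs"
  shows "\<exists>j < s. \<exists>\<alpha>. sat \<alpha> \<Phi> \<and> (\<forall>l < m. \<alpha> (X l) = x i j ! l)"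
proof -
  note h = K(1)[unfolded hits_iff]
  define \<alpha> where "\<alpha> v = (Some (v, True) \<in> K)" for v
  have "Some (v, \<alpha> v) \<in> K" if "v \<in> Vs" for v
  proof -
    have "{Some (v, True), Some (v, False)} \<in> base" using that by (auto simp: base_def)
    then have "K \<inter> {Some (v, True), Some (v, False)} \<noteq> {}" using h by blast
    then have "Some (v, True) \<in> K \<or> Some (v, False) \<in> K" by blast
    then show ?thesis by (cases "Some (v, True) \<in> K") (simp_all add: \<alpha>_def)
  qed
  then have sub: "(\<lambda>v. Some (v, \<alpha> v)) ` Vs \<subseteq> K" by (rule image_subsetI)
  have cV: "card ((\<lambda>v. Some (v, \<alpha> v)) ` Vs) = card Vs" by (rule card_image) (simp add: inj_on_def)
  have "finite K" using conjunct1[OF h] finite_P by (rule finite_subset)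
  from card_seteq[OF this sub] have KV: "K = (\<lambda>v. Some (v, \<alpha> v)) ` Vs" using cV K(2) by simp
  then have N: "None \<notin> K" and S: "\<And>v \<sigma>. Some (v, \<sigma>) \<in> K \<Longrightarrow> \<alpha> v = \<sigma>" by auto
  have "insert None ((\<lambda>j. Some (Inr j, True)) ` {..<s}) \<in> base" by (simp add: base_def)
  then have "K \<inter> insert None ((\<lambda>j. Some (Inr j, True)) ` {..<s}) \<noteq> {}" using h by blast
  then obtain j where j: "j < s" "Some (Inr j, True) \<in> K" using N by auto
  have "\<alpha> (Inl (X l)) = x i j ! l" if "l < m" for l
  proof -
    have "K \<inter> {None, Some (Inr j, False), Some (Inl (X l), x i j ! l)} \<noteq> {}" using h j(1) that by blast
    moreover have "Some (Inr j, False) \<notin> K" using S[OF j(2)] S[of "Inr j" False] by auto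
    ultimately have "Some (Inl (X l), x i j ! l) \<in> K" using N by auto
    then show ?thesis by (rule S)
  qed
  moreover have "sat (\<lambda>v. \<alpha> (Inl v)) \<Phi>"
    unfolding sat_def
  proof
    fix D assume "D \<in> \<Phi>"
    then have "lift_clause D \<in> base" by (simp add: base_def)
    then have "K \<inter> lift_clause D \<noteq> {}" using h by blast
    then obtain l where "l \<in> D" "Some (Inl (fst l), snd l) \<in> K" using N by (auto simp: lift_clause_def)
    then show "\<exists>l \<in> D. \<alpha> (Inl (fst l)) = snd l" using S by blast
  qed
  ultimately show ?thesis using j(1) by blast
qed

text \<open>Only the selector of column \<open>j\<close> is set to true, so the clauses of all other
  columns are hit by their negated selectors.\<close>

lemma sat_small_hitting_set:
  assumes "j < s" "sat \<alpha> \<Phi>" "\<forall>l < m. \<alpha> (X l) = x i j ! l"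
  shows "\<exists>K. hits K x i \<and> card K \<le> card Vs"
proof -
  define \<beta> where "\<beta> v = (case v of Inl u \<Rightarrow> \<alpha> u | Inr j' \<Rightarrow> j' = j)" for v
  define K where "K = (\<lambda>v. Some (v, \<beta> v)) ` Vs"
  have inK: "Some (v, \<sigma>) \<in> K \<longleftrightarrow> v \<in> Vs \<and> \<sigma> = \<beta> v" for v \<sigma> by (auto simp: K_def)
  have "hits K x i"
    unfolding hits_iff
  proof (intro conjI ballI allI impI)
    show "K \<subseteq> P" by (auto simp: K_def P_def)
  next
    fix A assume "A \<in> base"
    then consider D where "D \<in> \<Phi>" "A = lift_clause D" | "A = insert None ((\<lambda>j. Some (Inr j, True)) ` {..<s})"
      | v where "v \<in> Vs" "A = {Some (v, True), Some (v, False)}" by (auto simp: base_def)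
    then show "K \<inter> A \<noteq> {}"
    proof cases
      case 1
      obtain l where l: "l \<in> D" "\<alpha> (fst l) = snd l" using assms(2) 1 unfolding sat_def by blast
      have "Some (Inl (fst l), snd l) \<in> K" using l 1 \<Phi>_vars[of D] by (auto simp: inK \<beta>_def Vs_def)
      moreover have "Some (Inl (fst l), snd l) \<in> A" using l 1 by (auto simp: lift_clause_def)
      ultimately show ?thesis by blast
    next
      case 2
      have "Some (Inr j, True) \<in> K" using assms(1) by (auto simp: inK \<beta>_def Vs_def)
      then show ?thesis using 2 assms(1) by blast
    next
      case 3
      then have "Some (v, \<beta> v) \<in> K \<inter> A" by (cases "\<beta> v") (auto simp: inK)
      then show ?thesis by blast
    qed
  next
    fix j' l assume j': "j' < s" and l: "l < m"
    show "K \<inter> {None, Some (Inr j', False), Some (Inl (X l), x i j' ! l)} \<noteq> {}"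
    proof (cases "j' = j")
      case True
      then have "Some (Inl (X l), x i j' ! l) \<in> K"
        using assms(3) l X_vars by (auto simp: inK \<beta>_def Vs_def)
      then show ?thesis by blast
    next
      case False
      then have "Some (Inr j', False) \<in> K" using j' by (auto simp: inK \<beta>_def Vs_def)
      then show ?thesis by blast
    qed
  qed
  moreover have "card K \<le> card Vs" unfolding K_def by (rule card_image_le[OF finite_Vs])
  ultimately show ?thesis by blast
qed

lemma escape_hitting_set: "\<exists>K. hits K x i \<and> card K \<le> card Vs + 1"
proof -
  define K :: "'v or_lit set" where "K = insert None ((\<lambda>v. Some (v, True)) ` Vs)"
  have "hits K x i"
    unfolding hits_iff
  proof (intro conjI ballI allI impI)
    show "K \<subseteq> P" by (auto simp: K_def P_def)
    have N: "None \<in> K" by (simp add: K_def)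
    fix A assume "A \<in> base"
    then consider "None \<in> A" | v where "v \<in> Vs" "A = {Some (v, True), Some (v, False)}"
      by (auto simp: base_def lift_clause_def)
    then show "K \<inter> A \<noteq> {}"
    proof cases
      case 1
      then show ?thesis using N by blast
    next
      case 2
      then have "Some (v, True) \<in> K" by (simp add: K_def)
      then show ?thesis using 2(2) by blast
    qed
  qed (simp add: K_def)
  moreover have "card K \<le> card Vs + 1"
    unfolding K_def using finite_Vs card_image_le[OF finite_Vs, of "\<lambda>v. Some (v, True)"]
    by (simp add: card_insert_if)
  ultimately show ?thesis by blast
qed

text \<open>Chosen so that the condition on the number of arcs becomes a total below
  \<open>s * (card Vs + 1)\<close>, that is, some row must get by with \<open>card Vs\<close>. All
  rows have equally many clauses, so \<open>k\<close> is the same for every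
  \<open>x\<close>.\<close>

definition k :: nat where "k = s * (card P + card base + s * m) + 1 - s * (card Vs + 1)"

lemma k_pos: "k > 0" and k_eq: "k + s * (card Vs + 1) = s * (card P + card base + s * m) + 1"
proof -
  have "s * (card Vs + 1) \<le> s * (card P + card base + s * m)"
    by (rule mult_le_mono2) (simp add: card_P)
  then show "k > 0" "k + s * (card Vs + 1) = s * (card P + card base + s * m) + 1"
    by (simp_all add: k_def)
qed

lemma hitting_iff_or:
  "(\<exists>K. (\<forall>i < s. hits (K i) x i) \<and> (\<Sum>i<s. card (K i)) + k \<le> (\<Sum>i<s. card P + card (Cu x i))) \<longleftrightarrow>
   (\<exists>i < s. \<exists>j < s. \<exists>\<alpha>. sat \<alpha> \<Phi> \<and> (\<forall>l < m. \<alpha> (X l) = x i j ! l))"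
proof -
  have thr: "a + k \<le> (\<Sum>i<s. card P + card (Cu x i)) \<longleftrightarrow> a < s * (card Vs + 1)" for a
  proof -
    have "(\<Sum>i<s. card P + card (Cu x i)) = s * (card P + card base + s * m)"
      unfolding card_Cu by (simp add: add.assoc)
    then show ?thesis using k_eq by linarith
  qed
  show ?thesis
    unfolding thr
  proof
    assume "\<exists>K. (\<forall>i < s. hits (K i) x i) \<and> (\<Sum>i<s. card (K i)) < s * (card Vs + 1)"
    then obtain K where K: "\<forall>i < s. hits (K i) x i" "(\<Sum>i<s. card (K i)) < s * (card Vs + 1)" by blast
    have "\<exists>i < s. card (K i) \<le> card Vs"
    proof (rule ccontr)
      assume "\<not> (\<exists>i < s. card (K i) \<le> card Vs)"
      then have "(\<Sum>i<s. card Vs + 1) \<le> (\<Sum>i<s. card (K i))" by (intro sum_mono) auto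
      then show False using K(2) by simp
    qed
    then obtain i where i: "i < s" "card (K i) \<le> card Vs" by blast
    then show "\<exists>i < s. \<exists>j < s. \<exists>\<alpha>. sat \<alpha> \<Phi> \<and> (\<forall>l < m. \<alpha> (X l) = x i j ! l)"
      using small_hitting_set_sat[of "K i" x i] K(1) by blast
  next
    assume "\<exists>i < s. \<exists>j < s. \<exists>\<alpha>. sat \<alpha> \<Phi> \<and> (\<forall>l < m. \<alpha> (X l) = x i j ! l)"
    then obtain i0 j0 \<alpha> where i0: "i0 < s" and "j0 < s" "sat \<alpha> \<Phi>" "\<forall>l < m. \<alpha> (X l) = x i0 j0 ! l" by blast
    then obtain K0 where K0: "hits K0 x i0" "card K0 \<le> card Vs" using sat_small_hitting_set by blast
    obtain K1 where K1: "\<And>i. hits (K1 i) x i" "\<And>i. card (K1 i) \<le> card Vs + 1"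
      using escape_hitting_set[of x] by metis
    define K where "K = K1(i0 := K0)"
    have "(\<Sum>i<s. card (K i)) < (\<Sum>i<s. card Vs + 1)"
    proof (rule sum_strict_mono_ex1)
      show "\<forall>i \<in> {..<s}. card (K i) \<le> card Vs + 1" using K0 K1 by (auto simp: K_def)
      show "\<exists>i \<in> {..<s}. card (K i) < card Vs + 1" using K0 i0 by (auto simp: K_def)
    qed simp
    then have "(\<Sum>i<s. card (K i)) < s * (card Vs + 1)" by simp
    moreover have "\<forall>i < s. hits (K i) x i" using K0 K1 by (simp add: K_def)
    ultimately show "\<exists>K. (\<forall>i < s. hits (K i) x i) \<and> (\<Sum>i<s. card (K i)) < s * (card Vs + 1)" by blast
  qed
qed

end

section \<open>Templates\<close>

lemma count_list_conv_card: "count_list xs y = card {i. i < length xs \<and> xs ! i = y}"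
  unfolding count_list_eq_length_filter length_filter_conv_card by (metis (mono_tags))

text \<open>\<open>Yf x\<close> stands for the input of the compression. A bit and its complement
  stem from the arcs to the two polarities of a clause, exactly one of which is present. The bits of
  one string occur in order because the verifier reads its input only from left to right.\<close>

locale template =
  fixes s m N :: nat and Yf :: "(nat \<Rightarrow> nat \<Rightarrow> bool list) \<Rightarrow> bool list" and bp :: "nat \<Rightarrow> nat \<Rightarrow> nat \<Rightarrow> nat"
  assumes len: "\<And>x. length (Yf x) = N"
    and bp_less: "\<And>i j l. i < s \<Longrightarrow> j < s \<Longrightarrow> l < m \<Longrightarrow> Suc (bp i j l) < N"
    and bit: "\<And>x i j l. i < s \<Longrightarrow> j < s \<Longrightarrow> l < m \<Longrightarrow> Yf x ! bp i j l = x i j ! l"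
    and nbit: "\<And>x i j l. i < s \<Longrightarrow> j < s \<Longrightarrow> l < m \<Longrightarrow> Yf x ! Suc (bp i j l) = (\<not> x i j ! l)"
    and inj: "\<And>i j l i' j' l'. i < s \<Longrightarrow> j < s \<Longrightarrow> l < m \<Longrightarrow> i' < s \<Longrightarrow> j' < s \<Longrightarrow> l' < m \<Longrightarrow>
      bp i j l = bp i' j' l' \<Longrightarrow> i = i' \<and> j = j' \<and> l = l'"
    and sep: "\<And>i j l i' j' l'. i < s \<Longrightarrow> j < s \<Longrightarrow> l < m \<Longrightarrow> i' < s \<Longrightarrow> j' < s \<Longrightarrow> l' < m \<Longrightarrow>
      bp i j l \<noteq> Suc (bp i' j' l')"
    and mono: "\<And>i j l l'. i < s \<Longrightarrow> j < s \<Longrightarrow> l < l' \<Longrightarrow> l' < m \<Longrightarrow> bp i j l < bp i j l'"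
    and other: "\<And>x x' q. q < N \<Longrightarrow> (\<And>i j l. i < s \<Longrightarrow> j < s \<Longrightarrow> l < m \<Longrightarrow> q \<noteq> bp i j l \<and> q \<noteq> Suc (bp i j l)) \<Longrightarrow>
      Yf x ! q = Yf x' ! q"
begin

definition bits :: "nat set" where "bits = {bp i j l | i j l. i < s \<and> j < s \<and> l < m}"

text \<open>The string at \<open>(i0, j0)\<close> is taken from the input, while all other strings
  are left to the certificate. The constant bits are read off from an arbitrary tuple, here that of
  empty words, since \<open>other\<close> makes them the same for every tuple.\<close>

definition tsym :: "nat \<Rightarrow> nat \<Rightarrow> nat \<Rightarrow> nat" where
  "tsym i0 j0 q = (if \<exists>l < m. q = bp i0 j0 l then 4 else if q \<in> bits then 3
     else if q \<in> Suc ` bits then 5 else bit_sym (Yf (\<lambda>_ _. []) ! q))"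

definition tmpl :: "nat \<Rightarrow> nat \<Rightarrow> nat list" where
  "tmpl i0 j0 = map (tsym i0 j0) [0..<N]"

lemma tmpl_set: "set (tmpl i0 j0) \<subseteq> {1..5}"
  by (auto simp: tmpl_def tsym_def bit_sym_def)

lemma tmpl_nth: "length (tmpl i0 j0) = N" "q < N \<Longrightarrow> tmpl i0 j0 ! q = tsym i0 j0 q"
  by (simp_all add: tmpl_def)

lemma tsym_4: "tsym i0 j0 q = 4 \<longleftrightarrow> (\<exists>l < m. q = bp i0 j0 l)"
  by (auto simp: tsym_def bit_sym_def)

text \<open>By \<open>mono\<close>, the \<open>4\<close>s before the position of bit
  \<open>l\<close> are those of the earlier bits, so the head on the input stands at
  \<open>l\<close> there.\<close>

lemma count_before:
  assumes "i0 < s" "j0 < s" "l \<le> m" "\<And>l'. l' < m \<Longrightarrow> bp i0 j0 l' < q \<longleftrightarrow> l' < l" "q \<le> N"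
  shows "count_list (take q (tmpl i0 j0)) 4 = l"
proof -
  have "{i. i < length (take q (tmpl i0 j0)) \<and> take q (tmpl i0 j0) ! i = 4} = bp i0 j0 ` {..<l}"
  proof (intro set_eqI iffI)
    fix i assume "i \<in> {i. i < length (take q (tmpl i0 j0)) \<and> take q (tmpl i0 j0) ! i = 4}"
    then have "i < q" "tsym i0 j0 i = 4" using assms(5) by (auto simp: tmpl_nth)
    then show "i \<in> bp i0 j0 ` {..<l}" using assms(4) by (auto simp: tsym_4)
  next
    fix i assume "i \<in> bp i0 j0 ` {..<l}"
    then obtain l' where l': "l' < l" "i = bp i0 j0 l'" by blast
    then have "i < q" "l' < m" using assms(3,4) by simp_all
    then show "i \<in> {i. i < length (take q (tmpl i0 j0)) \<and> take q (tmpl i0 j0) ! i = 4}"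
      using l'(2) assms(5) tsym_4[of i0 j0 i] by (auto simp: tmpl_nth)
  qed
  moreover have "inj_on (bp i0 j0) {..<l}"
    using inj assms(1-3) by (auto simp: inj_on_def)
  ultimately show ?thesis unfolding count_list_conv_card by (simp add: card_image)
qed

lemma bp_less_iff:
  assumes "i0 < s" "j0 < s" "l < m" "l' < m"
  shows "bp i0 j0 l' < bp i0 j0 l \<longleftrightarrow> l' < l"
  using mono[OF assms(1,2), of l l'] mono[OF assms(1,2), of l' l] assms(3,4)
  by (cases l l' rule: linorder_cases) auto

lemma tmpl_count: "i0 < s \<Longrightarrow> j0 < s \<Longrightarrow> count_list (tmpl i0 j0) 4 = m"
  using count_before[of i0 j0 m N] bp_less[of i0 j0] by (auto simp: tmpl_nth dest: Suc_lessD)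

text \<open>A certificate amounts to a tuple with \<open>z\<close> at position
  \<open>(i0, j0)\<close>: conversely, the tuple is recovered by reading \<open>Y\<close> at the
  positions \<open>bp i j l\<close>.\<close>

lemma fits_tmpl:
  assumes "i0 < s" "j0 < s" "length z = m"
  shows "fits (tmpl i0 j0) z Y \<longleftrightarrow>
    (\<exists>x. (\<forall>i < s. \<forall>j < s. length (x i j) = m) \<and> x i0 j0 = z \<and> Y = Yf x)"
proof
  assume f: "fits (tmpl i0 j0) z Y"
  then have lY: "length Y = N" by (simp add: fits_def tmpl_nth)
  have ok: "symbol_ok (tsym i0 j0 q) (z ! count_list (take q (tmpl i0 j0)) 4) (Y ! q)
      (if q = 0 then False else Y ! (q - 1))" if "q < N" for q
    using f that by (simp add: fits_def tmpl_nth)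
  define x where "x i j = map (\<lambda>l. Y ! bp i j l) [0..<m]" for i j
  have "x i0 j0 = z"
  proof (rule nth_equalityI)
    show "length (x i0 j0) = length z" using assms(3) by (simp add: x_def)
    fix l assume "l < length (x i0 j0)"
    then have l: "l < m" by (simp add: x_def)
    have q: "bp i0 j0 l < N" using bp_less[OF assms(1,2) l] by simp
    have "tsym i0 j0 (bp i0 j0 l) = 4" using l by (auto simp: tsym_4)
    moreover have "count_list (take (bp i0 j0 l) (tmpl i0 j0)) 4 = l"
      using count_before[OF assms(1,2), of l "bp i0 j0 l"] bp_less_iff[OF assms(1,2) l] l q by simp
    ultimately have "Y ! bp i0 j0 l = z ! l" using ok[OF q] by (simp add: symbol_ok_def)
    then show "x i0 j0 ! l = z ! l" using l by (simp add: x_def)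
  qed
  moreover have "Y = Yf x"
  proof (rule nth_equalityI)
    show "length Y = length (Yf x)" by (simp add: lY len)
    fix q assume "q < length Y"
    then have q: "q < N" by (simp add: lY)
    show "Y ! q = Yf x ! q"
    proof (cases "q \<in> bits \<or> q \<in> Suc ` bits")
      case False
      then have n: "q \<noteq> bp i j l \<and> q \<noteq> Suc (bp i j l)" if "i < s" "j < s" "l < m" for i j l
      proof -
        have "bp i j l \<in> bits" using that by (auto simp: bits_def)
        then show ?thesis using False by blast
      qed
      have "tsym i0 j0 q = bit_sym (Yf (\<lambda>_ _. []) ! q)"
        using False n[OF assms(1,2)] by (auto simp: tsym_def)
      then have "Y ! q = Yf (\<lambda>_ _. []) ! q" using ok[OF q] by (auto simp: symbol_ok_def bit_sym_def split: if_splits)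
      also have "\<dots> = Yf x ! q" by (rule other[OF q]) (use n in blast)
      finally show ?thesis .
    next
      case True
      then consider i j l where "i < s" "j < s" "l < m" "q = bp i j l" | i j l where "i < s" "j < s" "l < m" "q = Suc (bp i j l)"
        by (auto simp: bits_def)
      then show ?thesis
      proof cases
        case 1
        then show ?thesis by (simp add: bit x_def)
      next
        case 2
        have "q \<notin> bits"
        proof
          assume "q \<in> bits"
          then obtain i' j' l' where "i' < s" "j' < s" "l' < m" "q = bp i' j' l'" by (auto simp: bits_def)
          then show False using sep[OF _ _ _ 2(1-3), of i' j' l'] 2(4) by simp
        qed
        moreover have "\<nexists>l. l < m \<and> q = bp i0 j0 l" using \<open>q \<notin> bits\<close> assms(1,2) by (auto simp: bits_def)
        moreover have "q \<in> Suc ` bits" using 2 by (auto simp: bits_def)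
        ultimately have "tsym i0 j0 q = 5" by (auto simp: tsym_def)
        then have "Y ! q = (\<not> Y ! bp i j l)" using ok[OF q] 2(4) by (auto simp: symbol_ok_def)
        then show ?thesis using 2 by (simp add: nbit x_def)
      qed
    qed
  qed
  moreover have "\<forall>i < s. \<forall>j < s. length (x i j) = m" by (simp add: x_def)
  ultimately show "\<exists>x. (\<forall>i < s. \<forall>j < s. length (x i j) = m) \<and> x i0 j0 = z \<and> Y = Yf x" by blast
next
  assume "\<exists>x. (\<forall>i < s. \<forall>j < s. length (x i j) = m) \<and> x i0 j0 = z \<and> Y = Yf x"
  then obtain x where x: "x i0 j0 = z" and Y: "Y = Yf x" by blast
  have "symbol_ok (tsym i0 j0 q) (z ! count_list (take q (tmpl i0 j0)) 4) (Y ! q)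
      (if q = 0 then False else Y ! (q - 1))" if q: "q < N" for q
  proof -
    consider (4) l where "l < m" "q = bp i0 j0 l" | (3) "tsym i0 j0 q = 3"
      | (5) i j l where "i < s" "j < s" "l < m" "q = Suc (bp i j l)" "tsym i0 j0 q = 5"
      | (o) "\<forall>i j l. i < s \<longrightarrow> j < s \<longrightarrow> l < m \<longrightarrow> q \<noteq> bp i j l \<and> q \<noteq> Suc (bp i j l)"
         "tsym i0 j0 q = bit_sym (Yf (\<lambda>_ _. []) ! q)"
    proof -
      assume t: "\<And>l. l < m \<Longrightarrow> q = bp i0 j0 l \<Longrightarrow> thesis" "tsym i0 j0 q = 3 \<Longrightarrow> thesis"
        "\<And>i j l. i < s \<Longrightarrow> j < s \<Longrightarrow> l < m \<Longrightarrow> q = Suc (bp i j l) \<Longrightarrow> tsym i0 j0 q = 5 \<Longrightarrow> thesis"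
        "\<forall>i j l. i < s \<longrightarrow> j < s \<longrightarrow> l < m \<longrightarrow> q \<noteq> bp i j l \<and> q \<noteq> Suc (bp i j l) \<Longrightarrow>
           tsym i0 j0 q = bit_sym (Yf (\<lambda>_ _. []) ! q) \<Longrightarrow> thesis"
      show thesis
      proof (cases "\<exists>l < m. q = bp i0 j0 l")
        case True
        then show ?thesis using t(1) by blast
      next
        case n4: False
        show ?thesis
        proof (cases "q \<in> bits")
          case True
          then show ?thesis using t(2) n4 by (simp add: tsym_def)
        next
          case nb: False
          show ?thesis
          proof (cases "q \<in> Suc ` bits")
            case True
            then obtain i j l where "i < s" "j < s" "l < m" "q = Suc (bp i j l)" by (auto simp: bits_def)
            moreover have "tsym i0 j0 q = 5" using n4 nb True by (simp add: tsym_def)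
            ultimately show ?thesis using t(3) by blast
          next
            case False
            have "tsym i0 j0 q = bit_sym (Yf (\<lambda>_ _. []) ! q)"
              using n4 nb False by (simp only: tsym_def if_False)
            moreover have "\<forall>i j l. i < s \<longrightarrow> j < s \<longrightarrow> l < m \<longrightarrow> q \<noteq> bp i j l \<and> q \<noteq> Suc (bp i j l)"
            proof (intro allI impI)
              fix i j l assume "i < s" "j < s" "l < m"
              then have "bp i j l \<in> bits" by (auto simp: bits_def)
              then show "q \<noteq> bp i j l \<and> q \<noteq> Suc (bp i j l)" using nb False by blast
            qed
            ultimately show ?thesis using t(4) by blast
          qed
        qed
      qed
    qed
    then show ?thesis
    proof cases
      case 4
      have "count_list (take q (tmpl i0 j0)) 4 = l"
        using count_before[OF assms(1,2), of l q] bp_less_iff[OF assms(1,2) 4(1)] 4 q by simp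
      moreover have "tsym i0 j0 q = 4" using 4 by (auto simp: tsym_4)
      ultimately show ?thesis using bit[OF assms(1,2) 4(1), of x] 4 x Y by (simp add: symbol_ok_def)
    next
      case 3
      then show ?thesis by (simp add: symbol_ok_def)
    next
      case 5
      then show ?thesis using bit[OF 5(1-3), of x] nbit[OF 5(1-3), of x] Y by (simp add: symbol_ok_def)
    next
      case o
      have "Y ! q = Yf (\<lambda>_ _. []) ! q" unfolding Y by (rule other[OF q]) (use o(1) in blast)
      then show ?thesis using o(2) by (auto simp: symbol_ok_def bit_sym_def)
    qed
  qed
  note ok = this
  show "fits (tmpl i0 j0) z Y"
    unfolding fits_def tmpl_nth(1)
  proof (intro conjI allI impI)
    show "length Y = N" by (simp add: Y len)
    fix q assume q: "q < N"
    show "symbol_ok (tmpl i0 j0 ! q) (z ! count_list (take q (tmpl i0 j0)) 4) (Y ! q)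
      (if q = 0 then False else Y ! (q - 1))"
      unfolding tmpl_nth(2)[OF q] by (rule ok[OF q])
  qed
qed

end

section \<open>The encoded digraphs\<close>

text \<open>Only the vertices that carry input bits need known numbers; the others are numbered
  arbitrarily.\<close>

lemma extend_numbering:
  assumes "finite V" "A \<subseteq> V" "inj_on f A" "f ` A = {..<a}"
  shows "\<exists>g :: 'a \<Rightarrow> nat. bij_betw g V {..<card V} \<and> (\<forall>v \<in> A. g v = f v)"
proof -
  have fA: "finite A" using assms(1,2) finite_subset by blast
  have cA: "card A = a" using card_image[OF assms(3)] assms(4) by simp
  obtain h where h: "bij_betw h (V - A) {0..<card (V - A)}"
    using ex_bij_betw_finite_nat[of "V - A"] assms(1) by blast
  define g where "g v = (if v \<in> A then f v else a + h v)" for v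
  have lt: "f v < a" if "v \<in> A" for v using assms(4) that by blast
  have "inj_on g V"
  proof (rule inj_onI)
    fix u v assume uv: "u \<in> V" "v \<in> V" "g u = g v"
    show "u = v"
    proof (cases "u \<in> A"; cases "v \<in> A")
      assume "u \<in> A" "v \<in> A"
      then show ?thesis using uv(3) assms(3) by (auto simp: g_def dest: inj_onD)
    next
      assume "u \<notin> A" "v \<notin> A"
      then show ?thesis using uv h by (auto simp: g_def bij_betw_def dest: inj_onD)
    qed (use uv(3) lt[of u] lt[of v] in \<open>auto simp: g_def\<close>)
  qed
  moreover have "g ` V \<subseteq> {..<card V}"
  proof
    fix y assume "y \<in> g ` V"
    then obtain v where v: "v \<in> V" "y = g v" by blast
    have cV: "card V = a + card (V - A)" using card_Un_disjoint[of A "V - A"] assms(1,2) fA cA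
      by (metis Diff_disjoint Un_Diff_cancel finite_Diff sup.absorb2)
    show "y \<in> {..<card V}"
    proof (cases "v \<in> A")
      case True
      then show ?thesis using lt[OF True] v cV by (simp add: g_def)
    next
      case False
      then have "h v \<in> {0..<card (V - A)}" using h v by (auto simp: bij_betw_def)
      then show ?thesis using False v cV by (simp add: g_def)
    qed
  qed
  ultimately have "bij_betw g V {..<card V}"
    unfolding bij_betw_def by (metis card_image card_lessThan card_subset_eq finite_lessThan)
  then show ?thesis by (intro exI[of _ g]) (simp add: g_def)
qed

lemma rows_eq:
  "concat (map (\<lambda>u. map (f u) [0..<n]) [0..<k]) = map (\<lambda>p. f (p div n) (p mod n)) [0..<k * n]"
proof (induction k)
  case 0
  then show ?case by simp
next
  case (Suc k)
  have "map (f k) [0..<n] = map (\<lambda>p. f (p div n) (p mod n)) [k * n..<k * n + n]"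
    by (rule nth_equalityI) auto
  moreover have "[0..<Suc k * n] = [0..<k * n] @ [k * n..<k * n + n]"
    using upt_add_eq_append[of 0 "k * n" n] by (simp add: add.commute)
  ultimately show ?case using Suc by simp
qed

fun binary_value :: "bool list \<Rightarrow> nat" where
  "binary_value [] = 0"
| "binary_value (c # bs) = of_bool c + 2 * binary_value bs"

lemma binary_value_binary: "binary_value (binary n) = n"
proof (induction n rule: less_induct)
  case (less n)
  show ?case
  proof (cases "n = 0")
    case True
    then show ?thesis by (subst binary.simps) simp
  next
    case False
    then have "binary_value (binary (n div 2)) = n div 2" using less by simp
    then show ?thesis using False by (subst binary.simps) (simp add: odd_two_times_div_two_succ)
  qed
qed

text \<open>Membership in \<open>directed_linear_spanner\<close> only says that some instance has
  the given code, so the code has to determine the digraph and the number.\<close>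

lemma instance_enc_inj:
  assumes "input_digraph D" "input_digraph D'" "card (pverts D) = card (pverts D')"
    "instance_enc D k = instance_enc D' k'"
  shows "D = D'" "k = k'"
proof -
  let ?n = "card (pverts D)"
  let ?M = "\<lambda>D. map (\<lambda>p. (p div ?n, p mod ?n) \<in> parcs D) [0..<?n * ?n]"
  have e: "?M D @ binary k = ?M D' @ binary k'"
    using assms(4) unfolding instance_enc_def Let_def assms(3)[symmetric]
      rows_eq[of "\<lambda>u v. (u, v) \<in> parcs D"] rows_eq[of "\<lambda>u v. (u, v) \<in> parcs D'"] by simp
  then have M: "?M D = ?M D'" and "binary k = binary k'" by (auto simp: append_eq_append_conv)
  then show "k = k'" by (metis binary_value_binary)
  have v: "pverts D = {..<?n}" "pverts D' = {..<?n}" using assms(1-3) by (auto simp: input_digraph_def)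
  have sub: "parcs D \<subseteq> {..<?n} \<times> {..<?n}" "parcs D' \<subseteq> {..<?n} \<times> {..<?n}"
    using assms(1,2) v unfolding input_digraph_def pair_digraph_def pair_fin_digraph_def pair_wf_digraph_def
    by fastforce+
  have "(a, c) \<in> parcs D \<longleftrightarrow> (a, c) \<in> parcs D'" if "a < ?n" "c < ?n" for a c
  proof -
    have lt: "a * ?n + c < ?n * ?n"
    proof -
      have "a * ?n + c < Suc a * ?n" using that(2) by simp
      also have "\<dots> \<le> ?n * ?n" using that(1) by (intro mult_le_mono1) simp
      finally show ?thesis .
    qed
    have "?M D ! (a * ?n + c) = ?M D' ! (a * ?n + c)" by (simp only: M)
    then show ?thesis using lt that by simp
  qed
  then have "parcs D = parcs D'" using sub by auto
  then show "D = D'" using v by simp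
qed

locale spanner_instance = or_gadget vars \<Phi> X m s
  for vars :: "'v set" and \<Phi> X m s +
  fixes b :: nat
  assumes b: "b \<ge> 2"
begin

lemmas gad = gadget[OF b]

definition W :: "'v or_vertex set" where "W = gadget.V P C s b"
definition arcs :: "(nat \<Rightarrow> nat \<Rightarrow> bool list) \<Rightarrow> 'v or_vertex rel" where "arcs x = gadget.E P C s (Cu x) lits b"
definition n :: nat where "n = card W"

lemma finite_W: "finite W"
  unfolding W_def by (rule gadget.finite_V[OF gad])

lemma in_W_iff: "Src i \<in> W \<longleftrightarrow> i < s" "Cls c \<in> W \<longleftrightarrow> c \<in> C"
  unfolding W_def by (simp_all add: gadget.in_V_iff[OF gad])

lemma arcs_subset: "arcs x \<subseteq> W \<times> W"
  unfolding arcs_def W_def by (rule gadget.E_subset[OF gad])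

lemma bit_arc: "(Src i, Cls (Inr (j, l, \<sigma>))) \<in> arcs x \<longleftrightarrow> i < s \<and> j < s \<and> l < m \<and> \<sigma> = x i j ! l"
  unfolding arcs_def gadget.E_def[OF gad] gadget.opt_def[OF gad] gadget.fixed_def[OF gad]
  by (auto simp: Cu_def)

lemma other_arc:
  assumes "(u, v) \<in> arcs x" "\<And>i j l \<sigma>. i < s \<Longrightarrow> j < s \<Longrightarrow> l < m \<Longrightarrow> u = Src i \<Longrightarrow> v = Cls (Inr (j, l, \<sigma>)) \<Longrightarrow> False"
  shows "(u, v) \<in> arcs x'"
proof -
  have E: "arcs x = gadget.fixed P C s lits b \<union> gadget.opt s (\<lambda>_. P) (Cu x)" for x
    unfolding arcs_def gadget.E_def[OF gad] ..
  have o: "gadget.opt s (\<lambda>_. P) (Cu x) = {(Src i, Lit p) | i p. i < s \<and> p \<in> P} \<union> {(Src i, Cls c) | i c. i < s \<and> c \<in> Cu x i}" for x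
    unfolding gadget.opt_def[OF gad] ..
  consider "(u, v) \<in> gadget.fixed P C s lits b" | i p where "u = Src i" "v = Lit p" "i < s" "p \<in> P"
    | i c where "u = Src i" "v = Cls c" "i < s" "c \<in> Cu x i"
    using assms(1) unfolding E o by auto
  then show ?thesis
  proof cases
    case 3
    from 3(4) consider A where "c = Inl A" "A \<in> base" | j l where "c = Inr (j, l, x i j ! l)" "j < s" "l < m"
      unfolding Cu_def by auto
    then show ?thesis
    proof cases
      case 1
      then have "c \<in> Cu x' i" by (simp add: Cu_def)
      then show ?thesis unfolding E o using 3 by auto
    next
      case 2
      then show ?thesis using assms(2)[of i j l "x i j ! l"] 3 by simp
    qed
  qed (auto simp: E o)
qed

section \<open>Numbering of the vertices\<close>

definition bit_vertices :: "'v or_vertex set" where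
  "bit_vertices = Src ` {..<s} \<union> (\<lambda>t. Cls (Inr t)) ` ({..<s} \<times> {..<m} \<times> (UNIV :: bool set))"

text \<open>The two polarities of a clause get consecutive numbers, so in row \<open>i\<close> of
  the adjacency matrix a bit is directly followed by its complement, as symbol \<open>5\<close>
  demands. Numbers increase with \<open>l\<close>, which yields the order of the bits.\<close>

definition bit_num :: "'v or_vertex \<Rightarrow> nat" where
  "bit_num v = (case v of Src i \<Rightarrow> i
     | Cls c \<Rightarrow> (case c of Inr (j, l, \<sigma>) \<Rightarrow> s + 2 * (j * m + l) + (if \<sigma> then 0 else 1) | _ \<Rightarrow> 0) | _ \<Rightarrow> 0)"

lemma pos_less: "j < s \<Longrightarrow> l < m \<Longrightarrow> 2 * (j * m + l) + 1 < 2 * s * m"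
proof -
  assume a: "j < s" "l < m"
  have "j * m + l + 1 \<le> Suc j * m" using a(2) by simp
  also have "\<dots> \<le> s * m" using a(1) by (intro mult_le_mono1) simp
  finally show ?thesis by simp
qed

lemma pair_num_inj:
  fixes j l j' l' M :: nat
  assumes "j * M + l = j' * M + l'" "l < M" "l' < M"
  shows "j = j' \<and> l = l'"
proof -
  have "(j * M + l) div M = j" "(j' * M + l') div M = j'" using assms(2,3) by auto
  then show ?thesis using assms by simp
qed

lemma bit_num_inj: "inj_on bit_num bit_vertices"
proof (rule inj_onI)
  fix u v assume a: "u \<in> bit_vertices" "v \<in> bit_vertices" "bit_num u = bit_num v"
  have cs: "(\<exists>i < s. u = Src i) \<or> (\<exists>j l \<sigma>. j < s \<and> l < m \<and> u = Cls (Inr (j, l, \<sigma>)))" if "u \<in> bit_vertices" for u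
    using that by (auto simp: bit_vertices_def)
  from cs[OF a(1)] cs[OF a(2)] show "u = v"
  proof (elim disjE exE conjE)
    fix j l \<sigma> j' l' \<sigma>'
    assume u: "j < s" "l < m" "u = Cls (Inr (j, l, \<sigma>))" and v: "j' < s" "l' < m" "v = Cls (Inr (j', l', \<sigma>'))"
    have e: "2 * (j * m + l) + (if \<sigma> then 0 else 1) = 2 * (j' * m + l') + (if \<sigma>' then 0 else 1)"
      using a(3) u v by (simp add: bit_num_def)
    have "\<sigma> = \<sigma>'" "j * m + l = j' * m + l'" using e by (cases \<sigma>; cases \<sigma>'; presburger)+
    then show ?thesis using pair_num_inj[of j m l j' l'] u v by simp
  qed (use a(3) in \<open>auto simp: bit_num_def\<close>)
qed

lemma bit_num_image: "bit_num ` bit_vertices = {..<s + 2 * s * m}"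
proof (rule card_subset_eq)
  show "finite {..<s + 2 * s * m}" by simp
  show "bit_num ` bit_vertices \<subseteq> {..<s + 2 * s * m}"
  proof
    fix y assume "y \<in> bit_num ` bit_vertices"
    then consider i where "i < s" "y = i" | j l \<sigma> where "j < s" "l < m" "y = s + 2 * (j * m + l) + (if \<sigma> then 0 else 1)"
      by (auto simp: bit_vertices_def bit_num_def)
    then show "y \<in> {..<s + 2 * s * m}"
    proof cases
      case 2
      then show ?thesis using pos_less[of j l] by (simp split: if_splits)
    qed simp
  qed
  have "card bit_vertices = card (Src ` {..<s} :: 'v or_vertex set) +
      card ((\<lambda>t. Cls (Inr t)) ` ({..<s} \<times> {..<m} \<times> (UNIV :: bool set)) :: 'v or_vertex set)"
    unfolding bit_vertices_def by (rule card_Un_disjoint) auto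
  also have "\<dots> = s + 2 * s * m"
    by (subst card_image, simp add: inj_on_def, subst card_image) (auto simp: inj_on_def card_cartesian_product)
  finally show "card (bit_num ` bit_vertices) = card {..<s + 2 * s * m}"
    using card_image[OF bit_num_inj] by simp
qed

definition num :: "'v or_vertex \<Rightarrow> nat" where
  "num = (SOME g. bij_betw g W {..<n} \<and> (\<forall>v \<in> bit_vertices. g v = bit_num v))"

lemma num: "bij_betw num W {..<n}" "\<And>v. v \<in> bit_vertices \<Longrightarrow> num v = bit_num v"
proof -
  have "bit_vertices \<subseteq> W" by (auto simp: bit_vertices_def in_W_iff C_def)
  then have "\<exists>g. bij_betw g W {..<n} \<and> (\<forall>v \<in> bit_vertices. g v = bit_num v)"
    unfolding n_def by (rule extend_numbering[OF finite_W _ bit_num_inj bit_num_image])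
  from someI_ex[OF this] show "bij_betw num W {..<n}" "\<And>v. v \<in> bit_vertices \<Longrightarrow> num v = bit_num v"
    unfolding num_def by blast+
qed

lemma n_ge: "s + 2 * s * m \<le> n"
proof -
  have "bit_vertices \<subseteq> W" by (auto simp: bit_vertices_def in_W_iff C_def)
  then have "card bit_vertices \<le> n" unfolding n_def by (rule card_mono[OF finite_W])
  then show ?thesis using card_image[OF bit_num_inj] bit_num_image by simp
qed

lemma num_Src: "i < s \<Longrightarrow> num (Src i) = i"
  and num_bit: "j < s \<Longrightarrow> l < m \<Longrightarrow> num (Cls (Inr (j, l, \<sigma>))) = s + 2 * (j * m + l) + (if \<sigma> then 0 else 1)"
  by (subst num(2); auto simp: bit_vertices_def bit_num_def)+

definition D :: "(nat \<Rightarrow> nat \<Rightarrow> bool list) \<Rightarrow> nat pair_pre_digraph" where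
  "D x = \<lparr>pverts = {..<n}, parcs = map_prod num num ` arcs x\<rparr>"

lemma num_inj: "inj_on num W" and num_image: "num ` W = {..<n}"
  using num(1) by (auto simp: bij_betw_def)

lemma num_arc:
  assumes "u \<in> W" "v \<in> W"
  shows "(num u, num v) \<in> parcs (D x) \<longleftrightarrow> (u, v) \<in> arcs x"
  using relpow_image[OF num_inj arcs_subset[of x] assms, of 1] by (simp add: D_def)

lemma acyclic_image:
  assumes "acyclic (arcs x)"
  shows "acyclic (parcs (D x))"
  unfolding acyclic_def
proof (intro allI notI)
  fix a assume "(a, a) \<in> (parcs (D x))\<^sup>+"
  then obtain j where j: "j > 0" "(a, a) \<in> parcs (D x) ^^ j" by (auto simp: trancl_power)
  then obtain y where "(a, y) \<in> parcs (D x)" by (metis gr0_conv_Suc relpow_Suc_D2)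
  then obtain u where u: "u \<in> W" "a = num u" using arcs_subset[of x] by (auto simp: D_def)
  have "(u, u) \<in> arcs x ^^ j" using j(2) relpow_image[OF num_inj arcs_subset[of x] u(1) u(1), of j] u(2) by (simp add: D_def)
  then have "(u, u) \<in> (arcs x)\<^sup>+" using j(1) by (auto simp: trancl_power)
  then show False using assms by (auto simp: acyclic_def)
qed

lemma input_digraph_D: "input_digraph (D x)" and acyclic_D: "acyclic (parcs (D x))" and card_D: "card (pverts (D x)) = n"
proof -
  show ac: "acyclic (parcs (D x))" by (rule acyclic_image) (unfold arcs_def, rule gadget.acyclic_E[OF gad])
  have sub: "parcs (D x) \<subseteq> {..<n} \<times> {..<n}"
    using arcs_subset[of x] num_image by (auto simp: D_def)
  have fin: "finite (parcs (D x))" using sub by (rule finite_subset) simp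
  have nl: "u \<noteq> v" if "(u, v) \<in> parcs (D x)" for u v
    using that ac unfolding acyclic_def by blast
  show "card (pverts (D x)) = n" by (simp add: D_def)
  have "pair_digraph (D x)"
  proof
    fix e assume e: "e \<in> parcs (D x)"
    then show "fst e \<in> pverts (D x)" "snd e \<in> pverts (D x)" using sub by (auto simp: D_def)
    show "fst e \<noteq> snd e" using nl[of "fst e" "snd e"] e by simp
  qed (use fin in \<open>auto simp: D_def\<close>)
  then show "input_digraph (D x)" by (simp add: input_digraph_def D_def)
qed

lemma in_dag_instances: "(instance_enc (D x) k, n) \<in> dag_instances"
  unfolding dag_instances_def
  by (intro CollectI exI[of _ "D x"] exI[of _ k] conjI)
    (simp_all add: input_digraph_D acyclic_D card_D k_pos)

lemma card_map_prod_num: "A \<subseteq> W \<times> W \<Longrightarrow> card (map_prod num num ` A) = card A"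
  by (rule card_image) (rule inj_on_subset[OF map_prod_inj_on[OF num_inj num_inj]])

theorem in_directed_linear_spanner_iff:
  assumes g: "f\<^sub>\<beta> 0 \<ge> 0" "\<And>d. d \<ge> 1 \<Longrightarrow> real (b + d - 1) \<le> f\<^sub>\<alpha> d * real d + f\<^sub>\<beta> d"
    "\<And>k. real k \<le> f\<^sub>\<alpha> 1 + f\<^sub>\<beta> 1 \<Longrightarrow> k \<le> b"
  shows "(instance_enc (D x) k, n) \<in> directed_linear_spanner f\<^sub>\<alpha> f\<^sub>\<beta> \<longleftrightarrow>
    (\<exists>i < s. \<exists>j < s. \<exists>\<alpha>. sat \<alpha> \<Phi> \<and> (\<forall>l < m. \<alpha> (X l) = x i j ! l))"
proof -
  let ?g = "\<lambda>d. f\<^sub>\<alpha> d * real d + f\<^sub>\<beta> d"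
  have wf: "pair_wf_digraph (D x)"
    using input_digraph_D[of x] by (simp add: input_digraph_def pair_digraph_def pair_fin_digraph_def)
  have "(instance_enc (D x) k, n) \<in> directed_linear_spanner f\<^sub>\<alpha> f\<^sub>\<beta> \<longleftrightarrow>
     (\<exists>H. linear_spanner f\<^sub>\<alpha> f\<^sub>\<beta> (D x) H \<and> card (parcs H) + k \<le> card (parcs (D x)))"
  proof
    assume "(instance_enc (D x) k, n) \<in> directed_linear_spanner f\<^sub>\<alpha> f\<^sub>\<beta>"
    then obtain D' k' where D': "instance_enc (D x) k = instance_enc D' k'" "n = card (pverts D')" "input_digraph D'"
      "\<exists>H. linear_spanner f\<^sub>\<alpha> f\<^sub>\<beta> D' H \<and> card (parcs H) + k' \<le> card (parcs D')"
      unfolding directed_linear_spanner_def by blast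
    have "D x = D'" "k = k'"
      using instance_enc_inj[OF input_digraph_D D'(3) _ D'(1)] D'(2) card_D by auto
    then show "\<exists>H. linear_spanner f\<^sub>\<alpha> f\<^sub>\<beta> (D x) H \<and> card (parcs H) + k \<le> card (parcs (D x))" using D'(4) by simp
  next
    assume h: "\<exists>H. linear_spanner f\<^sub>\<alpha> f\<^sub>\<beta> (D x) H \<and> card (parcs H) + k \<le> card (parcs (D x))"
    show "(instance_enc (D x) k, n) \<in> directed_linear_spanner f\<^sub>\<alpha> f\<^sub>\<beta>"
      unfolding directed_linear_spanner_def
      by (rule CollectI, rule exI[of _ "D x"], rule exI[of _ k])
        (use h in \<open>simp add: input_digraph_D card_D k_pos\<close>)
  qed
  also have "\<dots> \<longleftrightarrow> (\<exists>H. H \<subseteq> arcs x \<and> stretch_ok ?g W (arcs x) H \<and> card H + k \<le> card (arcs x))"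
  proof
    assume "\<exists>H. linear_spanner f\<^sub>\<alpha> f\<^sub>\<beta> (D x) H \<and> card (parcs H) + k \<le> card (parcs (D x))"
    then obtain H :: "nat pair_pre_digraph" where H: "parcs H \<subseteq> parcs (D x)" "stretch_ok ?g (pverts (D x)) (parcs (D x)) (parcs H)"
      "card (parcs H) + k \<le> card (parcs (D x))"
      unfolding linear_spanner_iff[OF wf] by blast
    then obtain H' where H': "H' \<subseteq> arcs x" "parcs H = map_prod num num ` H'"
      unfolding D_def by (auto simp: subset_image_iff)
    have "H' \<subseteq> W \<times> W" using H'(1) arcs_subset by blast
    then have "stretch_ok ?g W (arcs x) H'" "card H' + k \<le> card (arcs x)"
      using H(2,3) stretch_ok_image[OF num_inj arcs_subset[of x], of H' ?g] card_map_prod_num arcs_subset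
      by (simp_all add: D_def num_image H'(2))
    then show "\<exists>H. H \<subseteq> arcs x \<and> stretch_ok ?g W (arcs x) H \<and> card H + k \<le> card (arcs x)" using H'(1) by blast
  next
    assume "\<exists>H. H \<subseteq> arcs x \<and> stretch_ok ?g W (arcs x) H \<and> card H + k \<le> card (arcs x)"
    then obtain H where H: "H \<subseteq> arcs x" "stretch_ok ?g W (arcs x) H" "card H + k \<le> card (arcs x)" by blast
    have "H \<subseteq> W \<times> W" using H(1) arcs_subset by blast
    then have "linear_spanner f\<^sub>\<alpha> f\<^sub>\<beta> (D x) \<lparr>pverts = {..<n}, parcs = map_prod num num ` H\<rparr>"
      "card (map_prod num num ` H) + k \<le> card (parcs (D x))"
      unfolding linear_spanner_iff[OF wf]
      using H stretch_ok_image[OF num_inj arcs_subset[of x], of H ?g] card_map_prod_num arcs_subset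
      by (auto simp: D_def num_image)
    then show "\<exists>H. linear_spanner f\<^sub>\<alpha> f\<^sub>\<beta> (D x) H \<and> card (parcs H) + k \<le> card (parcs (D x))"
      by (metis pair_pre_digraph.select_convs(2))
  qed
  also have "\<dots> \<longleftrightarrow> (\<exists>K. (\<forall>i < s. hits (K i) x i) \<and> (\<Sum>i<s. card (K i)) + k \<le> (\<Sum>i<s. card P + card (Cu x i)))"
    unfolding arcs_def W_def hits_def
    by (rule gadget.spanner_iff_hitting[OF gad]) (use g in simp_all)
  also have "\<dots> \<longleftrightarrow> (\<exists>i < s. \<exists>j < s. \<exists>\<alpha>. sat \<alpha> \<Phi> \<and> (\<forall>l < m. \<alpha> (X l) = x i j ! l))"
    by (rule hitting_iff_or)
  finally show ?thesis .
qed

lemma n_le: "n \<le> s + b * card P + card C"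
proof -
  have W: "W = Src ` {..<s} \<union> Lit ` P \<union> (\<lambda>(p, r). Chain p r) ` (P \<times> {..<b - 1}) \<union> Cls ` C"
    unfolding W_def gadget.V_def[OF gad] ..
  have "n \<le> card (Src ` {..<s} :: 'v or_vertex set) + card (Lit ` P :: 'v or_vertex set) +
     card ((\<lambda>(p, r). Chain p r) ` (P \<times> {..<b - 1}) :: 'v or_vertex set) + card (Cls ` C :: 'v or_vertex set)"
    unfolding n_def W by (intro order_trans[OF card_Un_le] add_mono order_refl)
  also have "\<dots> \<le> s + card P + card P * (b - 1) + card C"
    using finite_P finite_C
    by (intro add_mono order_trans[OF card_image_le]) (auto simp: card_cartesian_product)
  also have "\<dots> = s + b * card P + card C" using b by (cases b) (auto simp: algebra_simps)
  finally show ?thesis .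
qed

section \<open>The input of the compression as a template\<close>

definition Y :: "(nat \<Rightarrow> nat \<Rightarrow> bool list) \<Rightarrow> bool list" where
  "Y x = pair_enc (instance_enc (D x) k) (unary n)"

text \<open>The length prefix and separator of \<open>pair_enc\<close>, followed by the number of
  vertices in unary at the start of the instance code.\<close>

definition pre :: "bool list" where
  "pre = replicate (n + 1 + n * n + length (binary k)) True @ [False] @ replicate n True @ [False]"

definition suf :: "bool list" where
  "suf = binary k @ replicate n True"

definition rowbits :: "(nat \<Rightarrow> nat \<Rightarrow> bool list) \<Rightarrow> bool list" where
  "rowbits x = map (\<lambda>p. (p div n, p mod n) \<in> parcs (D x)) [0..<n * n]"

lemma Y_eq: "Y x = pre @ rowbits x @ suf"
proof -
  have "instance_enc (D x) k = replicate n True @ [False] @ rowbits x @ binary k"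
    unfolding instance_enc_def Let_def card_D unary_def rowbits_def
      rows_eq[of "\<lambda>u v. (u, v) \<in> parcs (D x)"] ..
  then show ?thesis by (simp add: Y_def pair_enc_def pre_def suf_def unary_def rowbits_def)
qed

definition bp :: "nat \<Rightarrow> nat \<Rightarrow> nat \<Rightarrow> nat" where
  "bp i j l = length pre + (i * n + (s + 2 * (j * m + l)))"

definition N :: nat where "N = length pre + n * n + length suf"

lemma bp_bounds:
  assumes "i < s" "j < s" "l < m"
  shows "s + 2 * (j * m + l) + 1 < n" "i * n + (s + 2 * (j * m + l)) + 1 < n * n"
proof -
  show 1: "s + 2 * (j * m + l) + 1 < n" using pos_less[OF assms(2,3)] n_ge by simp
  have "i * n + (s + 2 * (j * m + l)) + 1 < Suc i * n" using 1 by simp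
  also have "\<dots> \<le> n * n" using assms(1) n_ge by (intro mult_le_mono1) simp
  finally show "i * n + (s + 2 * (j * m + l)) + 1 < n * n" .
qed

lemma Y_entry:
  assumes "i < s" "v < n"
  shows "Y x ! (length pre + (i * n + v)) \<longleftrightarrow> (i, v) \<in> parcs (D x)"
proof -
  have "i * n + v < Suc i * n" using assms(2) by simp
  also have "\<dots> \<le> n * n" using assms(1) n_ge by (intro mult_le_mono1) simp
  finally have lt: "i * n + v < n * n" .
  then have "Y x ! (length pre + (i * n + v)) = rowbits x ! (i * n + v)"
    by (simp add: Y_eq nth_append rowbits_def)
  also have "\<dots> = ((i, v) \<in> parcs (D x))" using lt assms(2) by (simp add: rowbits_def)
  finally show ?thesis by simp
qed

lemma bit_entry:
  assumes "i < s" "j < s" "l < m"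
  shows "(i, s + 2 * (j * m + l) + (if \<sigma> then 0 else 1)) \<in> parcs (D x) \<longleftrightarrow> \<sigma> = x i j ! l"
proof -
  have "Src i \<in> W" "Cls (Inr (j, l, \<sigma>)) \<in> W" using assms by (auto simp: in_W_iff C_def)
  from num_arc[OF this, of x] show ?thesis
    using assms by (simp add: num_Src num_bit bit_arc)
qed

lemma template_Y: "template s m N Y bp"
proof
  show "length (Y x) = N" for x by (simp add: Y_eq N_def rowbits_def)
next
  fix i j l assume a: "i < s" "j < s" "l < m"
  show "Suc (bp i j l) < N" using bp_bounds(2)[OF a] by (simp add: bp_def N_def)
  show "Y x ! bp i j l = x i j ! l" for x
    using Y_entry[OF a(1), of "s + 2 * (j * m + l)" x] bp_bounds(1)[OF a] bit_entry[OF a, of True x]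
    by (simp add: bp_def)
  have e: "Suc (bp i j l) = length pre + (i * n + (s + 2 * (j * m + l) + 1))" by (simp add: bp_def)
  show "Y x ! Suc (bp i j l) = (\<not> x i j ! l)" for x
    unfolding e using Y_entry[OF a(1), of "s + 2 * (j * m + l) + 1" x] bp_bounds(1)[OF a] bit_entry[OF a, of False x]
    by simp
next
  fix i j l i' j' l'
  assume a: "i < s" "j < s" "l < m" and a': "i' < s" "j' < s" "l' < m"
  show "i = i' \<and> j = j' \<and> l = l'" if e: "bp i j l = bp i' j' l'"
  proof -
    have "i * n + (s + 2 * (j * m + l)) = i' * n + (s + 2 * (j' * m + l'))" using e by (simp add: bp_def)
    then have "i = i' \<and> s + 2 * (j * m + l) = s + 2 * (j' * m + l')"
      by (rule pair_num_inj) (use bp_bounds(1)[OF a] bp_bounds(1)[OF a'] in simp_all)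
    then show ?thesis using pair_num_inj[of j m l j' l'] a(3) a'(3) by simp
  qed
  show "bp i j l \<noteq> Suc (bp i' j' l')"
  proof
    assume "bp i j l = Suc (bp i' j' l')"
    then have "i * n + (s + 2 * (j * m + l)) = i' * n + (s + 2 * (j' * m + l') + 1)" by (simp add: bp_def)
    then have "i = i' \<and> s + 2 * (j * m + l) = s + 2 * (j' * m + l') + 1"
      by (rule pair_num_inj) (use bp_bounds(1)[OF a] bp_bounds(1)[OF a'] in simp_all)
    then have "2 * (j * m + l) = 2 * (j' * m + l') + 1" by simp
    then show False by presburger
  qed
next
  fix i j l l' :: nat assume "l < l'"
  then show "bp i j l < bp i j l'" by (simp add: bp_def)
next
  fix x x' q
  assume q: "q < N" and nb: "\<And>i j l. i < s \<Longrightarrow> j < s \<Longrightarrow> l < m \<Longrightarrow> q \<noteq> bp i j l \<and> q \<noteq> Suc (bp i j l)"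
  have *: "(p div n, p mod n) \<in> parcs (D x')" if p: "q = length pre + p" "p < n * n" "(p div n, p mod n) \<in> parcs (D x)" for p x x'
  proof -
    obtain u v where uv: "(u, v) \<in> arcs x" "p div n = num u" "p mod n = num v" using p(3) by (auto simp: D_def)
    have "(u, v) \<in> arcs x'"
    proof (rule other_arc[OF uv(1)])
      fix i j l \<sigma> assume a: "i < s" "j < s" "l < m" "u = Src i" "v = Cls (Inr (j, l, \<sigma>))"
      have "p = p div n * n + p mod n" by simp
      then have "p = i * n + (s + 2 * (j * m + l) + (if \<sigma> then 0 else 1))"
        unfolding uv(2,3) a(4,5) num_Src[OF a(1)] num_bit[OF a(2,3)] .
      then have "q = bp i j l \<or> q = Suc (bp i j l)" using p(1) by (simp add: bp_def split: if_splits)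
      then show False using nb[OF a(1-3)] by blast
    qed
    then show ?thesis unfolding uv(2,3) by (auto simp: D_def intro: rev_image_eqI)
  qed
  show "Y x ! q = Y x' ! q"
  proof (cases "length pre \<le> q \<and> q < length pre + n * n")
    case True
    then obtain p where p: "q = length pre + p" "p < n * n" by (metis le_Suc_ex nat_add_left_cancel_less)
    have "Y x ! q = ((p div n, p mod n) \<in> parcs (D x))" for x
      using p by (simp add: Y_eq nth_append rowbits_def)
    then show ?thesis using *[OF p] by blast
  next
    case False
    then show ?thesis by (auto simp: Y_eq nth_append rowbits_def)
  qed
qed

lemma N_le: "N \<le> 2 * n * n + 6 * n + 2 * length (binary k) + 4"
  by (simp add: N_def pre_def suf_def)

end

section \<open>Covering the nonmembers\<close>

lemma card_lists_upto: "card {y :: bool list. length y \<le> t} < 2 ^ Suc t" "finite {y :: bool list. length y \<le> t}"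
proof -
  have e: "{y :: bool list. length y \<le> t} = {y. set y \<subseteq> UNIV \<and> length y \<le> t}" by auto
  show "finite {y :: bool list. length y \<le> t}" unfolding e by (rule finite_lists_length_le) simp
  have "card {y :: bool list. length y \<le> t} = (\<Sum>i\<le>t. 2 ^ i)"
    unfolding e by (subst card_lists_length_le) simp_all
  also have "\<dots> < 2 ^ Suc t" by (induction t) auto
  finally show "card {y :: bool list. length y \<le> t} < 2 ^ Suc t" .
qed

text \<open>If every output met less than a quarter of \<open>N\<close> at every position, then the
  tuples with a given output would lie in a product of \<open>s\<^sup>2\<close> such sets and make
  up at most a \<open>1 / 4 ^ (s * s)\<close> fraction of all tuples. There are fewer than
  \<open>2 ^ Suc (s * s) \<le> 4 ^ (s * s)\<close> outputs, too few to account for all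
  tuples.\<close>

lemma one_round:
  fixes N :: "'a set" and G :: "(nat \<Rightarrow> nat \<Rightarrow> 'a) \<Rightarrow> bool list"
  assumes fin: "finite N" and ne: "N \<noteq> {}" and s: "s \<ge> 1"
    and G: "\<And>x. (\<forall>i < s. \<forall>j < s. x i j \<in> N) \<Longrightarrow> length (G x) \<le> s * s"
  shows "\<exists>i0 < s. \<exists>j0 < s. \<exists>y. (\<exists>x. (\<forall>i < s. \<forall>j < s. x i j \<in> N) \<and> G x = y) \<and>
    card N \<le> 4 * card {z \<in> N. \<exists>x. (\<forall>i < s. \<forall>j < s. x i j \<in> N) \<and> x i0 j0 = z \<and> G x = y}"
proof (rule ccontr)
  assume neg: "\<not> ?thesis"
  define I where "I = {..<s} \<times> {..<s}"
  define tup where "tup = (I \<rightarrow>\<^sub>E N)"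
  define g where "g f = G (\<lambda>i j. f (i, j))" for f
  define S where "S y a = {z \<in> N. \<exists>x. (\<forall>i < s. \<forall>j < s. x i j \<in> N) \<and> x (fst a) (snd a) = z \<and> G x = y}" for y a
  have finI: "finite I" and cI: "card I = s * s" by (auto simp: I_def)
  have ftup: "finite tup" unfolding tup_def using finI fin by (simp add: finite_PiE)
  have ctup: "card tup = card N ^ (s * s)" unfolding tup_def using finI by (simp add: card_PiE cI)
  have tupN: "\<forall>i < s. \<forall>j < s. f (i, j) \<in> N" if "f \<in> tup" for f
    using that by (auto simp: tup_def I_def PiE_def Pi_def)
  have lg: "g f \<in> {y. length y \<le> s * s}" if "f \<in> tup" for f
    using G[OF tupN[OF that]] by (simp add: g_def)
  have small: "4 * card (S y a) \<le> card N" if y: "y \<in> g ` tup" and a: "a \<in> I" for y a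
  proof -
    obtain f where "f \<in> tup" "y = g f" using y by blast
    then have "\<exists>x. (\<forall>i < s. \<forall>j < s. x i j \<in> N) \<and> G x = y"
      using tupN by (intro exI[of _ "\<lambda>i j. f (i, j)"]) (auto simp: g_def)
    moreover have "fst a < s" "snd a < s" using a by (auto simp: I_def)
    ultimately have "\<not> card N \<le> 4 * card (S y a)" using neg unfolding S_def by blast
    then show ?thesis by simp
  qed
  have fib: "4 ^ (s * s) * card {f \<in> tup. g f = y} \<le> card N ^ (s * s)" if y: "y \<in> g ` tup" for y
  proof -
    have "{f \<in> tup. g f = y} \<subseteq> PiE I (S y)"
    proof
      fix f assume f: "f \<in> {f \<in> tup. g f = y}"
      have "f a \<in> S y a" if "a \<in> I" for a
      proof -
        have fN: "\<forall>i < s. \<forall>j < s. f (i, j) \<in> N" using tupN f by blast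
        then have "f a \<in> N" using that by (cases a) (auto simp: I_def)
        moreover have "G (\<lambda>i j. f (i, j)) = y" using f by (simp add: g_def)
        ultimately show ?thesis unfolding S_def using fN
          by (intro CollectI conjI exI[of _ "\<lambda>i j. f (i, j)"]) auto
      qed
      then show "f \<in> PiE I (S y)" using f by (auto simp: tup_def PiE_def)
    qed
    moreover have "finite (PiE I (S y))" using finI fin by (intro finite_PiE) (auto simp: S_def)
    ultimately have "card {f \<in> tup. g f = y} \<le> (\<Prod>a\<in>I. card (S y a))"
      using card_mono[of "PiE I (S y)"] finI by (simp add: card_PiE)
    then have "4 ^ (s * s) * card {f \<in> tup. g f = y} \<le> 4 ^ (s * s) * (\<Prod>a\<in>I. card (S y a))" by simp
    also have "\<dots> = (\<Prod>a\<in>I. 4 * card (S y a))" by (simp add: prod.distrib cI)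
    also have "\<dots> \<le> (\<Prod>a\<in>I. card N)" by (intro prod_mono conjI small y) auto
    also have "\<dots> = card N ^ (s * s)" by (simp add: cI)
    finally show ?thesis .
  qed
  have fimg: "finite (g ` tup)" using ftup by simp
  have "tup = (\<Union>y\<in>g ` tup. {f \<in> tup. g f = y})" by auto
  then have "card tup \<le> (\<Sum>y\<in>g ` tup. card {f \<in> tup. g f = y})"
    using card_UN_le[OF fimg, of "\<lambda>y. {f \<in> tup. g f = y}"] by simp
  then have "4 ^ (s * s) * card tup \<le> (\<Sum>y\<in>g ` tup. 4 ^ (s * s) * card {f \<in> tup. g f = y})"
    by (simp add: sum_distrib_left[symmetric])
  also have "\<dots> \<le> (\<Sum>y\<in>g ` tup. card N ^ (s * s))" by (intro sum_mono fib)
  also have "\<dots> = card (g ` tup) * card N ^ (s * s)" by simp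
  finally have le: "4 ^ (s * s) * card tup \<le> card (g ` tup) * card N ^ (s * s)" .
  have "card (g ` tup) \<le> card {y :: bool list. length y \<le> s * s}"
    using lg by (intro card_mono card_lists_upto(2)) blast
  also have "\<dots> < 2 ^ Suc (s * s)" by (rule card_lists_upto(1))
  also have "\<dots> \<le> 2 ^ (2 * (s * s))" using s by (intro power_increasing) auto
  also have "\<dots> = (4 :: nat) ^ (s * s)" by (simp add: power_mult)
  finally have "card (g ` tup) < 4 ^ (s * s)" .
  moreover have "card N ^ (s * s) > 0" using fin ne by (simp add: card_gt_0_iff)
  ultimately have "card (g ` tup) * card N ^ (s * s) < 4 ^ (s * s) * card N ^ (s * s)" by simp
  then show False using le ctup by simp
qed

text \<open>Each round is applied to the words still uncovered, hence the assumption for every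
  nonempty \<open>N'\<close>. It leaves at most three quarters of them, so after \<open>r\<close>
  rounds fewer than one remains.\<close>

lemma greedy_cover:
  assumes "finite N" "3 ^ r * card N < 4 ^ r"
    "\<And>N'. N' \<subseteq> N \<Longrightarrow> N' \<noteq> {} \<Longrightarrow> \<exists>c \<in> good. card N' \<le> 4 * card {z \<in> N'. cov c z}"
  shows "\<exists>cs. length cs \<le> r \<and> set cs \<subseteq> good \<and> (\<forall>z \<in> N. \<exists>c \<in> set cs. cov c z)"
  using assms
proof (induction r arbitrary: N)
  case 0
  then show ?case by (intro exI[of _ "[]"]) simp
next
  case (Suc r)
  show ?case
  proof (cases "N = {}")
    case True
    then show ?thesis by (intro exI[of _ "[]"]) simp
  next
    case False
    obtain c where c: "c \<in> good" "card N \<le> 4 * card {z \<in> N. cov c z}" using Suc.prems(3)[of N] False by auto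
    define N2 where "N2 = {z \<in> N. \<not> cov c z}"
    have "card N = card {z \<in> N. cov c z} + card N2"
    proof -
      have N: "N = {z \<in> N. cov c z} \<union> N2" by (auto simp: N2_def)
      show ?thesis using Suc.prems(1)
        by (subst N, subst card_Un_disjoint) (auto simp: N2_def)
    qed
    then have "4 * card N2 \<le> 3 * card N" using c(2) by simp
    then have "3 ^ r * (4 * card N2) \<le> 3 ^ r * (3 * card N)" by (rule mult_le_mono2)
    also have "\<dots> = 3 ^ Suc r * card N" by simp
    also have "\<dots> < 4 ^ Suc r" by (rule Suc.prems(2))
    finally have lt: "3 ^ r * card N2 < 4 ^ r" by simp
    have "\<exists>cs. length cs \<le> r \<and> set cs \<subseteq> good \<and> (\<forall>z \<in> N2. \<exists>c \<in> set cs. cov c z)"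
    proof (rule Suc.IH[OF _ lt])
      show "finite N2" using Suc.prems(1) by (simp add: N2_def)
      show "\<exists>c \<in> good. card N' \<le> 4 * card {z \<in> N'. cov c z}" if "N' \<subseteq> N2" "N' \<noteq> {}" for N'
        using that Suc.prems(3)[of N'] by (auto simp: N2_def)
    qed
    then obtain cs where "length cs \<le> r" "set cs \<subseteq> good" "\<forall>z \<in> N2. \<exists>c \<in> set cs. cov c z" by blast
    then show ?thesis using c(1) by (intro exI[of _ "c # cs"]) (auto simp: N2_def)
  qed
qed

text \<open>Since \<open>(4 / 3) ^ 3 = 64 / 27 > 2\<close>, three rounds more than halve the
  remaining words, of which there are at most \<open>2 ^ m\<close> at the start.\<close>

lemma rounds_bound: "3 ^ (3 * m + 1) * 2 ^ m < (4 :: nat) ^ (3 * m + 1)"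
proof -
  have "(3 :: nat) ^ (3 * m + 1) * 2 ^ m = 3 * 54 ^ m"
    by (simp add: power_mult power_mult_distrib[symmetric])
  also have "\<dots> < 4 * 64 ^ m"
  proof -
    have "(54 :: nat) ^ m \<le> 64 ^ m" by (rule power_mono) auto
    moreover have "(64 :: nat) ^ m > 0" by simp
    ultimately show ?thesis by linarith
  qed
  also have "\<dots> = 4 ^ (3 * m + 1)" by (simp add: power_mult)
  finally show ?thesis .
qed

text \<open>A linear bound is enough, as the numbers encoded are themselves polynomial in
  \<open>m\<close>.\<close>

lemma length_binary: "length (binary k) \<le> k"
proof (induction k rule: less_induct)
  case (less k)
  show ?case
  proof (cases "k = 0")
    case True
    then show ?thesis by (subst binary.simps) simp
  next
    case False
    then have "length (binary (k div 2)) \<le> k div 2" using less by simp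
    also have "k div 2 < k" using False by simp
    finally show ?thesis using False by (subst binary.simps) simp
  qed
qed

text \<open>For \<open>n \<le> s * q\<close> the output has
  \<open>O((s * q) powr (2 - \<epsilon>))\<close> bits, which is at most \<open>s * s\<close> once a
  small power of \<open>s\<close> exceeds a constant times \<open>q ^ 2\<close>. A power of
  \<open>q + c\<close> achieves this: exponent \<open>2\<close> for \<open>q ^ 2\<close> and one
  more for the constant.\<close>

lemma size_bound:
  fixes sz :: "nat \<Rightarrow> nat"
  assumes O: "(\<lambda>n. real (sz n)) \<in> O(\<lambda>n. real n powr (2 - \<epsilon>))" and \<epsilon>: "\<epsilon> > 0"
  shows "\<exists>c e :: nat. e \<ge> 1 \<and> (\<forall>q s n. q \<ge> 1 \<longrightarrow> s = (q + c) ^ e \<longrightarrow> s \<le> n \<longrightarrow> n \<le> s * q \<longrightarrow> sz n \<le> s * s)"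
proof -
  obtain c where c: "c > 0" "\<forall>\<^sub>F n in at_top. norm (real (sz n)) \<le> c * norm (real n powr (2 - \<epsilon>))"
    using O by (elim landau_o.bigE)
  then obtain n0 where n0: "\<And>n. n \<ge> n0 \<Longrightarrow> real (sz n) \<le> c * real n powr (2 - \<epsilon>)"
    by (auto simp: eventually_at_top_linorder)
  \<comment> \<open>Capping \<open>\<epsilon>\<close> at \<open>1\<close> keeps the exponent
    \<open>2 - d\<close> nonnegative, so that powers are monotone in the base.\<close>
  define d where "d = min \<epsilon> 1"
  have d: "d > 0" "d \<le> 1" "d \<le> \<epsilon>" using \<epsilon> by (auto simp: d_def)
  define e where "e = nat \<lceil>3 / d\<rceil>"
  have e: "real e * d \<ge> 3"
  proof -
    have "real e \<ge> 3 / d" unfolding e_def by (rule real_nat_ceiling_ge)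
    then show ?thesis using d by (simp add: field_simps)
  qed
  then have e1: "e \<ge> 1" by (cases e) auto
  define C where "C = n0 + nat \<lceil>c\<rceil> + 1"
  have C: "real C \<ge> c" "C \<ge> n0"  by (auto simp: C_def) linarith
  have "sz n \<le> s * s" if q: "q \<ge> 1" and s: "s = (q + C) ^ e" and n: "s \<le> n" "n \<le> s * q" for q s n
  proof -
    \<comment> \<open>Together with \<open>s \<le> n\<close> and \<open>C \<ge> n0\<close> this puts
      \<open>n\<close> into the range where the \<open>O\<close>-bound holds.\<close>
    have qC: "q + C \<le> s" using e1 q unfolding s by (intro self_le_power) auto
    have n1: "n \<ge> n0" "n \<ge> 1" "s \<ge> 1" using qC n C(2) q by linarith+
    have "real (sz n) \<le> c * real n powr (2 - \<epsilon>)" by (rule n0[OF n1(1)])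
    also have "\<dots> \<le> c * real n powr (2 - d)"
      using n1 d c by (intro mult_left_mono powr_mono) auto
    also have "\<dots> \<le> c * (real s * real q) powr (2 - d)"
      using n n1 d c by (intro mult_left_mono powr_mono2) (auto simp flip: of_nat_mult)
    also have "\<dots> = c * (real s powr (2 - d) * real q powr (2 - d))"
      by (simp add: powr_mult)
    also have "\<dots> \<le> c * (real s powr (2 - d) * real q powr 2)"
      using q d c by (intro mult_left_mono powr_mono) auto
    also have "\<dots> = real s powr (2 - d) * (c * real q ^ 2)" using q by (simp add: powr_numeral)
    also have "\<dots> \<le> real s powr (2 - d) * real s powr d"
    proof (rule mult_left_mono)
      have "c * real q ^ 2 \<le> real (q + C) * real (q + C) ^ 2"
        using C(1) c(1) by (intro mult_mono power_mono) auto
      also have "\<dots> = real (q + C) ^ 3" by (simp add: power3_eq_cube power2_eq_square)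
      also have "\<dots> = real (q + C) powr 3" using q by (subst powr_numeral) auto
      also have "\<dots> \<le> real (q + C) powr (real e * d)" using e q by (intro powr_mono) auto
      also have "\<dots> = (real (q + C) powr real e) powr d" by (simp add: powr_powr)
      also have "real (q + C) powr real e = real s" unfolding s using q by (subst powr_realpow) auto
      finally show "c * real q ^ 2 \<le> real s powr d" .
    qed simp
    also have "\<dots> = real s powr 2" by (simp add: powr_add[symmetric])
    also have "\<dots> = real (s * s)" using n1(3) by (simp add: powr_numeral power2_eq_square)
    finally show ?thesis by (simp only: of_nat_le_iff)
  qed
  then show ?thesis using e1 by blast
qed

lemma length_blocks_le:
  "(\<And>b. b \<in> set B \<Longrightarrow> length (block b) \<le> c) \<Longrightarrow> length (blocks B) \<le> length B * c"
  by (induction B) (auto simp: blocks_def intro: add_mono)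

lemma compression_imp_coNP_poly:
  fixes f\<^sub>\<alpha> f\<^sub>\<beta> :: "nat \<Rightarrow> real"
  assumes b: "b \<ge> 2" and g: "f\<^sub>\<beta> 0 \<ge> 0" "\<And>d. d \<ge> 1 \<Longrightarrow> real (b + d - 1) \<le> f\<^sub>\<alpha> d * real d + f\<^sub>\<beta> d"
    "\<And>k. real k \<le> f\<^sub>\<alpha> 1 + f\<^sub>\<beta> 1 \<Longrightarrow> k \<le> b"
    and \<epsilon>: "\<epsilon> > 0"
    and compr: "admits_poly_compression dag_instances (directed_linear_spanner f\<^sub>\<alpha> f\<^sub>\<beta>) (\<lambda>n. real n powr (2 - \<epsilon>))"
    and L: "L \<in> NP"
  shows "L \<in> with_poly_advice coNP"
proof -
  obtain R :: language and F and p :: "nat poly" and sz where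
    h: "poly_time F \<and> (\<lambda>n. real (sz n)) \<in> O(\<lambda>n. real n powr (2 - \<epsilon>)) \<and> (\<forall>(y, n) \<in> dag_instances.
        length (F (pair_enc y (unary n))) \<le> poly p n \<and> length (F (pair_enc y (unary n))) \<le> sz n \<and>
        (F (pair_enc y (unary n)) \<in> R \<longleftrightarrow> (y, n) \<in> directed_linear_spanner f\<^sub>\<alpha> f\<^sub>\<beta>))"
    using compr unfolding admits_poly_compression_def by (elim exE)
  have pF: "poly_time F" and O: "(\<lambda>n. real (sz n)) \<in> O(\<lambda>n. real n powr (2 - \<epsilon>))"
    by (rule conjunct1[OF h], rule conjunct1[OF conjunct2[OF h]])
  have F: "length (F (pair_enc y (unary n))) \<le> sz n \<and>
      (F (pair_enc y (unary n)) \<in> R \<longleftrightarrow> (y, n) \<in> directed_linear_spanner f\<^sub>\<alpha> f\<^sub>\<beta>)"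
    if "(y, n) \<in> dag_instances" for y n
    using bspec[OF conjunct2[OF conjunct2[OF h]] that] by simp
  obtain vars \<Phi> X where cl: "\<And>m. finite (vars m)" "\<And>m. finite (\<Phi> m)"
    "\<And>m C. C \<in> \<Phi> m \<Longrightarrow> C \<noteq> {} \<and> fst ` C \<subseteq> (vars m :: cvar set)"
    "\<And>m l. l < m \<Longrightarrow> X m l \<in> vars m"
    "poly_bounded (\<lambda>m. card (vars m))" "poly_bounded (\<lambda>m. card (\<Phi> m))"
    "\<And>x. x \<in> L \<longleftrightarrow> (\<exists>\<alpha>. sat \<alpha> (\<Phi> (length x)) \<and> (\<forall>l < length x. \<alpha> (X (length x) l) = x ! l))"
  proof (rule cook_levin[OF L], goal_cases)
    case (1 vars \<Phi> X)
    show ?case by (rule 1(1)[OF 1(2-)])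
  qed
  obtain c e where e: "e \<ge> (1 :: nat)"
    "\<And>q s n. q \<ge> 1 \<Longrightarrow> s = (q + c) ^ e \<Longrightarrow> s \<le> n \<Longrightarrow> n \<le> s * q \<Longrightarrow> sz n \<le> s * s"
    using size_bound[OF O \<epsilon>] by blast
  \<comment> \<open>The number of vertices is at most \<open>s m * q m\<close>, and
    \<open>q m\<close> does not refer to \<open>s m\<close>; so \<open>s m\<close> can be chosen
    afterwards as a power of \<open>q m + c\<close>.\<close>
  define q where "q m = 3 + b * (2 * card (vars m) + 3) + card (\<Phi> m) + card (vars m) + 2 * m" for m
  define s where "s m = (q m + c) ^ e" for m
  have q1: "q m \<ge> 1" for m by (simp add: q_def)
  have s1: "s m \<ge> 1" for m using q1[of m] by (simp add: s_def)
  have pq: "poly_bounded q" unfolding q_def by (intro poly_bounded_intros cl)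
  have ps: "poly_bounded s" unfolding s_def by (intro poly_bounded_intros pq)
  interpret si: spanner_instance "vars m" "\<Phi> m" "X m" m "s m" b for m
    by unfold_locales (use cl b in auto)
  interpret tp: template "s m" m "si.N m" "si.Y m" "si.bp m" for m
    by (rule si.template_Y)
  have n_le: "si.n m \<le> s m * q m" for m
  proof -
    have "si.n m \<le> s m + b * (2 * (card (vars m) + s m) + 1) + (card (\<Phi> m) + 1 + (card (vars m) + s m) + 2 * s m * m)"
      using si.n_le[of m] si.card_C[of m] si.card_base[of m] si.card_P[of m] si.card_Vs[of m] by simp
    also have "\<dots> \<le> s m * q m"
    proof -
      have le: "z \<le> s m * z" for z using s1[of m] by simp
      have "b * (2 * (card (vars m) + s m) + 1) = b * (2 * card (vars m)) + 2 * (s m * b) + b"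
        by (simp add: algebra_simps)
      also have "\<dots> \<le> s m * (b * (2 * card (vars m))) + 2 * (s m * b) + s m * b"
        using le[of "b * (2 * card (vars m))"] le[of b] by linarith
      also have "\<dots> = s m * (b * (2 * card (vars m) + 3))" by (simp add: algebra_simps)
      finally have 1: "b * (2 * (card (vars m) + s m) + 1) \<le> s m * (b * (2 * card (vars m) + 3))" .
      have 2: "card (\<Phi> m) \<le> s m * card (\<Phi> m)" "card (vars m) \<le> s m * card (vars m)" using le by blast+
      have "s m * q m = 3 * s m + s m * (b * (2 * card (vars m) + 3)) + s m * card (\<Phi> m) + s m * card (vars m) + 2 * s m * m"
        by (simp add: q_def algebra_simps)
      then show ?thesis using 1 2 s1[of m] by linarith
    qed
    finally show ?thesis .
  qed
  have sz: "sz (si.n m) \<le> s m * s m" for m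
    by (rule e(2)[OF q1 s_def]) (use n_le si.n_ge[of m] in auto)
  have len_FY: "length (F (si.Y m x)) \<le> s m * s m" for m x
    using F[OF si.in_dag_instances[of m x]] sz[of m] by (simp add: si.Y_def)
  have FY: "F (si.Y m x) \<in> R \<longleftrightarrow> (\<exists>i < s m. \<exists>j < s m. x i j \<in> L)"
    if lx: "\<forall>i < s m. \<forall>j < s m. length (x i j) = m" for m x
  proof -
    have "F (si.Y m x) \<in> R \<longleftrightarrow> (instance_enc (si.D m x) (si.k m), si.n m) \<in> directed_linear_spanner f\<^sub>\<alpha> f\<^sub>\<beta>"
      using F[OF si.in_dag_instances[of m x]] by (simp add: si.Y_def)
    also have "\<dots> \<longleftrightarrow> (\<exists>i < s m. \<exists>j < s m. \<exists>\<alpha>. sat \<alpha> (\<Phi> m) \<and> (\<forall>l < m. \<alpha> (X m l) = x i j ! l))"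
      by (rule si.in_directed_linear_spanner_iff) (use g in auto)
    also have "\<dots> \<longleftrightarrow> (\<exists>i < s m. \<exists>j < s m. x i j \<in> L)"
    proof -
      have "x i j \<in> L \<longleftrightarrow> (\<exists>\<alpha>. sat \<alpha> (\<Phi> m) \<and> (\<forall>l < m. \<alpha> (X m l) = x i j ! l))" if "i < s m" "j < s m" for i j
        using cl(7)[of "x i j"] lx that by simp
      then show ?thesis by blast
    qed
    finally show ?thesis .
  qed
  define N0 where "N0 m = {z :: bool list. length z = m \<and> z \<notin> L}" for m
  have fin0: "finite (N0 m)" and c0: "card (N0 m) \<le> 2 ^ m" for m
  proof -
    have sub: "N0 m \<subseteq> {z. set z \<subseteq> (UNIV :: bool set) \<and> length z = m}" by (auto simp: N0_def)
    show "finite (N0 m)" by (rule finite_subset[OF sub]) (rule finite_lists_length_eq, simp)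
    have "card (N0 m) \<le> card {z. set z \<subseteq> (UNIV :: bool set) \<and> length z = m}"
      by (rule card_mono[OF _ sub]) (rule finite_lists_length_eq, simp)
    also have "\<dots> = 2 ^ m" by (subst card_lists_length_eq) simp_all
    finally show "card (N0 m) \<le> 2 ^ m" .
  qed
  define cov where "cov m t z = (\<exists>x. (\<forall>i < s m. \<forall>j < s m. length (x i j) = m) \<and>
    x (fst t) (fst (snd t)) = z \<and> F (si.Y m x) = snd (snd t))" for m and t :: "nat \<times> nat \<times> bool list" and z
  \<comment> \<open>A certificate guesses arbitrary words of length \<open>m\<close>, as in
    \<open>cov\<close>; that they are nonmembers is not checked. Soundness comes from the triple
    instead: its output is also that of some tuple of nonmembers.\<close>
  define good where "good m = {t. fst t < s m \<and> fst (snd t) < s m \<and>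
    (\<exists>x. (\<forall>i < s m. \<forall>j < s m. x i j \<in> N0 m) \<and> F (si.Y m x) = snd (snd t))}" for m
  have ex: "\<exists>cs. length cs \<le> 3 * m + 1 \<and> set cs \<subseteq> good m \<and> (\<forall>z \<in> N0 m. \<exists>t \<in> set cs. cov m t z)" for m
  proof (rule greedy_cover[OF fin0])
    have "(3 :: nat) ^ (3 * m + 1) * card (N0 m) \<le> 3 ^ (3 * m + 1) * 2 ^ m" using c0 by (rule mult_le_mono2)
    also have "\<dots> < 4 ^ (3 * m + 1)" by (rule rounds_bound)
    finally show "3 ^ (3 * m + 1) * card (N0 m) < 4 ^ (3 * m + 1)" .
  next
    fix N' assume N': "N' \<subseteq> N0 m" "N' \<noteq> {}"
    have f': "finite N'" using N'(1) fin0 by (rule finite_subset)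
    obtain i0 j0 y x where ij: "i0 < s m" "j0 < s m" and x: "\<forall>i < s m. \<forall>j < s m. x i j \<in> N'" "F (si.Y m x) = y"
      and card: "card N' \<le> 4 * card {z \<in> N'. \<exists>x. (\<forall>i < s m. \<forall>j < s m. x i j \<in> N') \<and> x i0 j0 = z \<and> F (si.Y m x) = y}"
      using one_round[OF f' N'(2) s1[of m] len_FY, of "\<lambda>x. x"] by blast
    have "(i0, j0, y) \<in> good m" using ij x N'(1) unfolding good_def by auto
    moreover have "{z \<in> N'. \<exists>x. (\<forall>i < s m. \<forall>j < s m. x i j \<in> N') \<and> x i0 j0 = z \<and> F (si.Y m x) = y} \<subseteq>
        {z \<in> N'. cov m (i0, j0, y) z}"
    proof (intro Collect_mono impI, elim conjE exE)
      fix z x assume "z \<in> N'" and x: "\<forall>i < s m. \<forall>j < s m. x i j \<in> N'" "x i0 j0 = z" "F (si.Y m x) = y"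
      moreover have "\<forall>i < s m. \<forall>j < s m. length (x i j) = m" using x(1) N'(1) by (auto simp: N0_def)
      ultimately show "z \<in> N' \<and> cov m (i0, j0, y) z" unfolding cov_def by auto
    qed
    then have "card {z \<in> N'. \<exists>x. (\<forall>i < s m. \<forall>j < s m. x i j \<in> N') \<and> x i0 j0 = z \<and> F (si.Y m x) = y} \<le>
        card {z \<in> N'. cov m (i0, j0, y) z}"
      using f' by (intro card_mono) auto
    ultimately show "\<exists>t \<in> good m. card N' \<le> 4 * card {z \<in> N'. cov m t z}"
      using card by (intro bexI[of _ "(i0, j0, y)"]) auto
  qed
  obtain its where its': "\<forall>m. length (its m) \<le> 3 * m + 1 \<and> set (its m) \<subseteq> good m \<and>
      (\<forall>z \<in> N0 m. \<exists>t \<in> set (its m). cov m t z)"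
  proof -
    have "\<forall>m. \<exists>cs. length cs \<le> 3 * m + 1 \<and> set cs \<subseteq> good m \<and> (\<forall>z \<in> N0 m. \<exists>t \<in> set cs. cov m t z)"
      using ex by (rule allI)
    from choice[OF this] show thesis using that by (elim exE)
  qed
  have its: "\<And>m. length (its m) \<le> 3 * m + 1" "\<And>m. set (its m) \<subseteq> good m"
    "\<And>m z. z \<in> N0 m \<Longrightarrow> \<exists>t \<in> set (its m). cov m t z" using its' by simp_all
  define B where "B m = map (\<lambda>t. (tp.tmpl m (fst t) (fst (snd t)), snd (snd t))) (its m)" for m
  define a where "a m = enc_syms (blocks (B m) @ [8])" for m
  have goodD: "fst t < s m" "fst (snd t) < s m" "\<exists>x. (\<forall>i < s m. \<forall>j < s m. x i j \<in> N0 m) \<and> F (si.Y m x) = snd (snd t)"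
    if "t \<in> set (its m)" for t m
    using that its(2)[of m] unfolding good_def by blast+
  have Bok: "\<forall>t \<in> set (B m). set (fst t) \<subseteq> {1..5}" "\<forall>t \<in> set (B m). count_list (fst t) 4 \<le> m" for m
    unfolding B_def using tp.tmpl_set goodD by (auto simp: tp.tmpl_count)
  define W where "W = {z. \<exists>w. length w \<le> length z \<and> accepts F (pair_enc z w)}"
  have W_NP: "W \<in> NP"
    unfolding NP_def
  proof (intro CollectI bexI exI allI)
    show "{v. accepts F v} \<in> class_P" by (rule accepts_in_P[OF pF])
    show "z \<in> W \<longleftrightarrow> (\<exists>w. length w \<le> poly [:0, 1:] (length z) \<and> pair_enc z w \<in> {v. accepts F v})" for z
      by (simp add: W_def)
  qed
  have iff: "pair_enc x (a (length x)) \<in> W \<longleftrightarrow> x \<notin> L" for x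
  proof -
    define m where "m = length x"
    have "pair_enc x (a m) \<in> W \<longleftrightarrow> (\<exists>t \<in> set (B m). \<exists>Y. fits (fst t) x Y \<and> F Y = snd t)"
      unfolding W_def mem_Collect_eq
      by (rule ex_witness_iff) (use Bok[of m] in \<open>auto simp: a_def m_def\<close>)
    also have "\<dots> \<longleftrightarrow> (\<exists>t \<in> set (its m). \<exists>Y. fits (tp.tmpl m (fst t) (fst (snd t))) x Y \<and> F Y = snd (snd t))"
      by (simp add: B_def)
    also have "\<dots> \<longleftrightarrow> (\<exists>t \<in> set (its m). cov m t x)"
    proof (rule bex_cong[OF refl])
      fix t assume t: "t \<in> set (its m)"
      show "(\<exists>Y. fits (tp.tmpl m (fst t) (fst (snd t))) x Y \<and> F Y = snd (snd t)) \<longleftrightarrow> cov m t x"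
        unfolding tp.fits_tmpl[OF goodD(1,2)[OF t] m_def[symmetric]] cov_def by blast
    qed
    also have "\<dots> \<longleftrightarrow> x \<notin> L"
    proof
      assume "\<exists>t \<in> set (its m). cov m t x"
      then obtain t where t: "t \<in> set (its m)" "cov m t x" by blast
      obtain x1 where x1: "\<forall>i < s m. \<forall>j < s m. length (x1 i j) = m" "x1 (fst t) (fst (snd t)) = x"
        "F (si.Y m x1) = snd (snd t)" using t(2) unfolding cov_def by blast
      \<comment> \<open>The tuple \<open>x2\<close> shows that the common output is not in
        \<open>R\<close>; as \<open>x1\<close> has the same output, it contains no member of
        \<open>L\<close> either.\<close>
      obtain x2 where x2: "\<forall>i < s m. \<forall>j < s m. x2 i j \<in> N0 m" "F (si.Y m x2) = snd (snd t)"
        using goodD(3)[OF t(1)] by blast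
      have "F (si.Y m x2) \<notin> R" using FY[of m x2] x2(1) by (auto simp: N0_def)
      then have "F (si.Y m x1) \<notin> R" using x1(3) x2(2) by simp
      then have "\<not> (\<exists>i < s m. \<exists>j < s m. x1 i j \<in> L)" using FY[OF x1(1)] by simp
      then show "x \<notin> L" using x1(2) goodD(1,2)[OF t(1)] by blast
    next
      assume "x \<notin> L"
      then have "x \<in> N0 m" by (simp add: N0_def m_def)
      then show "\<exists>t \<in> set (its m). cov m t x" by (rule its(3))
    qed
    finally show ?thesis unfolding m_def .
  qed
  have "poly_bounded (\<lambda>m. length (a m))"
  proof (rule poly_bounded_mono)
    have pP: "poly_bounded (\<lambda>m. card (si.P m))"
      unfolding si.card_P si.card_Vs by (intro poly_bounded_intros cl ps)
    have pb: "poly_bounded (\<lambda>m. card (si.base m))"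
      by (rule poly_bounded_mono[OF _ si.card_base]) (unfold si.card_Vs, intro poly_bounded_intros cl ps)
    have pk: "poly_bounded (\<lambda>m. length (binary (si.k m)))"
    proof (rule poly_bounded_mono)
      show "length (binary (si.k m)) \<le> s m * (card (si.P m) + card (si.base m) + s m * m) + 1" for m
        by (rule order_trans[OF length_binary]) (simp add: si.k_def)
    qed (intro poly_bounded_intros pP pb ps)
    have pn: "poly_bounded (\<lambda>m. si.n m)"
      by (rule poly_bounded_mono[OF _ n_le]) (intro poly_bounded_intros ps pq)
    have pN: "poly_bounded (\<lambda>m. si.N m)"
      by (rule poly_bounded_mono[OF _ si.N_le]) (intro poly_bounded_intros pn pk)
    show "poly_bounded (\<lambda>m. 9 * ((3 * m + 1) * (2 + si.N m + s m * s m) + 1))"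
      by (intro poly_bounded_intros pN ps)
    fix m
    have bl: "length (block t) \<le> 2 + si.N m + s m * s m" if t: "t \<in> set (B m)" for t
    proof -
      obtain u where u: "u \<in> set (its m)" "t = (tp.tmpl m (fst u) (fst (snd u)), snd (snd u))"
        using t unfolding B_def by auto
      obtain x where "F (si.Y m x) = snd (snd u)" using goodD(3)[OF u(1)] by (elim exE conjE)
      then have "length (snd (snd u)) \<le> s m * s m" using len_FY[of m x] by simp
      then show ?thesis by (simp add: block_def u(2) tp.tmpl_nth)
    qed
    have "length (a m) \<le> 9 * length (blocks (B m) @ [8])"
      unfolding a_def by (rule length_enc_syms_le) (use set_blocks(2)[OF Bok(1)] in fastforce)
    also have "\<dots> \<le> 9 * (length (B m) * (2 + si.N m + s m * s m) + 1)"
      using length_blocks_le[of "B m", OF bl] by simp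
    also have "\<dots> \<le> 9 * ((3 * m + 1) * (2 + si.N m + s m * s m) + 1)"
      using its(1)[of m] by (intro mult_le_mono2 add_mono mult_le_mono1 order_refl) (simp add: B_def)
    finally show "length (a m) \<le> 9 * ((3 * m + 1) * (2 + si.N m + s m * s m) + 1)" .
  qed
  then obtain pa :: "nat poly" where pa: "\<forall>m. length (a m) \<le> poly pa m"
    unfolding poly_bounded_def by blast
  have "- W \<in> coNP" using W_NP by (simp add: coNP_def)
  moreover have "\<forall>x. x \<in> L \<longleftrightarrow> pair_enc x (a (length x)) \<in> - W" using iff by simp
  ultimately show ?thesis unfolding with_poly_advice_def using pa by blast
qed

theorem theorem1:
  fixes f\<^sub>\<alpha> f\<^sub>\<beta> :: "nat \<Rightarrow> real"
  assumes "\<And>n. 0 \<le> f\<^sub>\<alpha> n" and "\<And>n. 0 \<le> f\<^sub>\<beta> n"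
    and "mono f\<^sub>\<alpha>" and "mono f\<^sub>\<beta>"
    and "computable_nonneg_real f\<^sub>\<alpha>" and "computable_nonneg_real f\<^sub>\<beta>"
    and "1 \<le> f\<^sub>\<alpha> 1" and "2 \<le> f\<^sub>\<alpha> 1 + f\<^sub>\<beta> 1"
    and "\<not> NP \<subseteq> with_poly_advice coNP"
  shows "\<forall>\<epsilon> :: real. \<epsilon> > 0 \<longrightarrow>
    \<not> admits_poly_compression UNIV (directed_linear_spanner f\<^sub>\<alpha> f\<^sub>\<beta>) (\<lambda>n. real n powr (2 - \<epsilon>)) \<and>
    \<not> admits_poly_compression dag_instances (directed_linear_spanner f\<^sub>\<alpha> f\<^sub>\<beta>) (\<lambda>n. real n powr (2 - \<epsilon>))"
proof (intro allI impI)
  fix \<epsilon> :: real assume \<epsilon>: "\<epsilon> > 0"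
  define b where "b = nat \<lfloor>f\<^sub>\<alpha> 1 + f\<^sub>\<beta> 1\<rfloor>"
  have b: "b \<ge> 2" using assms(8) by (simp add: b_def le_nat_iff le_floor_iff)
  have bB: "real b \<le> f\<^sub>\<alpha> 1 + f\<^sub>\<beta> 1" using assms(8) by (simp add: b_def)
  have k: "k \<le> b" if "real k \<le> f\<^sub>\<alpha> 1 + f\<^sub>\<beta> 1" for k
    using that by (simp add: b_def le_nat_iff le_floor_iff)
  \<comment> \<open>One arc gets the bound \<open>f\<^sub>\<alpha> 1 + f\<^sub>\<beta> 1\<close>,
    and every further arc adds \<open>f\<^sub>\<alpha> 1 \<ge> 1\<close>; monotonicity then replaces
    the argument \<open>1\<close> by \<open>d\<close>.\<close>
  have d: "real (b + d - 1) \<le> f\<^sub>\<alpha> d * real d + f\<^sub>\<beta> d" if "d \<ge> 1" for d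
  proof -
    have "real (b + d - 1) = real b + (real d - 1)" using that b by simp
    also have "\<dots> \<le> f\<^sub>\<alpha> 1 + f\<^sub>\<beta> 1 + f\<^sub>\<alpha> 1 * (real d - 1)"
      using bB assms(7) that mult_right_mono[of 1 "f\<^sub>\<alpha> 1" "real d - 1"] by simp
    also have "\<dots> = f\<^sub>\<alpha> 1 * real d + f\<^sub>\<beta> 1" by (simp add: algebra_simps)
    also have "\<dots> \<le> f\<^sub>\<alpha> d * real d + f\<^sub>\<beta> d"
      using that monoD[OF assms(3) that] monoD[OF assms(4) that] by (intro add_mono mult_right_mono) auto
    finally show ?thesis .
  qed
  have dag: "\<not> admits_poly_compression dag_instances (directed_linear_spanner f\<^sub>\<alpha> f\<^sub>\<beta>) (\<lambda>n. real n powr (2 - \<epsilon>))"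
    using compression_imp_coNP_poly[OF b assms(2) d k \<epsilon>] assms(9) by blast
  \<comment> \<open>A compression for all inputs works in particular for the acyclic ones, so the
    unrestricted claim follows from the restricted one.\<close>
  moreover have "admits_poly_compression dag_instances (directed_linear_spanner f\<^sub>\<alpha> f\<^sub>\<beta>) (\<lambda>n. real n powr (2 - \<epsilon>))"
    if univ: "admits_poly_compression UNIV (directed_linear_spanner f\<^sub>\<alpha> f\<^sub>\<beta>) (\<lambda>n. real n powr (2 - \<epsilon>))"
  proof -
    obtain R :: language and F and p :: "nat poly" and sz where
      h: "poly_time F \<and> (\<lambda>n. real (sz n)) \<in> O(\<lambda>n. real n powr (2 - \<epsilon>)) \<and> (\<forall>(y, n) \<in> UNIV.
        length (F (pair_enc y (unary n))) \<le> poly p n \<and> length (F (pair_enc y (unary n))) \<le> sz n \<and>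
        (F (pair_enc y (unary n)) \<in> R \<longleftrightarrow> (y, n) \<in> directed_linear_spanner f\<^sub>\<alpha> f\<^sub>\<beta>))"
      using univ unfolding admits_poly_compression_def by (elim exE)
    show ?thesis unfolding admits_poly_compression_def
      by (intro exI[of _ R] exI[of _ F] exI[of _ p] exI[of _ sz]) (use h in simp)
  qed
  ultimately show "\<not> admits_poly_compression UNIV (directed_linear_spanner f\<^sub>\<alpha> f\<^sub>\<beta>) (\<lambda>n. real n powr (2 - \<epsilon>)) \<and>
    \<not> admits_poly_compression dag_instances (directed_linear_spanner f\<^sub>\<alpha> f\<^sub>\<beta>) (\<lambda>n. real n powr (2 - \<epsilon>))"
    by blast
qed

end
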